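(* Let $\alpha,\beta$ be integers with $\beta\neq 1$, $\alpha\equiv 7\pmod 9$ and $\beta\equiv 1\pmod 9$, and let $n=v_3(\beta-1)$. Then $|G_3|=3^{n+4}$, the nilpotency class of $G_3$ is $3$, $o(a)=9$, $o(b)=3^{n+1}$ and $o(c)=3$.
   Context: $G(\alpha,\beta)=\langle A,B\mid A^{[A,B]}=A^{\alpha},\ B^{[B,A]}=B^{\beta}\rangle$ with $[x,y]=x^{-1}y^{-1}xy$, $y^x=x^{-1}yx$, and $C=[A,B]$. The group $G(\alpha,\beta)$ is finite and nilpotent, hence the direct product of its Sylow subgroups; $G_3$ denotes its Sylow $3$-subgroup and $a,b,c$ denote the images of $A,B,C$ under the canonical projection $G(\alpha,\beta)\to G_3$. $v_3$ is the $3$-adic valuation and $o(x)$ the order of $x$. *)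

theory Defs
  imports "HOL-Algebra.Algebra" "HOL-Computational_Algebra.Factorial_Ring"
begin

text \<open>Letters: (g, e) with g = False for A, g = True for B; e = True means inverse.\<close>
type_synonym letter = "bool \<times> bool"

definition linv :: "letter \<Rightarrow> letter" where
  "linv x = (fst x, \<not> snd x)"

definition winv :: "letter list \<Rightarrow> letter list" where
  "winv w = rev (map linv w)"

definition wpow :: "letter list \<Rightarrow> int \<Rightarrow> letter list" where
  "wpow w k = (if k \<ge> 0 then concat (replicate (nat k) w)
               else concat (replicate (nat (- k)) (winv w)))"

definition wA :: "letter list" where "wA = [(False, False)]"
definition wB :: "letter list" where "wB = [(True, False)]"
definition wC :: "letter list" where "wC = winv wA @ winv wB @ wA @ wB"

text \<open>Congruence on words generated by free cancellation and the two defining relations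
  A^[A,B] = A^alpha, i.e. C^-1 A C = A^alpha, and B^[B,A] = B^beta, i.e. C B C^-1 = B^beta
  (since [B,A] = C^-1).\<close>
inductive weq :: "int \<Rightarrow> int \<Rightarrow> letter list \<Rightarrow> letter list \<Rightarrow> bool" for \<alpha> \<beta> where
  rel1: "weq \<alpha> \<beta> (winv wC @ wA @ wC) (wpow wA \<alpha>)"
| rel2: "weq \<alpha> \<beta> (wC @ wB @ winv wC) (wpow wB \<beta>)"
| cancel: "weq \<alpha> \<beta> [x, linv x] []"
| refl: "weq \<alpha> \<beta> w w"
| sym: "weq \<alpha> \<beta> u v \<Longrightarrow> weq \<alpha> \<beta> v u"
| trans: "weq \<alpha> \<beta> u v \<Longrightarrow> weq \<alpha> \<beta> v w \<Longrightarrow> weq \<alpha> \<beta> u w"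
| ctxt: "weq \<alpha> \<beta> u v \<Longrightarrow> weq \<alpha> \<beta> (p @ u @ q) (p @ v @ q)"

definition wclass :: "int \<Rightarrow> int \<Rightarrow> letter list \<Rightarrow> letter list set" where
  "wclass \<alpha> \<beta> w = {v. weq \<alpha> \<beta> w v}"

definition wmult :: "int \<Rightarrow> int \<Rightarrow> letter list set \<Rightarrow> letter list set \<Rightarrow> letter list set" where
  "wmult \<alpha> \<beta> U V = {v. \<exists>x\<in>U. \<exists>y\<in>V. weq \<alpha> \<beta> (x @ y) v}"

definition presG :: "int \<Rightarrow> int \<Rightarrow> letter list set monoid" where
  "presG \<alpha> \<beta> = \<lparr> carrier = range (wclass \<alpha> \<beta>),
     monoid.mult = wmult \<alpha> \<beta>, one = wclass \<alpha> \<beta> [] \<rparr>"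

text \<open>In a finite nilpotent group the Sylow p-subgroup is the set of p-elements.\<close>
definition pelems :: "nat \<Rightarrow> ('a, 'b) monoid_scheme \<Rightarrow> 'a set" where
  "pelems p G = {g \<in> carrier G. \<exists>k. group.ord G g = p ^ k}"

text \<open>The p-part of g: the unique p-element x commuting with a p'-element y with g = x y.
  In a finite nilpotent group this is the canonical projection onto the Sylow p-subgroup.\<close>
definition ppart :: "nat \<Rightarrow> ('a, 'b) monoid_scheme \<Rightarrow> 'a \<Rightarrow> 'a" where
  "ppart p G g = (THE x. x \<in> carrier G \<and> (\<exists>k. group.ord G x = p ^ k) \<and>
      (\<exists>y \<in> carrier G. coprime (group.ord G y) p \<and> x \<otimes>\<^bsub>G\<^esub> y = g
                     \<and> x \<otimes>\<^bsub>G\<^esub> y = y \<otimes>\<^bsub>G\<^esub> x))"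

definition commsub :: "('a, 'b) monoid_scheme \<Rightarrow> 'a set \<Rightarrow> 'a set \<Rightarrow> 'a set" where
  "commsub G U V = generate G {inv\<^bsub>G\<^esub> x \<otimes>\<^bsub>G\<^esub> inv\<^bsub>G\<^esub> y \<otimes>\<^bsub>G\<^esub> x \<otimes>\<^bsub>G\<^esub> y | x y. x \<in> U \<and> y \<in> V}"

text \<open>Lower central series, 0-indexed: lcs G 0 = G = gamma_1, lcs G (Suc i) = [lcs G i, G].\<close>
fun lcs :: "('a, 'b) monoid_scheme \<Rightarrow> nat \<Rightarrow> 'a set" where
  "lcs G 0 = carrier G"
| "lcs G (Suc i) = commsub G (lcs G i) (carrier G)"

definition nilpotency_class_is :: "('a, 'b) monoid_scheme \<Rightarrow> nat \<Rightarrow> bool" where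
  "nilpotency_class_is G c \<longleftrightarrow> lcs G c = {\<one>\<^bsub>G\<^esub>} \<and> (\<forall>i<c. lcs G i \<noteq> {\<one>\<^bsub>G\<^esub>})"

end

theory Submission
  imports Defs "HOL-Number_Theory.Residues"
begin

text \<open>
  \<^bold>\<open>Finiteness.\<close> Conjugating \<open>A\<^sup>C = A\<^sup>\<alpha>\<close> by \<open>B\<close> exhibits a non-zero power of \<open>B\<close> as a product
  \<open>C\<^sup>N A\<^sup>x C\<^sup>M\<close>; its commutator with \<open>C\<close> shows that some power of \<open>B\<close> is a power of \<open>A\<close>, hence
  central, hence of finite order. Then \<open>C\<close> and \<open>A\<close> have finite order as well.

  \<^bold>\<open>Nilpotency.\<close> Every prime dividing the order of \<open>A\<close> divides \<open>\<alpha> - 1\<close>: if \<open>q\<close> is the largest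
  exception, a suitable power \<open>A\<^sup>k\<close> of order \<open>q\<close> is conjugate to \<open>C\<^sup>k\<close>, and then lies in
  \<open>\<langle>A\<rangle> \<inter> \<langle>B\<rangle>\<close>, so it is central and killed by \<open>\<alpha> - 1\<close>. Consequently adjoining
  \<open>C\<^sup>k\<close>, \<open>A\<^sup>k\<close>, \<open>B\<^sup>k\<close> successively to the normal subgroup generated by the \<open>kp\<close>-th powers gives
  normal subgroups, and along such chains one finds a normal subgroup of \<open>3\<close>-power exponent and one
  of exponent prime to \<open>3\<close> which together generate the group and commute elementwise.

  \<^bold>\<open>Upper bound.\<close> In the \<open>3\<close>-part, the same conjugated relation reads \<open>b\<^sup>y = a\<^sup>z c\<^sup>w\<close> with
  \<open>3\<^bsup>2n\<^esup> | y\<close>, \<open>27 | z\<close> and \<open>w\<close> exactly divisible by \<open>3\<close>. Comparing its commutators with \<open>a\<close>, \<open>b\<close>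
  and \<open>c\<close> forces \<open>a\<^sup>9 = b\<^bsup>3^(n+1)\<^esup> = c\<^sup>3 = 1\<close>, so all elements have the form \<open>a\<^sup>i b\<^sup>j c\<^sup>k\<close>.

  \<^bold>\<open>Lower bound.\<close> An explicit action on triples \<open>(i, j, k)\<close> modulo \<open>9\<close>, \<open>3\<^bsup>n+1\<^esup>\<close>, \<open>3\<close> shows that
  these normal forms are distinct.
\<close>

section \<open>Geometric sums\<close>

text \<open>The sums \<open>geom\<close> come from \<open>A^B = A C\<close>: since \<open>C\<close>
  raises \<open>A\<close> to the power \<alpha>,
  \<open>(A C)^k = C^k A^(\<alpha> * geom \<alpha> k)\<close>, and this is how \<open>B\<close>
  conjugates \<open>A^k\<close>. The obstacle before finiteness is known is that conjugation by
  \<open>C\<close> maps the powers of \<open>A\<close> into themselves, but perhaps not onto. Only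
  positive powers of \<open>C\<close> can be moved, past powers of \<open>A\<close> in one direction
  and past powers of \<open>B\<close> in the other. Hence the natural-number exponents of
  \<open>C\<close>, and the shape \<open>C^N A^x C^M\<close>, in which the two powers of
  \<open>C\<close> cannot be merged. The splitting cannot start from nilpotency, which is what is at
  stake. Two normal subgroups of coprime exponents are enough, because they intersect trivially. The
  3-components are powers \<open>A^i\<close>, \<open>B^i\<close> with one exponent \<open>i\<close>
  congruent to 1 modulo a high power of 3, so a model built for \<open>A\<close> and
  \<open>B\<close> also tests their components.\<close>

definition geom :: "int \<Rightarrow> nat \<Rightarrow> int" where
  "geom t k = (\<Sum>i<k. t ^ i)"

lemma geom_0 [simp]: "geom t 0 = 0"
  by (simp add: geom_def)

lemma geom_Suc: "geom t (Suc k) = geom t k + t ^ k"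
  by (simp add: geom_def)

lemma geom_Suc': "geom t (Suc k) = 1 + t * geom t k"
  by (simp add: geom_def sum.lessThan_Suc_shift sum_distrib_left del: sum.lessThan_Suc)

lemma geom_times: "(t - 1) * geom t k = t ^ k - 1"
  by (simp add: geom_def power_diff_1_eq)

lemma geom_add: "geom t (a + b) = geom t a + t ^ a * geom t b"
  by (induction b) (simp_all add: geom_Suc algebra_simps power_add)

lemma geom_mult: "geom t (a * b) = geom t a * geom (t ^ a) b"
proof (induction b)
  case (Suc b)
  have "geom t (a * Suc b) = geom t (a * b + a)" by (simp add: add.commute)
  then show ?case by (simp only: geom_add Suc geom_Suc power_mult) (simp add: algebra_simps)
qed simp

lemma dvd_geom_one_minus: "t - 1 dvd geom t k - int k"
proof (induction k)
  case (Suc k)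
  have "t - 1 dvd t ^ k - 1"
    by (metis geom_times dvd_triv_left)
  then have "t - 1 dvd (geom t k - int k) + (t ^ k - 1)"
    using Suc by (rule dvd_add[rotated])
  then show ?case by (simp add: geom_Suc algebra_simps)
qed simp

text \<open>Peel one prime \<open>p\<close> off \<open>g\<close>: \<open>geom t (l * p)\<close>
  factors as \<open>geom t l * geom (t ^ l) p\<close>, and the second factor is congruent to
  \<open>p\<close>, hence to 0, modulo \<open>p\<close>.\<close>

lemma dvd_geom:
  assumes "int g dvd int k" "g > 0" "\<And>p. Factorial_Ring.prime p \<Longrightarrow> p dvd g \<Longrightarrow> int p dvd t - 1"
  shows "int g dvd geom t k"
  using assms
proof (induction g arbitrary: k rule: less_induct)
  case (less g)
  show ?case
  proof (cases "g = 1")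
    case False
    then obtain p where p: "Factorial_Ring.prime p" "p dvd g" using prime_factor_nat by blast
    then obtain h where h: "g = p * h" by blast
    have "g dvd k" using less.prems(1) by simp
    then obtain l where "k = p * h * l" using h by blast
    then have l: "k = (h * l) * p" by simp
    have h0: "h > 0" "h < g" using h less.prems(2) prime_gt_1_nat[OF p(1)] by (auto intro: Nat.gr0I)
    have 1: "int h dvd geom t (h * l)"
      by (rule less.IH) (use h0 h less.prems(3) in auto)
    have "int p dvd t - 1" using less.prems(3) p by blast
    then have "int p dvd t ^ (h * l) - 1" by (metis geom_times dvd_mult2)
    then have "int p dvd geom (t ^ (h * l)) p - int p"
      using dvd_geom_one_minus dvd_trans by blast
    then have 2: "int p dvd geom (t ^ (h * l)) p"
      using dvd_add[OF _ dvd_refl] by fastforce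
    have "int (p * h) dvd geom t (h * l) * geom (t ^ (h * l)) p"
      using mult_dvd_mono[OF 1 2] by (simp add: mult.commute)
    then show ?thesis by (simp only: l h geom_mult[of t "h * l" p])
  qed simp
qed

text \<open>Induction by tripling \<open>k\<close>: with \<open>e = t ^ l - 1\<close> the new factor
  is \<open>3 + 3 * e + e * e\<close>, and \<open>3 ^ (n + m)\<close> already divides
  \<open>e\<close>. The coefficient 3 of the linear term raises the exponent by one; in the
  quadratic term \<open>e\<close> itself does so, as \<open>n \<ge> 1\<close>.\<close>

lemma three_power_dvd_geom_diff:
  assumes "3 ^ n dvd t - 1" "n \<ge> 1" "3 ^ m dvd k"
  shows "3 ^ (n + m) dvd geom t k - int k"
  using assms(3)
proof (induction m arbitrary: k)
  case 0
  then show ?case using dvd_trans[OF assms(1) dvd_geom_one_minus] by simp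
next
  case (Suc m)
  then obtain l where l: "k = l * 3" "3 ^ m dvd l"
    by (metis dvd_def mult.assoc mult.commute power_Suc)
  define e where "e = t ^ l - 1"
  have IH: "3 ^ (n + m) dvd geom t l - int l" using Suc.IH l by blast
  then obtain d where d: "geom t l = int l + 3 ^ (n + m) * d"
    by (metis add.commute diff_add_cancel dvdE)
  have "3 ^ m dvd int l" using l(2) by (metis of_nat_dvd_iff of_nat_numeral of_nat_power)
  then have "3 ^ m dvd geom t l"
    unfolding d by (simp add: power_add)
  then have "3 ^ (n + m) dvd e"
    unfolding e_def using assms(1) geom_times[of t l] by (metis mult_dvd_mono power_add)
  then obtain f where f: "e = 3 ^ (n + m) * f" by blast
  have "geom (t ^ l) 3 = 3 + 3 * e + e * e"
    by (simp add: geom_def numeral_3_eq_3 e_def algebra_simps)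
  then have "geom t k - int k = 3 * (3 ^ (n + m) * d) + geom t l * (3 * e + e * e)"
    unfolding l geom_mult d by (simp add: algebra_simps)
  also have "3 * e + e * e = 3 ^ (n + Suc m) * (f + 3 ^ (n + m - 1) * f * f)"
  proof -
    have "(3::int) ^ (n + m) = 3 * 3 ^ (n + m - 1)"
      using assms(2) by (metis add_gr_0 less_le_trans power_eq_if not_gr_zero zero_less_one)
    then show ?thesis unfolding f by (simp add: algebra_simps)
  qed
  also have "3 * (3 ^ (n + m) * d) = 3 ^ (n + Suc m) * d" by simp
  finally show ?case
    by (metis dvd_add dvd_mult dvd_triv_left)
qed

text \<open>Both terms are congruent to \<open>int k * t\<close> modulo \<open>3 ^ (n + m)\<close>.
  Such differences are the exponents left over when a power of \<open>B\<close> (or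
  \<open>A\<close>) is moved past the other generator and past a power of \<open>C\<close>: with
  \<open>j = 1\<close> in the conjugated relation, with \<open>j = 0\<close> in the commutators
  taken from it later.\<close>

lemma three_power_dvd_geom_shift:
  assumes "3 ^ n dvd t - 1" "n \<ge> 1" "3 ^ m dvd k"
  shows "3 ^ (n + m) dvd int k * t ^ (k + j) - t * geom t k"
proof -
  have "3 ^ m dvd int k" using assms(3) by (metis of_nat_dvd_iff of_nat_numeral of_nat_power)
  moreover have "3 ^ n dvd t ^ (k + j) - t"
  proof -
    have "3 ^ n dvd t ^ (k + j) - 1" using assms(1) by (metis geom_times dvd_mult2)
    then have "3 ^ n dvd (t ^ (k + j) - 1) - (t - 1)" using assms(1) by (rule dvd_diff)
    then show ?thesis by simp
  qed
  ultimately have "3 ^ (n + m) dvd int k * (t ^ (k + j) - t)"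
    by (metis mult_dvd_mono power_add mult.commute)
  moreover have "3 ^ (n + m) dvd t * (geom t k - int k)"
    using three_power_dvd_geom_diff[OF assms] by simp
  ultimately have "3 ^ (n + m) dvd int k * (t ^ (k + j) - t) - t * (geom t k - int k)"
    by (rule dvd_diff)
  then show ?thesis by (simp add: algebra_simps)
qed

lemma three_power_dvd_power_minus_one:
  assumes "3 ^ n dvd t - (1::int)" "n \<ge> 1" "3 ^ m dvd k"
  shows "3 ^ (n + m) dvd t ^ k - 1"
proof -
  have "3 ^ m dvd int k" using assms(3) by (metis of_nat_dvd_iff of_nat_numeral of_nat_power)
  moreover have "3 ^ m dvd geom t k - int k"
    using three_power_dvd_geom_diff[OF assms] by (metis dvd_mult_right power_add)
  ultimately have "3 ^ m dvd geom t k" using dvd_add by fastforce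
  then show ?thesis using assms(1) geom_times[of t k] by (metis mult_dvd_mono power_add)
qed

section \<open>Exponents congruent to 7 modulo 9, read modulo 27\<close>

lemma mod_9_eq_7_cases:
  fixes t :: nat
  assumes "t mod 9 = 7"
  obtains r q where "t = r + 27 * q" "r = 7 \<or> r = 16 \<or> r = 25"
proof -
  have "t mod 27 = 7 \<or> t mod 27 = 16 \<or> t mod 27 = 25" using assms by presburger
  then show ?thesis using that[of "t mod 27" "t div 27"] by simp
qed

lemma power_27_multiple:
  assumes "t mod 9 = 7"
  shows "27 dvd int t ^ (27 * q) - 1"
proof -
  have "3 dvd int t - 1" using assms by presburger
  then have "3 ^ (1 + 3) dvd int t ^ (27 * q) - 1"
    by (intro three_power_dvd_power_minus_one) auto
  then show ?thesis by (auto elim: dvd_trans[rotated])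
qed

text \<open>Up to sign and a power of \<alpha>, this is the exponent of \<open>A\<close> in the
  conjugated relation. Here \<open>t\<close> is base and exponent at once; as a multiple of 27 in
  the exponent changes neither \<open>t ^ _\<close> nor \<open>geom t _\<close> modulo 27, only
  \<open>t mod 27\<close> matters in both roles, which leaves 7, 16 and 25.\<close>

lemma dvd_27_relator_exponent:
  fixes t :: nat
  assumes "t mod 9 = 7"
  shows "27 dvd int t ^ (t + 1) - int t * geom (int t) t"
proof -
  obtain r q where t: "t = r + 27 * q" and r: "r = 7 \<or> r = 16 \<or> r = 25"
    using mod_9_eq_7_cases[OF assms] .
  have c1: "[int t = int r] (mod 27)" by (simp add: t cong_def)
  have c2: "[int t ^ (27 * q) = 1] (mod 27)"
    using power_27_multiple[OF assms] by (simp add: cong_iff_dvd_diff)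
  have "3 ^ (1 + 3) dvd geom (int t) (27 * q) - int (27 * q)"
    by (rule three_power_dvd_geom_diff) (use assms in \<open>auto, presburger\<close>)
  then have "27 dvd geom (int t) (27 * q) - 27 * int q"
    by (auto elim: dvd_trans[rotated])
  then have "27 dvd geom (int t) (27 * q)" using dvd_add[OF _ dvd_triv_left[of 27 "int q"]] by fastforce
  then have "[int t ^ r * geom (int t) (27 * q) = 0] (mod 27)" by (simp add: cong_0_iff)
  moreover have "[geom (int t) r = geom (int r) r] (mod 27)"
    unfolding geom_def by (intro cong_sum cong_pow c1)
  ultimately have "[geom (int t) t = geom (int r) r + 0] (mod 27)"
    by (subst (2) t) (simp only: geom_add cong_add)
  moreover have "[int t ^ (t + 1) = int r ^ (r + 1) * 1] (mod 27)"
  proof -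
    have eq: "int t ^ (t + 1) = int t ^ (r + 1) * int t ^ (27 * q)"
      by (subst (2) t) (simp add: power_add mult_ac)
    show ?thesis unfolding eq by (intro cong_mult cong_pow c1 c2)
  qed
  ultimately have "[int t ^ (t + 1) - int t * geom (int t) t
      = int r ^ (r + 1) * 1 - int r * (geom (int r) r + 0)] (mod 27)"
    by (intro cong_diff cong_mult c1)
  moreover have "[int r ^ (r + 1) * 1 - int r * (geom (int r) r + 0) = 0] (mod 27)"
  proof -
    show ?thesis using r by (elim disjE) (simp_all add: cong_0_iff geom_def lessThan_nat_numeral lessThan_Suc)
  qed
  ultimately show ?thesis using cong_trans cong_0_iff by blast
qed

text \<open>The value 10 is \<open>7 ^ 6\<close> modulo 27. What counts is that
  \<open>t ^ w - 1\<close> is divisible by 9 but not by 27: this produces the bound 9 for the order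
  of \<open>a\<close>.\<close>

lemma mod_27_power:
  fixes t :: nat
  assumes "t mod 9 = 7" "w mod 9 = 6"
  shows "[int t ^ w = 10] (mod 27)"
proof -
  obtain r q where t: "t = r + 27 * q" and r: "r = 7 \<or> r = 16 \<or> r = 25"
    using mod_9_eq_7_cases[OF assms(1)] .
  have c1: "[int t = int r] (mod 27)" by (simp add: t cong_def)
  have w: "w = 6 + 9 * (w div 9)" using assms(2) by presburger
  have "3 ^ (1 + 2) dvd int t ^ (9 * (w div 9)) - 1"
    by (rule three_power_dvd_power_minus_one) (use assms in \<open>auto, presburger\<close>)
  then have "[int t ^ (9 * (w div 9)) = 1] (mod 27)"
    by (simp add: cong_iff_dvd_diff)
  then have "[int t ^ w = int r ^ 6 * 1] (mod 27)"
    by (subst w, unfold power_add) (intro cong_mult cong_pow c1)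
  moreover have "[int r ^ 6 * 1 = 10] (mod 27)" using r by (auto simp: cong_def)
  ultimately show ?thesis by (rule cong_trans)
qed

section \<open>Macdonald relations and finiteness of the orders\<close>

context group
begin

lemma inv_cancel_left [simp]:
  assumes "x \<in> carrier G" "y \<in> carrier G"
  shows "inv x \<otimes> (x \<otimes> y) = y" "x \<otimes> (inv x \<otimes> y) = y"
  using assms by (simp_all add: m_assoc[symmetric])

lemma int_pow_inv_eq: "x \<in> carrier G \<Longrightarrow> inv x [^] (k::int) = x [^] (- k)"
  by (simp add: int_pow_inv int_pow_neg)

lemma int_pow_add_left:
  "x \<in> carrier G \<Longrightarrow> y \<in> carrier G \<Longrightarrow>
    x [^] (i::int) \<otimes> (x [^] (j::int) \<otimes> y) = x [^] (i + j) \<otimes> y"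
  by (simp add: int_pow_mult m_assoc)

lemma int_pow_Suc:
  assumes "x \<in> carrier G"
  shows "x [^] int (Suc k) = x [^] int k \<otimes> x" "x [^] int (Suc k) = x \<otimes> x [^] int k"
  using assms int_pow_mult[of x "int k" 1] int_pow_mult[of x 1 "int k"] by (simp_all add: add.commute)

lemma int_pow_commute:
  assumes "x \<in> carrier G"
  shows "x [^] (i::int) \<otimes> x [^] (j::int) = x [^] j \<otimes> x [^] i"
  using assms by (simp add: int_pow_mult[symmetric] add.commute)

text \<open>Conjugation is written as \<open>x y = y z\<close> so that later rewriting is free of
  inverses.\<close>

lemma conj_int_pow:
  assumes [simp]: "x \<in> carrier G" "y \<in> carrier G" "z \<in> carrier G" and eq: "x \<otimes> y = y \<otimes> z"
  shows "x [^] (k::int) \<otimes> y = y \<otimes> z [^] k"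
proof -
  have nat: "x [^] (n::nat) \<otimes> y = y \<otimes> z [^] n" for n
  proof (induction n)
    case (Suc n)
    have "x [^] Suc n \<otimes> y = x [^] n \<otimes> (y \<otimes> z)"
      by (simp add: m_assoc eq)
    also have "\<dots> = y \<otimes> z [^] Suc n"
      by (simp add: m_assoc[symmetric] Suc)
    finally show ?case .
  qed simp
  show ?thesis
  proof (cases k rule: int_cases4)
    case (nonneg n)
    then show ?thesis using nat by (simp add: int_pow_int)
  next
    case (neg n)
    have "inv (x [^] n) \<otimes> (x [^] n \<otimes> y) \<otimes> inv (z [^] n) = inv (x [^] n) \<otimes> (y \<otimes> z [^] n) \<otimes> inv (z [^] n)"
      by (simp only: nat)
    then show ?thesis using neg by (simp add: m_assoc int_pow_neg_int)
  qed
qed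

lemma eq_inv_mult_iff:
  assumes "x \<in> carrier G" "y \<in> carrier G" "z \<in> carrier G"
  shows "x = inv y \<otimes> z \<longleftrightarrow> y \<otimes> x = z"
  using assms by auto

lemma int_pow_cong:
  assumes "x \<in> carrier G" "x [^] (m::int) = \<one>" "[i = j] (mod m)"
  shows "x [^] i = x [^] j"
proof -
  obtain l where "i = j + m * l" using assms(3) by (metis cong_iff_lin cong_sym)
  then show ?thesis using assms by (simp add: int_pow_mult int_pow_pow[symmetric])
qed

lemma int_pow_in_powers:
  assumes "x \<in> carrier G" "x [^] (m::int) = \<one>" "gcd k m dvd i"
  obtains l where "x [^] i = x [^] (k * l)"
proof -
  obtain r s where "r * k + s * m = gcd k m" using bezout_int by blast
  moreover obtain t where "i = gcd k m * t" using assms(3) by blast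
  ultimately have "i = (r * k + s * m) * t" by simp
  then have "i - k * (r * t) = m * (s * t)" by (simp add: algebra_simps)
  then have "[i = k * (r * t)] (mod m)" by (simp add: cong_iff_dvd_diff)
  then show ?thesis using that int_pow_cong assms by blast
qed

end

definition gcomm :: "('a, 'b) monoid_scheme \<Rightarrow> 'a \<Rightarrow> 'a \<Rightarrow> 'a" where
  "gcomm G x y = inv\<^bsub>G\<^esub> x \<otimes>\<^bsub>G\<^esub> inv\<^bsub>G\<^esub> y \<otimes>\<^bsub>G\<^esub> x \<otimes>\<^bsub>G\<^esub> y"

lemma (in group) gcomm_closed [simp]:
  "x \<in> carrier G \<Longrightarrow> y \<in> carrier G \<Longrightarrow> gcomm G x y \<in> carrier G"
  by (simp add: gcomm_def)

lemma (in group) inv_gcomm: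
  "x \<in> carrier G \<Longrightarrow> y \<in> carrier G \<Longrightarrow> inv (gcomm G x y) = gcomm G y x"
  by (simp add: gcomm_def inv_mult_group m_assoc)

lemma (in group) mult_gcomm:
  "x \<in> carrier G \<Longrightarrow> y \<in> carrier G \<Longrightarrow> y \<otimes> (x \<otimes> gcomm G x y) = x \<otimes> y"
  by (simp add: gcomm_def m_assoc)

text \<open>Only the relations are recorded, so that the results apply to the generators of the
  presented group, to their 3-components, to the same elements inside the Sylow subgroup, to
  \<alpha> and \<beta> reduced modulo a power of 3, and, by symmetry, with \<open>A\<close> and
  \<open>B\<close> exchanged.\<close>

locale macdonald = group G for G (structure) +
  fixes A B :: 'a and \<alpha> \<beta> :: int
  assumes A_closed [simp]: "A \<in> carrier G" and B_closed [simp]: "B \<in> carrier G"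
    and rel_A: "inv gcomm G A B \<otimes> A \<otimes> gcomm G A B = A [^] \<alpha>"
    and rel_B: "gcomm G A B \<otimes> B \<otimes> inv gcomm G A B = B [^] \<beta>"
begin

abbreviation C where "C \<equiv> gcomm G A B"

lemma gcomm_swap: "gcomm G B A = inv C"
  by (simp add: inv_gcomm)

lemma macdonald_swap: "macdonald G B A \<beta> \<alpha>"
proof
  show "inv gcomm G B A \<otimes> B \<otimes> gcomm G B A = B [^] \<beta>"
    "gcomm G B A \<otimes> A \<otimes> inv gcomm G B A = A [^] \<alpha>"
    using rel_A rel_B by (simp_all add: gcomm_swap)
qed simp_all

lemma A_pow_C_pow: "A [^] x \<otimes> C [^] int k = C [^] int k \<otimes> A [^] (x * \<alpha> ^ k)"
proof (induction k arbitrary: x)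
  case (Suc k)
  have "A \<otimes> C = C \<otimes> A [^] \<alpha>" by (simp add: rel_A[symmetric] m_assoc)
  then have 1: "A [^] x \<otimes> C = C \<otimes> A [^] (\<alpha> * x)" for x
    using conj_int_pow[of A C "A [^] \<alpha>" x] by (simp add: int_pow_pow)
  have "C [^] int (Suc k) = C \<otimes> C [^] int k"
    by (rule int_pow_Suc) simp
  then have "A [^] x \<otimes> C [^] int (Suc k) = C \<otimes> (A [^] (\<alpha> * x) \<otimes> C [^] int k)"
    by (simp add: m_assoc[symmetric] 1)
  also have "\<dots> = C \<otimes> C [^] int k \<otimes> A [^] (x * \<alpha> ^ Suc k)"
    by (simp add: Suc m_assoc mult_ac)
  finally show ?case by (simp only: int_pow_Suc(2) gcomm_closed A_closed B_closed)
qed simp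

lemma C_pow_B_pow: "C [^] int k \<otimes> B [^] x = B [^] (x * \<beta> ^ k) \<otimes> C [^] int k"
proof -
  interpret s: macdonald G B A \<beta> \<alpha> by (rule macdonald_swap)
  have "B [^] x \<otimes> inv C [^] int k = inv C [^] int k \<otimes> B [^] (x * \<beta> ^ k)"
    using s.A_pow_C_pow by (simp add: gcomm_swap)
  then have "B [^] x \<otimes> inv (C [^] int k) = inv (C [^] int k) \<otimes> B [^] (x * \<beta> ^ k)"
    by (simp add: int_pow_inv)
  then have "C [^] int k \<otimes> (B [^] x \<otimes> inv (C [^] int k)) \<otimes> C [^] int k
      = C [^] int k \<otimes> (inv (C [^] int k) \<otimes> B [^] (x * \<beta> ^ k)) \<otimes> C [^] int k"
    by (simp only:)
  then show ?thesis by (simp add: m_assoc)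
qed

lemma AC_pow: "(A \<otimes> C) [^] int k = C [^] int k \<otimes> A [^] (\<alpha> * geom \<alpha> k)"
proof (induction k)
  case (Suc k)
  have "(A \<otimes> C) [^] int (Suc k) = C [^] int k \<otimes> (A [^] (\<alpha> * geom \<alpha> k) \<otimes> A [^] (1::int)) \<otimes> C [^] int 1"
    using int_pow_Suc(1)[of "A \<otimes> C" k] by (simp add: Suc m_assoc)
  also have "\<dots> = C [^] int k \<otimes> (A [^] (\<alpha> * geom \<alpha> k + 1) \<otimes> C [^] int 1)"
    by (simp only: int_pow_mult[OF A_closed, symmetric]) (simp add: m_assoc)
  also have "\<dots> = C [^] (int k + int 1) \<otimes> A [^] ((\<alpha> * geom \<alpha> k + 1) * \<alpha>)"
    by (simp only: A_pow_C_pow) (simp add: int_pow_mult m_assoc)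
  finally show ?case by (simp add: geom_Suc' algebra_simps)
qed simp

lemma A_pow_B: "A [^] int k \<otimes> B = B \<otimes> (C [^] int k \<otimes> A [^] (\<alpha> * geom \<alpha> k))"
  using conj_int_pow[of A B "A \<otimes> C" "int k"] by (simp add: AC_pow mult_gcomm)

lemma B_pow_A: "B [^] int k \<otimes> A = A \<otimes> (C [^] (- int k) \<otimes> B [^] (\<beta> * geom \<beta> k))"
proof -
  interpret s: macdonald G B A \<beta> \<alpha> by (rule macdonald_swap)
  show ?thesis using s.A_pow_B[of k] by (simp add: gcomm_swap int_pow_inv_eq)
qed

end

lemma (in group) commute_gcomm:
  assumes [simp]: "x \<in> carrier G" "y \<in> carrier G" "g \<in> carrier G"
    and x: "g \<otimes> x = x \<otimes> g" and y: "g \<otimes> y = y \<otimes> g"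
  shows "g \<otimes> gcomm G x y = gcomm G x y \<otimes> g"
proof -
  have ix: "inv x \<otimes> g = g \<otimes> inv x" and iy: "inv y \<otimes> g = g \<otimes> inv y"
    using conj_int_pow[of x g x "-1"] conj_int_pow[of y g y "-1"] x y by (simp_all add: int_pow_neg)
  have l: "h \<otimes> (g \<otimes> z) = g \<otimes> (h \<otimes> z)" if "h \<otimes> g = g \<otimes> h" "h \<in> carrier G" "z \<in> carrier G" for h z
    using that by (simp add: m_assoc[symmetric])
  show ?thesis
    by (simp add: gcomm_def m_assoc ix iy x[symmetric] y[symmetric]
      l[OF ix] l[OF iy] l[OF x[symmetric]] l[OF y[symmetric]])
qed

section \<open>From the conjugated relation to finite orders\<close>

context macdonald
begin

text \<open>For negative \<open>m\<close> the power of \<open>C\<close> has to stay on the right,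
  since powers of \<open>A\<close> cannot be moved across it. Both signs fit a form whose left power
  of \<open>C\<close> is non-negative.\<close>

lemma AC_pow_int: "\<exists>N. \<exists>x::int. (A \<otimes> C) [^] (m::int) = C [^] int N \<otimes> (A [^] x \<otimes> C [^] (m - int N))"
proof (cases m rule: int_cases4)
  case (nonneg n)
  then show ?thesis
    by (intro exI[of _ n] exI[of _ "\<alpha> * geom \<alpha> n"]) (simp add: AC_pow)
next
  case (neg n)
  have "(A \<otimes> C) [^] m = inv ((A \<otimes> C) [^] int n)" by (simp add: neg int_pow_neg)
  also have "\<dots> = A [^] (- (\<alpha> * geom \<alpha> n)) \<otimes> C [^] m"
    by (simp add: AC_pow inv_mult_group int_pow_neg neg)
  finally show ?thesis
    by (intro exI[of _ 0] exI[of _ "- (\<alpha> * geom \<alpha> n)"]) simp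
qed

lemma C_mult_B_pow: "C \<otimes> B [^] x = B [^] (x * \<beta>) \<otimes> C"
  using C_pow_B_pow[of 1 x] by simp

lemma A_pow_mult_C: "A [^] x \<otimes> C = C \<otimes> A [^] (x * \<alpha>)"
  using A_pow_C_pow[of x 1] by simp

text \<open>This is \<open>A C = C A^\<alpha>\<close> conjugated by \<open>B\<close>, which sends
  \<open>A\<close> to \<open>A C\<close> and, by the second relation, \<open>C\<close> to
  \<open>B^(\<beta> - 1) C\<close>.\<close>

lemma AC_conj: "A \<otimes> (C \<otimes> (B [^] (\<beta> - 1) \<otimes> C)) = B [^] (\<beta> - 1) \<otimes> (C \<otimes> (A \<otimes> C) [^] \<alpha>)"
proof -
  have CB: "C \<otimes> B = B \<otimes> (B [^] (\<beta> - 1) \<otimes> C)"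
  proof -
    have "B [^] \<beta> = B \<otimes> B [^] (\<beta> - 1)"
      using int_pow_mult[of B 1 "\<beta> - 1"] by simp
    then show ?thesis using C_mult_B_pow[of 1] by (simp add: m_assoc)
  qed
  have "A \<otimes> (C \<otimes> B) = A \<otimes> B \<otimes> (B [^] (\<beta> - 1) \<otimes> C)"
    by (simp add: CB m_assoc)
  then have 1: "A \<otimes> (C \<otimes> B) = B \<otimes> (A \<otimes> (C \<otimes> (B [^] (\<beta> - 1) \<otimes> C)))"
    using mult_gcomm[of A B, symmetric] by (simp add: m_assoc)
  have "A \<otimes> (C \<otimes> B) = C \<otimes> (A [^] \<alpha> \<otimes> B)"
    using A_pow_mult_C[of 1] by (simp add: m_assoc[symmetric])
  also have "A [^] \<alpha> \<otimes> B = B \<otimes> (A \<otimes> C) [^] \<alpha>"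
    by (rule conj_int_pow) (simp_all add: mult_gcomm)
  also have "C \<otimes> (B \<otimes> (A \<otimes> C) [^] \<alpha>) = B \<otimes> (B [^] (\<beta> - 1) \<otimes> (C \<otimes> (A \<otimes> C) [^] \<alpha>))"
    by (simp add: m_assoc[symmetric] CB)
  finally show ?thesis unfolding 1 by simp
qed

text \<open>In \<open>AC_conj\<close> the leading \<open>B^k\<close> is brought to the other side as
  \<open>B^(-k)\<close> and moved past \<open>A\<close> by \<open>B_pow_A\<close>. The
  \<open>C^k\<close> that this creates then passes \<open>B^(k * \<beta>)\<close> and multiplies its
  exponent by \<open>\<beta>^k\<close>.\<close>

lemma conj_relation_pos:
  assumes "\<beta> - 1 = int k"
  shows "A \<otimes> (B [^] (int k * \<beta> ^ (k + 1) - \<beta> * geom \<beta> k) \<otimes> C [^] (int k + 2))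
    = C \<otimes> (A \<otimes> C) [^] \<alpha>"
proof -
  let ?g = "\<beta> * geom \<beta> k"
  have BA: "A \<otimes> (B [^] (- ?g) \<otimes> C [^] int k) = B [^] (- int k) \<otimes> A"
  proof -
    have "B [^] int k \<otimes> (A \<otimes> (B [^] (- ?g) \<otimes> C [^] int k))
        = A \<otimes> (C [^] (- int k) \<otimes> B [^] ?g) \<otimes> (B [^] (- ?g) \<otimes> C [^] int k)"
      by (simp add: m_assoc[symmetric] B_pow_A)
    also have "\<dots> = A"
      by (simp add: m_assoc int_pow_add_left) (simp add: int_pow_mult[symmetric])
    finally show ?thesis by (simp add: int_pow_neg eq_inv_mult_iff)
  qed
  have "A \<otimes> (B [^] (int k * \<beta> ^ (k + 1) - ?g) \<otimes> C [^] (int k + 2))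
      = A \<otimes> (B [^] (- ?g) \<otimes> (B [^] (int k * \<beta> * \<beta> ^ k) \<otimes> C [^] int k \<otimes> C [^] (2::int)))"
    by (simp add: m_assoc int_pow_add_left) (simp add: int_pow_mult m_assoc mult_ac)
  also have "\<dots> = A \<otimes> (B [^] (- ?g) \<otimes> C [^] int k) \<otimes> (B [^] (int k * \<beta>) \<otimes> C [^] (2::int))"
    by (simp only: C_pow_B_pow[symmetric]) (simp add: m_assoc)
  also have "\<dots> = B [^] (- int k) \<otimes> (A \<otimes> (B [^] (int k * \<beta>) \<otimes> C [^] (2::int)))"
    unfolding BA by (simp add: m_assoc)
  also have "B [^] (int k * \<beta>) \<otimes> C [^] (2::int) = C \<otimes> (B [^] int k \<otimes> C)"
    using int_pow_mult[of C 1 1] by (simp add: m_assoc[symmetric] C_mult_B_pow)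
  also have "A \<otimes> (C \<otimes> (B [^] int k \<otimes> C)) = B [^] int k \<otimes> (C \<otimes> (A \<otimes> C) [^] \<alpha>)"
    using AC_conj by (simp add: assms)
  finally show ?thesis by (simp add: int_pow_neg)
qed

text \<open>Moving \<open>B^k\<close> past \<open>A\<close> now creates a negative power of
  \<open>C\<close>, which cannot be pushed through \<open>B\<close>; it remains in front.\<close>

lemma conj_relation_neg:
  assumes "\<beta> - 1 = - int k"
  shows "A \<otimes> (C [^] (- int k) \<otimes> (B [^] (\<beta> * geom \<beta> k - int k * \<beta>) \<otimes> C [^] (2::int)))
    = C \<otimes> (A \<otimes> C) [^] \<alpha>"
proof -
  let ?g = "\<beta> * geom \<beta> k"
  have "A \<otimes> (C [^] (- int k) \<otimes> (B [^] (?g - int k * \<beta>) \<otimes> C [^] (2::int)))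
      = A \<otimes> (C [^] (- int k) \<otimes> B [^] ?g) \<otimes> (B [^] (- int k * \<beta>) \<otimes> C [^] (2::int))"
    by (simp add: m_assoc int_pow_add_left)
  also have "\<dots> = B [^] int k \<otimes> (A \<otimes> (B [^] (- int k * \<beta>) \<otimes> C [^] (2::int)))"
    by (simp only: B_pow_A[symmetric]) (simp add: m_assoc)
  also have "B [^] (- int k * \<beta>) \<otimes> C [^] (2::int) = C \<otimes> (B [^] (- int k) \<otimes> C)"
    using int_pow_mult[of C 1 1] C_mult_B_pow[of "- int k"] by (simp add: m_assoc[symmetric])
  also have "A \<otimes> (C \<otimes> (B [^] (- int k) \<otimes> C)) = B [^] (- int k) \<otimes> (C \<otimes> (A \<otimes> C) [^] \<alpha>)"
    using AC_conj by (simp add: assms)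
  finally show ?thesis by (simp add: int_pow_neg)
qed

lemma B_pow_eq_C_A_C:
  assumes "A \<otimes> (C [^] (- int k) \<otimes> (B [^] (y::int) \<otimes> C [^] (j::int))) = C \<otimes> (A \<otimes> C) [^] \<alpha>"
  obtains N x M where "B [^] (y::int) = C [^] int N \<otimes> (A [^] (x::int) \<otimes> C [^] (M::int))"
proof -
  obtain N x where Nx: "(A \<otimes> C) [^] \<alpha> = C [^] int N \<otimes> (A [^] (x::int) \<otimes> C [^] (\<alpha> - int N))"
    using AC_pow_int by blast
  let ?r = "A [^] x \<otimes> C [^] (\<alpha> - int N)"
  have "A \<otimes> (C [^] (- int k) \<otimes> (B [^] y \<otimes> C [^] j)) = C [^] int (Suc N) \<otimes> ?r"
    unfolding assms Nx by (simp only: int_pow_Suc(2)[of C] gcomm_closed A_closed B_closed) (simp add: m_assoc)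
  then have "C [^] (- int k) \<otimes> (B [^] y \<otimes> C [^] j) = inv A \<otimes> (C [^] int (Suc N) \<otimes> ?r)"
    by (subst eq_inv_mult_iff) simp_all
  also have "\<dots> = A [^] (- 1 :: int) \<otimes> C [^] int (Suc N) \<otimes> ?r"
    by (simp add: m_assoc int_pow_neg del: of_nat_Suc)
  also have "\<dots> = C [^] int (Suc N) \<otimes> (A [^] (x - \<alpha> ^ Suc N) \<otimes> C [^] (\<alpha> - int N))"
    by (simp only: A_pow_C_pow) (simp add: m_assoc int_pow_add_left del: of_nat_Suc)
  finally have "B [^] y \<otimes> C [^] j = C [^] int k \<otimes> (C [^] int (Suc N) \<otimes> (A [^] (x - \<alpha> ^ Suc N) \<otimes> C [^] (\<alpha> - int N)))"
    (is "_ = ?z") by (simp add: int_pow_neg eq_inv_mult_iff[symmetric] eq_commute[of "inv _ \<otimes> _"] del: of_nat_Suc)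
  then have "B [^] y \<otimes> C [^] j \<otimes> C [^] (- j) = ?z \<otimes> C [^] (- j)" by simp
  then have "B [^] y = C [^] int (k + Suc N) \<otimes> (A [^] (x - \<alpha> ^ Suc N) \<otimes> C [^] (\<alpha> - int N - j))"
    by (simp add: m_assoc int_pow_add_left int_pow_mult[symmetric] add.left_commute)
  then show ?thesis using that by blast
qed

text \<open>Conjugation by \<open>C\<close> turns \<open>B^y\<close> into
  \<open>B^(y * \<beta>)\<close>. In the quotient of the two expressions \<open>C^M\<close> cancels,
  leaving a power of \<open>A\<close> conjugated by \<open>C^(N+1)\<close>; raising to the power
  \<open>\<alpha>^(N+1)\<close> undoes that conjugation.\<close>

lemma B_pow_eq_A_pow:
  assumes "B [^] (y::int) = C [^] int N \<otimes> (A [^] (x::int) \<otimes> C [^] (M::int))"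
  shows "B [^] (y * (\<beta> - 1) * \<alpha> ^ Suc N) = A [^] (x - x * \<alpha>)"
proof -
  let ?C = "C [^] int (Suc N)"
  have "B [^] (y * \<beta>) \<otimes> C = C \<otimes> B [^] y" by (simp add: C_mult_B_pow)
  also have "\<dots> = ?C \<otimes> (A [^] x \<otimes> C [^] M)"
    unfolding assms by (simp only: int_pow_Suc(2)[of C] gcomm_closed A_closed B_closed) (simp add: m_assoc)
  finally have "B [^] (y * \<beta>) \<otimes> C \<otimes> inv C = ?C \<otimes> (A [^] x \<otimes> C [^] M) \<otimes> inv C" by simp
  then have 1: "B [^] (y * \<beta>) = ?C \<otimes> (A [^] x \<otimes> (C [^] M \<otimes> inv C))"
    by (simp add: m_assoc del: of_nat_Suc)
  have 2: "B [^] (- y) \<otimes> ?C = C [^] (- M) \<otimes> (A [^] (- x) \<otimes> C)"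
    unfolding int_pow_neg[OF B_closed] assms
    by (simp only: int_pow_Suc(1)[of C] gcomm_closed A_closed B_closed)
       (simp add: inv_mult_group m_assoc int_pow_neg)
  have CM: "C [^] M \<otimes> (inv C \<otimes> (C [^] (- M) \<otimes> z)) = inv C \<otimes> z" if "z \<in> carrier G" for z
  proof -
    have cm: "inv C \<otimes> C [^] (- M) = C [^] (- M) \<otimes> inv C"
      using int_pow_commute[of C "-1" "- M"] by (simp add: int_pow_neg)
    have "inv C \<otimes> (C [^] (- M) \<otimes> z) = C [^] (- M) \<otimes> (inv C \<otimes> z)"
      using that by (simp add: m_assoc[symmetric] cm)
    then show ?thesis using that by (simp add: int_pow_neg)
  qed
  have "B [^] (y * (\<beta> - 1)) \<otimes> ?C = B [^] (y * \<beta>) \<otimes> (B [^] (- y) \<otimes> ?C)"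
    by (simp add: int_pow_add_left algebra_simps)
  also have "\<dots> = ?C \<otimes> (A [^] x \<otimes> (inv C \<otimes> (A [^] (- x) \<otimes> C)))"
    unfolding 1 2 by (simp add: m_assoc CM del: of_nat_Suc)
  also have "\<dots> = ?C \<otimes> A [^] (x - x * \<alpha>)"
    by (simp add: A_pow_mult_C int_pow_mult[symmetric] del: of_nat_Suc)
  finally have "B [^] (y * (\<beta> - 1)) \<otimes> ?C = ?C \<otimes> A [^] (x - x * \<alpha>)" .
  then have "(B [^] (y * (\<beta> - 1))) [^] (\<alpha> ^ Suc N) \<otimes> ?C = ?C \<otimes> (A [^] (x - x * \<alpha>)) [^] (\<alpha> ^ Suc N)"
    by (intro conj_int_pow) simp_all
  also have "\<dots> = A [^] (x - x * \<alpha>) \<otimes> ?C"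
    by (simp only: A_pow_C_pow int_pow_pow A_closed)
  finally show ?thesis by (simp add: int_pow_pow del: of_nat_Suc power_Suc)
qed

text \<open>Such an element commutes with \<open>A\<close> and \<open>B\<close>, hence with
  \<open>C\<close>, whereas \<open>C\<close> raises it to the power \<beta>.\<close>

lemma central_B_pow_trivial:
  assumes "B [^] (y::int) = A [^] (x::int)"
  shows "B [^] (y * (\<beta> - 1)) = \<one>"
proof -
  have "B [^] y \<otimes> C = C \<otimes> B [^] y"
  proof (rule commute_gcomm)
    show "B [^] y \<otimes> A = A \<otimes> B [^] y"
      using int_pow_commute[of A x 1] by (simp add: assms)
    show "B [^] y \<otimes> B = B \<otimes> B [^] y"
      using int_pow_commute[of B y 1] by simp
  qed simp_all
  then have "B [^] y = B [^] (y * \<beta>)" by (simp add: C_mult_B_pow)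
  then show ?thesis by (simp add: algebra_simps int_pow_diff)
qed

text \<open>The trivial element \<open>B^m\<close> is moved past \<open>A\<close> by
  \<open>B_pow_A\<close>.\<close>

lemma C_pow_in_powers_B:
  assumes "B [^] int m = \<one>"
  shows "C [^] int m = B [^] (\<beta> * geom \<beta> m)"
proof -
  have "C [^] (- int m) \<otimes> B [^] (\<beta> * geom \<beta> m) = \<one>"
    using B_pow_A[of m] by (simp add: assms)
  then show ?thesis by (simp add: int_pow_neg) (metis B_closed gcomm_closed A_closed int_pow_closed inv_closed inv_equality inv_inv)
qed

lemma C_pow_trivial:
  assumes "B [^] int m = \<one>"
  shows "C [^] int (m * m) = \<one>"
proof -
  have "C [^] int (m * m) = (C [^] int m) [^] int m" by (simp add: int_pow_pow)
  also have "\<dots> = (B [^] int m) [^] (\<beta> * geom \<beta> m)"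
    by (simp only: C_pow_in_powers_B[OF assms] int_pow_pow B_closed mult.commute)
  finally show ?thesis by (simp add: assms)
qed

lemma A_pow_trivial:
  assumes "C [^] int m = \<one>"
  shows "A [^] (\<alpha> ^ m - 1) = \<one>"
  using A_pow_C_pow[of 1 m] assms by (simp add: int_pow_diff)

end

text \<open>Vanishing would give \<open>k * b ^ k = geom b k\<close>, and the right side is 1 modulo
  \<open>b\<close>.\<close>

lemma relation_exponent_pos_nonzero:
  assumes "b \<ge> (2::int)" "b - 1 = int k"
  shows "int k * b ^ (k + 1) - b * geom b k \<noteq> 0"
proof
  assume "int k * b ^ (k + 1) - b * geom b k = 0"
  obtain l where l: "k = Suc l" using assms by (cases k) auto
  have "b * (int k * b ^ k - geom b k) = 0" using \<open>_ = 0\<close> by (simp add: algebra_simps)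
  then have "int k * b ^ k = geom b k" using assms by simp
  then have "b * (int k * b ^ l - geom b l) = 1"
    by (simp add: l geom_Suc' algebra_simps)
  then have "b dvd 1" by (metis dvd_triv_left)
  then show False using assms by simp
qed

text \<open>Vanishing would give \<open>geom b k = 1 - b\<close>; after splitting off the first two
  terms of the sum, \<open>b * geom b (k - 2) = -2\<close>, so \<open>b\<close> divides 2. The bound
  is sharp: \<open>b = -2\<close> gives \<open>k = 3\<close> and \<open>geom b 3 = 3\<close>, and
  the exponent is 0.\<close>

lemma relation_exponent_neg_nonzero:
  assumes "b \<le> (-3::int)" "b - 1 = - int k"
  shows "b * geom b k - int k * b \<noteq> 0"
proof
  assume "b * geom b k - int k * b = 0"
  obtain l where l: "k = Suc (Suc l)" using assms by (intro that[of "k - 2"]) linarith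
  have "b * (geom b k - int k) = 0" using \<open>_ = 0\<close> by (simp add: algebra_simps)
  then have "geom b k = 1 - b" using assms by simp
  then have "1 + b * (1 + b * geom b l) = 1 - b" by (simp add: l geom_Suc')
  then have "b * (b * geom b l + 2) = 0" by (simp add: algebra_simps)
  then have "b * geom b l = - 2" using assms by simp
  then have "b dvd 2" by (metis dvd_triv_left dvd_minus_iff)
  then have "\<bar>b\<bar> \<le> 2" using dvd_imp_le_int[of 2 b] by simp
  then show False using assms by simp
qed

lemma (in macdonald) finite_orders:
  assumes "\<beta> \<ge> 2 \<or> \<beta> \<le> -3" "\<bar>\<alpha>\<bar> \<ge> 2"
  obtains m :: nat where "m > 0" "A [^] int m = \<one>" "B [^] int m = \<one>" "C [^] int m = \<one>"
proof -
  obtain y k j where y: "y \<noteq> 0" "A \<otimes> (C [^] (- int k) \<otimes> (B [^] (y::int) \<otimes> C [^] (j::int))) = C \<otimes> (A \<otimes> C) [^] \<alpha>"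
  proof (cases "\<beta> \<ge> 2")
    case True
    define k where "k = nat (\<beta> - 1)"
    have k: "\<beta> - 1 = int k" using True by (simp add: k_def)
    show ?thesis
      using that[of "int k * \<beta> ^ (k + 1) - \<beta> * geom \<beta> k" 0 "int k + 2"]
        conj_relation_pos[OF k] relation_exponent_pos_nonzero[OF True k] by simp
  next
    case False
    define k where "k = nat (1 - \<beta>)"
    have b: "\<beta> \<le> -3" using False assms by blast
    then have k: "\<beta> - 1 = - int k" by (simp add: k_def)
    show ?thesis
      using that[of "\<beta> * geom \<beta> k - int k * \<beta>" k 2]
        conj_relation_neg[OF k] relation_exponent_neg_nonzero[OF b k] by simp
  qed
  obtain N x M where NxM: "B [^] (y::int) = C [^] int N \<otimes> (A [^] (x::int) \<otimes> C [^] (M::int))"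
    using B_pow_eq_C_A_C[OF y(2)] .
  \<comment> \<open>Without its last factor, \<open>z\<close> is the exponent for which
    \<open>B_pow_eq_A_pow\<close> yields a power of \<open>A\<close>; the last
    \<open>\<beta> - 1\<close> makes that central element trivial.\<close>
  define z where "z = y * (\<beta> - 1) * \<alpha> ^ Suc N * (\<beta> - 1)"
  have "B [^] z = \<one>" unfolding z_def
    by (rule central_B_pow_trivial) (rule B_pow_eq_A_pow[OF NxM])
  moreover have "z \<noteq> 0" using y(1) assms by (auto simp: z_def)
  ultimately have "\<exists>b>0. B [^] int b = \<one>"
    by (intro exI[of _ "nat \<bar>z\<bar>"]) (auto simp: abs_if int_pow_neg)
  then obtain b where b: "b > 0" "B [^] int b = \<one>" by blast
  have c: "C [^] int (b * b) = \<one>" by (rule C_pow_trivial) fact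
  define a where "a = nat \<bar>\<alpha> ^ (b * b) - 1\<bar>"
  have "A [^] (\<alpha> ^ (b * b) - 1) = \<one>" by (rule A_pow_trivial) fact
  then have A: "A [^] int a = \<one>"
    using int_pow_neg[OF A_closed, of "\<alpha> ^ (b * b) - 1"] by (auto simp: a_def abs_if)
  have "\<bar>\<alpha> ^ (b * b)\<bar> \<ge> 2 ^ (b * b)" unfolding power_abs using assms(2) by (intro power_mono) auto
  moreover have "(2::int) ^ (b * b) \<ge> 2" using b(1) by (cases "b * b") auto
  ultimately have "a > 0" by (auto simp: a_def)
  have eq: "int (a * b * b) = int a * int (b * b)" "int (a * b * b) = int b * int (a * b)" by simp_all
  show ?thesis
  proof
    show "A [^] int (a * b * b) = \<one>" unfolding eq(1) by (simp only: int_pow_pow[symmetric] A_closed A int_pow_one)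
    show "B [^] int (a * b * b) = \<one>" unfolding eq(2) by (simp only: int_pow_pow[symmetric] B_closed b int_pow_one)
    show "C [^] int (a * b * b) = \<one>" unfolding eq(1) mult.commute[of "int a"]
      by (simp only: int_pow_pow[symmetric] gcomm_closed A_closed B_closed c int_pow_one)
  qed (use \<open>a > 0\<close> b in simp)
qed

section \<open>Prime divisors of the orders\<close>

lemma int_dvd_if_prime_powers_dvd:
  fixes n :: nat and x :: int
  assumes "n > 0" and pp: "\<And>r k. Factorial_Ring.prime r \<Longrightarrow> r ^ k dvd n \<Longrightarrow> int (r ^ k) dvd x"
  shows "int n dvd x"
proof (cases "x = 0")
  case False
  have "n dvd nat \<bar>x\<bar>"
  proof (rule multiplicity_le_imp_dvd)
    fix r :: nat assume r: "Factorial_Ring.prime r"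
    have "int (r ^ multiplicity r n) dvd x" by (intro pp r multiplicity_dvd)
    then have "r ^ multiplicity r n dvd nat \<bar>x\<bar>" using int_dvd_int_iff[of _ "nat \<bar>x\<bar>"] by simp
    then show "multiplicity r n \<le> multiplicity r (nat \<bar>x\<bar>)"
      using r False by (intro multiplicity_geI) (auto dest: not_prime_unit)
  qed (use assms in simp)
  then have "int n dvd int (nat \<bar>x\<bar>)" by (simp only: int_dvd_int_iff)
  then show ?thesis by simp
qed simp

text \<open>One prime power \<open>r ^ k\<close> at a time. If \<open>r\<close> divides
  \<open>t - 1\<close>, then \<open>r\<close> is not \<open>q\<close>, and all of
  \<open>r ^ k\<close> survives in \<open>o' div q\<close>. Otherwise \<open>r \<le> q\<close>, so
  \<open>r - 1\<close> divides \<open>(q - 1)!\<close>, and \<open>totient (r ^ k)\<close> divides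
  the exponent; the lost factor \<open>q\<close> is harmless, because the totient contains one
  factor \<open>r\<close> less than \<open>r ^ k\<close>. Euler's theorem then applies,
  \<open>t - 1\<close> being a unit modulo \<open>r\<close>.\<close>

lemma dvd_geom_factorial:
  fixes o' q :: nat
  assumes o': "o' > 0" and q: "Factorial_Ring.prime q" "q dvd o'"
    and cop: "coprime t (int o')"
    and largest: "\<And>r. Factorial_Ring.prime r \<Longrightarrow> r dvd o' \<Longrightarrow> r > q \<Longrightarrow> int r dvd t - 1"
    and nq: "\<not> int q dvd t - 1"
  shows "int o' dvd geom t (o' div q * fact (q - 1))"
proof (rule int_dvd_if_prime_powers_dvd[OF o'])
  fix r k :: nat
  assume r: "Factorial_Ring.prime r" and rk: "r ^ k dvd o'"
  let ?m = "o' div q"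
  have om: "o' = q * ?m" using q by simp
  have rm: "r ^ k dvd ?m" if "r \<noteq> q"
  proof -
    have "coprime (r ^ k) q" using that r q(1) by (simp add: primes_coprime coprime_power_left_iff)
    then show ?thesis using rk om by (metis coprime_dvd_mult_right_iff)
  qed
  show "int (r ^ k) dvd geom t (?m * fact (q - 1))"
  proof (cases "k = 0 \<or> int r dvd t - 1")
    case True
    then show ?thesis
    proof
      assume rt: "int r dvd t - 1"
      then have "r ^ k dvd ?m * fact (q - 1)" using rm nq by (metis dvd_mult2)
      then have "int (r ^ k) dvd int (?m * fact (q - 1))" by (simp only: int_dvd_int_iff)
      then show ?thesis
      proof (rule dvd_geom)
        show "int p dvd t - 1" if "Factorial_Ring.prime p" "p dvd r ^ k" for p
          using that r rt by (metis prime_dvd_power primes_dvd_imp_eq)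
      qed (use prime_gt_0_nat[OF r] in simp)
    qed simp
  next
    case False
    then obtain j where k: "k = Suc j" by (cases k) auto
    have "r dvd o'" using rk k by (metis dvd_mult_left power_Suc)
    then have rq: "r \<le> q" using largest[OF r] False by force
    have rj: "r ^ j dvd ?m"
    proof (cases "r = q")
      case True
      then have "q * r ^ j dvd q * ?m" using rk k om by simp
      then show ?thesis using q(1) by (simp add: prime_gt_0_nat)
    next
      case False
      then show ?thesis using rm k by (metis dvd_mult_right power_Suc)
    qed
    have "r - 1 dvd fact (q - 1)"
      using prime_gt_1_nat[OF r] rq by (intro dvd_fact) auto
    then have "totient (r ^ k) dvd ?m * fact (q - 1)"
      using rj by (simp only: k totient_prime_power_Suc[OF r] mult_dvd_mono)
    then obtain l where l: "?m * fact (q - 1) = totient (r ^ k) * l" by blast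
    have "residues (int (r ^ k))"
      unfolding residues_def using prime_gt_1_nat[OF r] k
      by (metis one_less_power of_nat_1 of_nat_less_iff zero_less_Suc)
    moreover have "coprime t (int (r ^ k))"
      using cop rk by (meson coprime_divisors dvd_refl int_dvd_int_iff)
    ultimately have "[t ^ totient (r ^ k) = 1] (mod int (r ^ k))"
      using residues.euler_theorem[of "int (r ^ k)" t] by (simp only: nat_int)
    then have "[t ^ (?m * fact (q - 1)) = 1] (mod int (r ^ k))"
      unfolding l power_mult by (metis cong_pow power_one)
    then have "int (r ^ k) dvd (t - 1) * geom t (?m * fact (q - 1))"
      by (simp add: geom_times cong_iff_dvd_diff)
    moreover have "coprime (int (r ^ k)) (t - 1)"
    proof -
      have "coprime (int r) (t - 1)"
        using False r by (intro prime_imp_coprime) auto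
      then show ?thesis by simp
    qed
    ultimately show ?thesis by (simp only: coprime_dvd_mult_right_iff)
  qed
qed

lemma (in macdonald) coprime_ord_A:
  assumes "m > 0" "C [^] int m = \<one>"
  shows "coprime \<alpha> (int (ord A))"
proof -
  have "int (ord A) dvd \<alpha> ^ m - 1"
    using A_pow_trivial[OF assms(2)] by (simp add: int_pow_eq_id)
  moreover have "coprime \<alpha> (\<alpha> ^ m - 1)"
  proof -
    have "coprime (\<alpha> ^ m - 1) (\<alpha> ^ m)" by (rule coprime_diff_one_left)
    then have "coprime (\<alpha> ^ m - 1) \<alpha>" using assms(1) by simp
    then show ?thesis by (subst coprime_commute)
  qed
  ultimately show ?thesis by (meson coprime_divisors dvd_refl)
qed

text \<open>\<open>A\<^bsup>k(\<alpha>-1)\<^esup>\<close> lies in \<open>\<langle>A\<rangle> \<inter> \<langle>B\<rangle>\<close> and is therefore central.\<close>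
lemma (in macdonald) A_pow_trivial_if_conj_C_pow:
  assumes "A [^] int k \<otimes> B = B \<otimes> C [^] int k"
  shows "A [^] (int k * (\<alpha> - 1) * (\<alpha> - 1)) = \<one>"
proof -
  define u where "u = \<beta> - 1"
  let ?X = "A [^] int k" and ?Y = "C [^] int k"
  have CB: "C \<otimes> B = B \<otimes> (B [^] u \<otimes> C)"
    using C_mult_B_pow[of 1] int_pow_mult[of B 1 u] by (simp add: m_assoc u_def)
  have XB: "?X [^] l \<otimes> B = B \<otimes> ?Y [^] l" for l :: int
    by (rule conj_int_pow) (use assms in simp_all)
  \<comment> \<open>Conjugate \<open>?X C = C ?X^\<alpha>\<close> by \<open>B\<close>, which sends
    \<open>?X\<close> to \<open>?Y\<close> and \<open>C\<close> to \<open>B^u C\<close>. The factor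
    \<open>C\<close> cancels, since it commutes with \<open>?Y\<close>.\<close>
  have "B \<otimes> (?Y \<otimes> (B [^] u \<otimes> C)) = ?X \<otimes> (C \<otimes> B)"
    unfolding CB using assms by (simp add: m_assoc[symmetric])
  also have "\<dots> = C \<otimes> (?X [^] \<alpha> \<otimes> B)"
    by (simp add: m_assoc[symmetric] A_pow_mult_C int_pow_pow)
  also have "\<dots> = B \<otimes> (B [^] u \<otimes> (C \<otimes> ?Y [^] \<alpha>))"
    unfolding XB by (simp add: m_assoc[symmetric] CB)
  also have "C \<otimes> ?Y [^] \<alpha> = ?Y [^] \<alpha> \<otimes> C"
    using int_pow_commute[of C 1 "int k * \<alpha>"] by (simp add: int_pow_pow)
  finally have "?Y \<otimes> (B [^] u \<otimes> C) = B [^] u \<otimes> (?Y [^] \<alpha> \<otimes> C)" by simp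
  then have "?Y \<otimes> B [^] u = B [^] u \<otimes> ?Y [^] \<alpha>" by (simp add: m_assoc[symmetric])
  then have "B [^] (u * \<beta> ^ k) \<otimes> ?Y = B [^] u \<otimes> ?Y [^] \<alpha>" by (simp add: C_pow_B_pow)
  then have "B [^] (- u) \<otimes> (B [^] (u * \<beta> ^ k) \<otimes> ?Y) \<otimes> inv ?Y
      = B [^] (- u) \<otimes> (B [^] u \<otimes> ?Y [^] \<alpha>) \<otimes> inv ?Y" by simp
  then have Y: "?Y [^] (\<alpha> - 1) = B [^] (u * \<beta> ^ k - u)"
    using int_pow_diff[of ?Y \<alpha> 1] by (simp add: int_pow_add_left m_assoc)
  have "?X [^] (\<alpha> - 1) = B [^] (u * \<beta> ^ k - u)"
  proof -
    have "?X [^] (\<alpha> - 1) \<otimes> B = B [^] (u * \<beta> ^ k - u) \<otimes> B"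
      unfolding XB Y using int_pow_commute[of B 1] by simp
    then show ?thesis by simp
  qed
  then have "A [^] (int k * (\<alpha> - 1)) = B [^] (u * \<beta> ^ k - u)" by (simp add: int_pow_pow)
  then show ?thesis
    using macdonald.central_B_pow_trivial[OF macdonald_swap] by blast
qed

theorem (in macdonald) prime_dvd_ord_A:
  assumes "m > 0" "A [^] int m = \<one>" "C [^] int m = \<one>"
    and "Factorial_Ring.prime p" "p dvd ord A"
  shows "int p dvd \<alpha> - 1"
proof (rule ccontr)
  assume np: "\<not> int p dvd \<alpha> - 1"
  have o: "ord A > 0"
    using assms(1,2) int_pow_eq_id[of A "int m"] by (auto intro: Nat.gr0I)
  define S where "S = {q. Factorial_Ring.prime q \<and> q dvd ord A \<and> \<not> int q dvd \<alpha> - 1}"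
  have fin: "finite S" unfolding S_def by (rule finite_subset[OF _ finite_divisors_nat[OF o]]) auto
  define q where "q = Max S"
  have "q \<in> S" unfolding q_def by (rule Max_in) (use fin assms np S_def in auto)
  then have q: "Factorial_Ring.prime q" "q dvd ord A" "\<not> int q dvd \<alpha> - 1" by (auto simp: S_def)
  have "int r dvd \<alpha> - 1" if "Factorial_Ring.prime r" "r dvd ord A" "r > q" for r
  proof (rule ccontr)
    assume "\<not> int r dvd \<alpha> - 1"
    then have "r \<in> S" using that by (simp add: S_def)
    then have "r \<le> q" unfolding q_def by (rule Max_ge[OF fin])
    then show False using that(3) by simp
  qed
  \<comment> \<open>As \<open>(q - 1)!\<close> is prime to \<open>q\<close>, this \<open>k\<close>
    has exactly one factor \<open>q\<close> less than \<open>ord A\<close>. Once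
    \<open>ord A\<close> divides \<open>k * (\<alpha> - 1) * (\<alpha> - 1)\<close>, that factor
    must divide \<open>\<alpha> - 1\<close>.\<close>
  define k where "k = ord A div q * fact (q - 1)"
  have "int (ord A) dvd geom \<alpha> k" unfolding k_def
    by (rule dvd_geom_factorial) (use o q coprime_ord_A assms \<open>\<And>r. _ \<Longrightarrow> _ \<Longrightarrow> _ \<Longrightarrow> int r dvd \<alpha> - 1\<close> in auto)
  then have "A [^] (\<alpha> * geom \<alpha> k) = \<one>" by (simp add: int_pow_eq_id)
  then have "A [^] int k \<otimes> B = B \<otimes> C [^] int k" by (simp add: A_pow_B)
  then have "A [^] (int k * (\<alpha> - 1) * (\<alpha> - 1)) = \<one>" by (rule A_pow_trivial_if_conj_C_pow)
  then have "int (ord A) dvd int k * (\<alpha> - 1) * (\<alpha> - 1)" by (simp add: int_pow_eq_id)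
  moreover have "int (ord A) = int (ord A div q) * int q" using q(2) by (simp flip: of_nat_mult)
  moreover have "int k * (\<alpha> - 1) * (\<alpha> - 1) = int (ord A div q) * (int (fact (q - 1)) * (\<alpha> - 1) * (\<alpha> - 1))"
    by (simp add: k_def)
  moreover have "int (ord A div q) \<noteq> 0" using o q by (auto simp: dvd_div_eq_0_iff)
  ultimately have "int q dvd int (fact (q - 1)) * (\<alpha> - 1) * (\<alpha> - 1)"
    by (metis dvd_mult_cancel_left)
  moreover have pq: "Factorial_Ring.prime (int q)" using q(1) by simp
  ultimately have "int q dvd int (fact (q - 1))" using q(3) by (metis prime_dvd_mult_iff)
  then have "q dvd fact (q - 1)" by (simp only: int_dvd_int_iff)
  then show False using q(1) prime_gt_1_nat[OF q(1)] by (simp add: prime_dvd_fact_iff)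
qed

section \<open>Normal subgroups containing powers of the generators\<close>

context group
begin

text \<open>The inverse of \<open>g\<close> is a non-negative power of \<open>g\<close>, so
  stability under conjugation in one direction gives the other.\<close>

lemma conj_mem_if_torsion:
  assumes H: "subgroup H G" and g [simp]: "g \<in> carrier G" and m: "m > 0" "g [^] int m = \<one>"
    and conj: "\<And>h. h \<in> H \<Longrightarrow> inv g \<otimes> h \<otimes> g \<in> H" and h: "h \<in> H"
  shows "g \<otimes> h \<otimes> inv g \<in> H"
proof -
  have car [simp]: "h \<in> carrier G" using H h by (rule subgroup.mem_carrier)
  have "inv (g [^] int n) \<otimes> h \<otimes> g [^] int n \<in> H" for n
  proof (induction n)
    case (Suc n)
    then show ?case using conj[OF Suc] unfolding int_pow_Suc(1)[OF g]
      by (simp add: inv_mult_group m_assoc)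
  qed (use h in simp)
  moreover have "g [^] int (m - 1) = inv g"
  proof -
    have "g [^] int (m - 1) \<otimes> g = \<one>"
      using m int_pow_Suc(1)[of g "m - 1"] by simp
    then show ?thesis by (simp add: inv_equality)
  qed
  ultimately show ?thesis by (metis g inv_inv)
qed

lemma normal_if_generators_normalize:
  assumes H: "subgroup H G" and gen: "carrier G = generate G S"
    and S: "\<And>s h. s \<in> S \<Longrightarrow> h \<in> H \<Longrightarrow> s \<otimes> h \<otimes> inv s \<in> H"
           "\<And>s h. s \<in> S \<Longrightarrow> h \<in> H \<Longrightarrow> inv s \<otimes> h \<otimes> s \<in> H"
  shows "H \<lhd> G"
proof -
  have HG: "h \<in> carrier G" if "h \<in> H" for h using H that by (rule subgroup.mem_carrier)
  have SG: "S \<subseteq> carrier G" unfolding gen by (auto intro: generate.incl)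
  have "\<forall>h\<in>H. x \<otimes> h \<otimes> inv x \<in> H" if "x \<in> generate G S" for x
    using that
  proof induction
    case (inv s)
    then show ?case using S(2) SG by auto
  next
    case (eng x y)
    have xy: "x \<in> carrier G" "y \<in> carrier G" using eng.hyps by (simp_all only: gen)
    show ?case
    proof
      fix h assume h: "h \<in> H"
      have "x \<otimes> y \<otimes> h \<otimes> inv (x \<otimes> y) = x \<otimes> (y \<otimes> h \<otimes> inv y) \<otimes> inv x"
        using xy HG[OF h] by (simp add: inv_mult_group m_assoc)
      then show "x \<otimes> y \<otimes> h \<otimes> inv (x \<otimes> y) \<in> H" using eng.IH h by simp
    qed
  qed (use S HG in auto)
  then show ?thesis unfolding normal_inv_iff gen using H by blast
qed

definition adjoin :: "'a set \<Rightarrow> 'a \<Rightarrow> 'a set" where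
  "adjoin H x = {h \<otimes> x [^] (i::int) | h i. h \<in> H}"

lemma adjoinI: "h \<in> H \<Longrightarrow> h \<otimes> x [^] (i::int) \<in> adjoin H x"
  by (auto simp: adjoin_def)

lemma adjoin_incl:
  assumes "H \<subseteq> carrier G"
  shows "H \<subseteq> adjoin H x"
proof
  fix h assume "h \<in> H"
  then show "h \<in> adjoin H x" using adjoinI[of h H x 0] assms by auto
qed

lemma mem_adjoin:
  assumes "\<one> \<in> H" "x \<in> carrier G"
  shows "x \<in> adjoin H x"
  using adjoinI[of \<one> H x 1] assms by simp

lemma subgroup_adjoin:
  assumes N: "H \<lhd> G" and x [simp]: "x \<in> carrier G"
  shows "subgroup (adjoin H x) G"
proof -
  interpret H: normal H G by fact
  have conj: "x [^] i \<otimes> h \<otimes> inv (x [^] i) \<in> H" if "h \<in> H" for h and i :: int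
    using N that by (simp add: normal_inv_iff)
  show ?thesis
  proof (rule subgroupI)
    show "adjoin H x \<subseteq> carrier G" by (auto simp: adjoin_def)
    show "adjoin H x \<noteq> {}" using mem_adjoin[OF H.one_closed x] by blast
    show "inv y \<in> adjoin H x" if y: "y \<in> adjoin H x" for y
    proof -
      obtain h i where y: "y = h \<otimes> x [^] (i::int)" "h \<in> H" using y by (auto simp: adjoin_def)
      have [simp]: "h \<in> carrier G" using y by simp
      have "inv y = (x [^] (- i) \<otimes> inv h \<otimes> inv (x [^] (- i))) \<otimes> x [^] (- i)"
        by (simp add: y inv_mult_group m_assoc int_pow_neg)
      moreover have "x [^] (- i) \<otimes> inv h \<otimes> inv (x [^] (- i)) \<in> H" using y by (intro conj) simp
      ultimately show ?thesis by (metis adjoinI)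
    qed
    show "y \<otimes> z \<in> adjoin H x" if y: "y \<in> adjoin H x" "z \<in> adjoin H x" for y z
    proof -
      obtain h i h' j where yz: "y = h \<otimes> x [^] (i::int)" "h \<in> H" "z = h' \<otimes> x [^] (j::int)" "h' \<in> H"
        using y by (auto simp: adjoin_def)
      have [simp]: "h \<in> carrier G" "h' \<in> carrier G" using yz by simp_all
      have "y \<otimes> z = (h \<otimes> (x [^] i \<otimes> h' \<otimes> inv (x [^] i))) \<otimes> x [^] (i + j)"
        by (simp add: yz m_assoc int_pow_mult)
      moreover have "h \<otimes> (x [^] i \<otimes> h' \<otimes> inv (x [^] i)) \<in> H" using yz conj by simp
      ultimately show ?thesis by (metis adjoinI)
    qed
  qed
qed

lemma adjoin_conj:
  assumes N: "H \<lhd> G" and [simp]: "x \<in> carrier G" "g \<in> carrier G"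
    and conj: "inv g \<otimes> x \<otimes> g \<in> adjoin H x" and y: "y \<in> adjoin H x"
  shows "inv g \<otimes> y \<otimes> g \<in> adjoin H x"
proof -
  interpret H: normal H G by fact
  interpret K: subgroup "adjoin H x" G using N by (rule subgroup_adjoin) simp
  obtain h i where y: "y = h \<otimes> x [^] (i::int)" "h \<in> H" using y by (auto simp: adjoin_def)
  have [simp]: "h \<in> carrier G" using y by simp
  have "inv g \<otimes> h \<otimes> g \<in> H" using H.inv_op_closed1[of g h] y by simp
  then have 1: "inv g \<otimes> h \<otimes> g \<in> adjoin H x" using adjoin_incl[OF H.subset] by blast
  have "x [^] i \<otimes> g = g \<otimes> (inv g \<otimes> x \<otimes> g) [^] i"
    by (rule conj_int_pow) (simp_all add: m_assoc)
  then have "inv g \<otimes> y \<otimes> g = (inv g \<otimes> h \<otimes> g) \<otimes> (inv g \<otimes> x \<otimes> g) [^] i"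
    unfolding y by (simp add: m_assoc)
  then show ?thesis using 1 subgroup_int_pow_closed[OF K.subgroup_axioms conj] by simp
qed

text \<open>Modulo \<open>H\<close>, the subgroup \<open>adjoin H x\<close> is cyclic, generated by
  an element whose \<open>p\<close>-th power is trivial.\<close>

lemma adjoin_pow_mem:
  assumes N: "H \<lhd> G" and [simp]: "x \<in> carrier G" and p: "x [^] int p \<in> H" and y: "y \<in> adjoin H x"
  shows "y [^] int p \<in> H"
proof -
  interpret H: normal H G by fact
  obtain h i where y: "y = h \<otimes> x [^] (i::int)" "h \<in> H" using y by (auto simp: adjoin_def)
  have [simp]: "h \<in> carrier G" using y by simp
  have "\<exists>h'\<in>H. y [^] int n = h' \<otimes> x [^] (i * int n)" for n
  proof (induction n)
    case 0
    then show ?case by (intro bexI[of _ \<one>]) simp_all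
  next
    case (Suc n)
    then obtain h' where h': "h' \<in> H" "y [^] int n = h' \<otimes> x [^] (i * int n)" by blast
    have [simp]: "h' \<in> carrier G" using h' by simp
    let ?z = "x [^] (i * int n)"
    have "?z \<otimes> h \<otimes> inv ?z \<in> H" using N y by (simp add: normal_inv_iff)
    then have 1: "h' \<otimes> (?z \<otimes> h \<otimes> inv ?z) \<in> H" using h' by simp
    have "y [^] int (Suc n) = y [^] int n \<otimes> y" by (rule int_pow_Suc) (simp add: y)
    also have "\<dots> = h' \<otimes> (?z \<otimes> h \<otimes> inv ?z) \<otimes> x [^] (i * int (Suc n))"
    proof -
      have i: "i * int (Suc n) = i * int n + i" by (simp add: algebra_simps)
      show ?thesis unfolding h' i by (simp add: y m_assoc int_pow_mult)
    qed
    finally show ?case using 1 by blast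
  qed
  then obtain h' where h': "h' \<in> H" "y [^] int p = h' \<otimes> x [^] (i * int p)" by blast
  moreover have "x [^] (i * int p) \<in> H"
    using subgroup_int_pow_closed[OF H.subgroup_axioms p, of i] by (simp add: int_pow_pow mult.commute)
  ultimately show ?thesis by simp
qed

lemma commute_if_normal_disjoint:
  assumes "N1 \<lhd> G" "N2 \<lhd> G" "N1 \<inter> N2 = {\<one>}" "x \<in> N1" "y \<in> N2"
  shows "x \<otimes> y = y \<otimes> x"
proof -
  interpret N1: normal N1 G by fact
  interpret N2: normal N2 G by fact
  have [simp]: "x \<in> carrier G" "y \<in> carrier G" using assms by simp_all
  have "gcomm G x y = inv x \<otimes> (inv y \<otimes> x \<otimes> y)" by (simp add: gcomm_def m_assoc)
  then have 1: "gcomm G x y \<in> N1" using assms N1.inv_op_closed1[of y x] by simp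
  have "gcomm G x y = (inv x \<otimes> inv y \<otimes> x) \<otimes> y" by (simp add: gcomm_def)
  then have "gcomm G x y \<in> N2" using assms N2.inv_op_closed1[of x "inv y"] by simp
  then have "gcomm G x y = \<one>" using 1 assms(3) by blast
  then show ?thesis using mult_gcomm[of x y] by simp
qed

end

lemma gcd_dvd_geom:
  assumes "o' > 0" "\<And>q. Factorial_Ring.prime q \<Longrightarrow> q dvd o' \<Longrightarrow> int q dvd t - 1"
  shows "gcd (int k) (int o') dvd geom t k"
proof -
  have "int (gcd k o') dvd geom t k"
    by (rule dvd_geom) (use assms in auto)
  then show ?thesis by (simp add: gcd_int_int_eq)
qed

text \<open>If \<open>p\<close> divides \<open>o'\<close>, it divides \<open>t - 1\<close> and
  supplies the additional factor in \<open>t ^ k - 1 = (t - 1) * geom t k\<close>; otherwise it does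
  not affect the gcd. The gcd with the order decides which powers of \<open>x\<close> are powers of
  \<open>x^(k * p)\<close>.\<close>

lemma gcd_dvd_power_minus_one:
  assumes o': "o' > 0" "\<And>q. Factorial_Ring.prime q \<Longrightarrow> q dvd o' \<Longrightarrow> int q dvd t - 1"
    and p: "Factorial_Ring.prime p"
  shows "gcd (int (k * p)) (int o') dvd t ^ k - 1"
proof (cases "p dvd o'")
  case True
  have "gcd (int (k * p)) (int o') dvd gcd (int p * int k) (int p * int o')"
    by (rule gcd_greatest) (simp_all add: mult.commute[of "int p"])
  also have "\<dots> = int p * gcd (int k) (int o')" by (simp add: gcd_mult_distrib_int[symmetric])
  also have "\<dots> dvd (t - 1) * geom t k"
    using o'(2)[OF p True] gcd_dvd_geom[OF o'] by (rule mult_dvd_mono)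
  finally show ?thesis by (simp add: geom_times)
next
  case False
  then have "coprime p o'" using p by (rule prime_imp_coprime[rotated])
  then have "gcd (int (k * p)) (int o') = gcd (int k) (int o')"
    by (simp add: gcd_mult_right_right_cancel coprime_commute gcd_mult_left_right_cancel)
  then show ?thesis using gcd_dvd_geom[OF o', of k] by (simp flip: geom_times)
qed

text \<open>\<open>L\<close> is an arbitrary common exponent rather than the least one, so that it
  can be chosen divisible by a prescribed power of 3.\<close>

locale torsion_macdonald = macdonald +
  fixes L :: nat
  assumes generators: "carrier G = generate G {A, B}"
    and L_pos: "L > 0" and A_L: "A [^] int L = \<one>" and B_L: "B [^] int L = \<one>" and C_L: "C [^] int L = \<one>"
    and primes_A: "\<And>p. Factorial_Ring.prime p \<Longrightarrow> p dvd ord A \<Longrightarrow> int p dvd \<alpha> - 1"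
    and primes_B: "\<And>p. Factorial_Ring.prime p \<Longrightarrow> p dvd ord B \<Longrightarrow> int p dvd \<beta> - 1"
begin

lemma ord_pos: "ord A > 0" "ord B > 0"
proof -
  have "ord A dvd L" "ord B dvd L" using A_L B_L by (simp_all add: int_pow_eq_id)
  then show "ord A > 0" "ord B > 0" using L_pos by (auto intro: Nat.gr0I)
qed

lemma normal_adjoin:
  assumes N: "H \<lhd> G" and [simp]: "x \<in> carrier G"
    and "inv A \<otimes> x \<otimes> A \<in> adjoin H x" "inv B \<otimes> x \<otimes> B \<in> adjoin H x"
  shows "adjoin H x \<lhd> G"
proof -
  have K: "subgroup (adjoin H x) G" using N by (rule subgroup_adjoin) simp
  have AB: "inv s \<otimes> h \<otimes> s \<in> adjoin H x" if "s \<in> {A, B}" "h \<in> adjoin H x" for s h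
    using that assms by (auto intro!: adjoin_conj)
  show ?thesis
    using K generators
  proof (rule normal_if_generators_normalize)
    fix s h assume s: "s \<in> {A, B}" and h: "h \<in> adjoin H x"
    show "s \<otimes> h \<otimes> inv s \<in> adjoin H x"
      by (rule conj_mem_if_torsion[OF K _ L_pos]) (use s h AB A_L B_L in auto)
  qed (rule AB)
qed

lemma pow_mem_if_gcd_dvd:
  assumes H: "subgroup H G" and x: "x \<in> carrier G" and k: "x [^] int k \<in> H" and "gcd (int k) (int (ord x)) dvd i"
  shows "x [^] i \<in> H"
proof -
  have "x [^] int (ord x) = \<one>" using x by (simp add: int_pow_eq_id)
  then obtain l where "x [^] i = x [^] (int k * l)" using int_pow_in_powers[OF x _ assms(4)] by blast
  then show ?thesis using subgroup_int_pow_closed[OF H k, of l] x by (simp add: int_pow_pow)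
qed

text \<open>The order of adjunction matters. Conjugates of \<open>C^k\<close> differ from it by
  powers of \<open>A\<close> and \<open>B\<close> with exponents \<open>1 - \<alpha>^k\<close> and
  \<open>\<beta>^k - 1\<close>, which \<open>H\<close> already contains. Conjugates of
  \<open>A^k\<close> and \<open>B^k\<close> involve \<open>C^k\<close> or its inverse, so
  \<open>C^k\<close> has to be present before them. Each adjunction costs one factor
  \<open>p\<close>, whence \<open>p ^ 3\<close>.\<close>

lemma normal_power_step:
  assumes N: "H \<lhd> G" and p: "Factorial_Ring.prime p"
    and H: "A [^] int (k * p) \<in> H" "B [^] int (k * p) \<in> H" "C [^] int (k * p) \<in> H"
  obtains K where "K \<lhd> G" "A [^] int k \<in> K" "B [^] int k \<in> K" "C [^] int k \<in> K"
    "\<And>g. g \<in> K \<Longrightarrow> g [^] int (p ^ 3) \<in> H"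
proof -
  let ?a = "A [^] int k" and ?b = "B [^] int k" and ?c = "C [^] int k"
  interpret H: normal H G by fact
  define H1 where "H1 = adjoin H ?c"
  have sub1: "subgroup H1 G" unfolding H1_def using N by (rule subgroup_adjoin) simp
  have H_H1: "H \<subseteq> H1" unfolding H1_def by (rule adjoin_incl) (rule H.subset)
  have c1: "?c \<in> H1" unfolding H1_def by (rule mem_adjoin) simp_all
  have "A [^] (1 - \<alpha> ^ k) \<in> H"
    by (rule pow_mem_if_gcd_dvd[OF H.subgroup_axioms _ H(1)])
       (use gcd_dvd_power_minus_one[OF ord_pos(1) primes_A p, of k] dvd_diff_commute in \<open>auto\<close>)
  moreover have "inv A \<otimes> ?c \<otimes> A = ?c \<otimes> A [^] (1 - \<alpha> ^ k)"
    using A_pow_C_pow[of "-1" k] int_pow_mult[of A "- (\<alpha> ^ k)" 1]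
    by (simp add: int_pow_neg m_assoc)
  ultimately have cA: "inv A \<otimes> ?c \<otimes> A \<in> H1"
    using c1 H_H1 subgroup.m_closed[OF sub1] by auto
  have "B [^] (\<beta> ^ k - 1) \<in> H"
    by (rule pow_mem_if_gcd_dvd[OF H.subgroup_axioms _ H(2)])
       (use gcd_dvd_power_minus_one[OF ord_pos(2) primes_B p, of k] in auto)
  moreover have "inv B \<otimes> ?c \<otimes> B = B [^] (\<beta> ^ k - 1) \<otimes> ?c"
    using C_pow_B_pow[of k 1] int_pow_add_left[of B ?c "-1" "\<beta> ^ k"]
    by (simp add: int_pow_neg m_assoc)
  ultimately have cB: "inv B \<otimes> ?c \<otimes> B \<in> H1"
    using c1 H_H1 subgroup.m_closed[OF sub1] by auto
  have N1: "H1 \<lhd> G" unfolding H1_def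
    by (rule normal_adjoin[OF N]) (use cA cB H1_def in auto)
  define H2 where "H2 = adjoin H1 ?a"
  have sub2: "subgroup H2 G" unfolding H2_def using N1 by (rule subgroup_adjoin) simp
  have H1_H2: "H1 \<subseteq> H2" unfolding H2_def by (rule adjoin_incl) (rule subgroup.subset[OF sub1])
  have a2: "?a \<in> H2" unfolding H2_def by (rule mem_adjoin) (simp_all add: subgroup.one_closed[OF sub1])
  have "inv A \<otimes> ?a \<otimes> A = ?a"
    using int_pow_commute[of A "int k" 1] by (simp add: m_assoc)
  then have aA: "inv A \<otimes> ?a \<otimes> A \<in> H2" using a2 by simp
  have "A [^] (\<alpha> * geom \<alpha> k) \<in> H2"
    by (rule pow_mem_if_gcd_dvd[OF sub2 _ a2]) (use gcd_dvd_geom[OF ord_pos(1) primes_A] in auto)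
  moreover have "inv B \<otimes> ?a \<otimes> B = ?c \<otimes> A [^] (\<alpha> * geom \<alpha> k)"
    by (simp add: m_assoc A_pow_B)
  ultimately have aB: "inv B \<otimes> ?a \<otimes> B \<in> H2"
    using c1 H1_H2 subgroup.m_closed[OF sub2] by auto
  have N2: "H2 \<lhd> G" unfolding H2_def
    by (rule normal_adjoin[OF N1]) (use aA aB H2_def in auto)
  define H3 where "H3 = adjoin H2 ?b"
  have sub3: "subgroup H3 G" unfolding H3_def using N2 by (rule subgroup_adjoin) simp
  have H2_H3: "H2 \<subseteq> H3" unfolding H3_def by (rule adjoin_incl) (rule subgroup.subset[OF sub2])
  have b3: "?b \<in> H3" unfolding H3_def by (rule mem_adjoin) (simp_all add: subgroup.one_closed[OF sub2])
  have "inv B \<otimes> ?b \<otimes> B = ?b"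
    using int_pow_commute[of B "int k" 1] by (simp add: m_assoc)
  then have bB: "inv B \<otimes> ?b \<otimes> B \<in> H3" using b3 by simp
  have "B [^] (\<beta> * geom \<beta> k) \<in> H3"
    by (rule pow_mem_if_gcd_dvd[OF sub3 _ b3]) (use gcd_dvd_geom[OF ord_pos(2) primes_B] in auto)
  moreover have "C [^] (- int k) \<in> H3"
    using c1 H1_H2 H2_H3 subgroup.m_inv_closed[OF sub3] by (auto simp: int_pow_neg)
  moreover have "inv A \<otimes> ?b \<otimes> A = C [^] (- int k) \<otimes> B [^] (\<beta> * geom \<beta> k)"
    by (simp add: m_assoc B_pow_A)
  ultimately have bA: "inv A \<otimes> ?b \<otimes> A \<in> H3"
    using subgroup.m_closed[OF sub3] by auto
  have N3: "H3 \<lhd> G" unfolding H3_def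
    by (rule normal_adjoin[OF N2]) (use bA bB H3_def in auto)
  have pows: "?a [^] int p \<in> H1" "?b [^] int p \<in> H2" "?c [^] int p \<in> H"
    using H H_H1 H1_H2 by (auto simp: int_pow_pow)
  show ?thesis
  proof
    show "H3 \<lhd> G" "?a \<in> H3" "?b \<in> H3" "?c \<in> H3"
      using N3 b3 a2 c1 H1_H2 H2_H3 by auto
    fix g assume g: "g \<in> H3"
    have [simp]: "g \<in> carrier G" using g subgroup.mem_carrier[OF sub3] by blast
    have "g [^] int p \<in> H2" by (rule adjoin_pow_mem[OF N2 _ pows(2)]) (use g H3_def in auto)
    then have "(g [^] int p) [^] int p \<in> H1"
      by (intro adjoin_pow_mem[OF N1 _ pows(1)]) (auto simp: H2_def)
    then have "((g [^] int p) [^] int p) [^] int p \<in> H"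
      by (intro adjoin_pow_mem[OF N _ pows(3)]) (auto simp: H1_def)
    then show "g [^] int (p ^ 3) \<in> H"
      by (simp add: int_pow_pow power3_eq_cube)
  qed
qed

text \<open>Descent from the trivial subgroup at \<open>k = L\<close>: the primes of
  \<open>k'\<close> are removed from the exponent one by one, so only they enter \<open>M\<close>.
  Used with \<open>k' = 3 ^ e\<close> and with \<open>k = 3 ^ e\<close>, it supplies the two
  commuting factors.\<close>

lemma normal_power_subgroup:
  assumes "L = k * k'"
  obtains K M where "K \<lhd> G" "A [^] int k \<in> K" "B [^] int k \<in> K" "C [^] int k \<in> K"
    "M > 0" "\<And>g. g \<in> K \<Longrightarrow> g [^] int M = \<one>" "\<And>p. Factorial_Ring.prime p \<Longrightarrow> p dvd M \<Longrightarrow> p dvd k'"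
  using assms
proof (induction k' arbitrary: k thesis rule: less_induct)
  case (less k')
  show ?case
  proof (cases "k' = 1")
    case True
    show ?thesis
    proof (rule less.prems(1)[of "{\<one>}" 1])
      show "{\<one>} \<lhd> G" by (rule one_is_normal)
    qed (use True less.prems A_L B_L C_L in auto)
  next
    case False
    then obtain p where p: "Factorial_Ring.prime p" "p dvd k'" using prime_factor_nat by blast
    then obtain j where j: "k' = p * j" by blast
    have "j < k'" using j less.prems(2) L_pos prime_gt_1_nat[OF p(1)] by auto
    moreover have "L = (k * p) * j" using less.prems(2) j by simp
    ultimately obtain H M where H: "H \<lhd> G" "A [^] int (k * p) \<in> H" "B [^] int (k * p) \<in> H" "C [^] int (k * p) \<in> H"
      "M > 0" "\<And>g. g \<in> H \<Longrightarrow> g [^] int M = \<one>" "\<And>p. Factorial_Ring.prime p \<Longrightarrow> p dvd M \<Longrightarrow> p dvd j"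
      using less.IH[of j "k * p"] by metis
    obtain K where K: "K \<lhd> G" "A [^] int k \<in> K" "B [^] int k \<in> K" "C [^] int k \<in> K"
      "\<And>g. g \<in> K \<Longrightarrow> g [^] int (p ^ 3) \<in> H"
      using normal_power_step[OF H(1) p(1) H(2-4)] by metis
    show ?thesis
    proof (rule less.prems(1)[of K "p ^ 3 * M"])
      show "p ^ 3 * M > 0" using H(5) prime_gt_0_nat[OF p(1)] by simp
      show "g [^] int (p ^ 3 * M) = \<one>" if "g \<in> K" for g
      proof -
        have "g \<in> carrier G" using that K(1) by (meson normal_imp_subgroup subgroup.mem_carrier)
        then show ?thesis using H(6)[OF K(5)[OF that]] by (simp add: int_pow_pow)
      qed
      show "q dvd k'" if "Factorial_Ring.prime q" "q dvd p ^ 3 * M" for q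
        using that H(7)[of q] p j by (metis dvd_mult dvd_triv_left prime_dvd_mult_iff prime_dvd_power primes_dvd_imp_eq)
    qed (use K in auto)
  qed
qed

end

section \<open>Order bounds in the 3-part\<close>

lemma inverse_mod_three_power:
  fixes r :: int
  assumes "\<not> 3 dvd r"
  obtains s where "[r * s = 1] (mod 3 ^ E)"
proof -
  have "Factorial_Ring.prime (3::int)" by simp
  then have "coprime (3::int) r" using assms by (rule prime_imp_coprime)
  then have "coprime r (3 ^ E)" by (simp add: coprime_commute)
  then show ?thesis using that cong_solve_coprime_int by blast
qed

context group
begin

text \<open>A factor \<open>r\<close> prime to 3 is invertible modulo the exponent
  \<open>3 ^ E\<close> of \<open>x\<close>.\<close>

lemma int_pow_unit_root:
  fixes r k j :: int
  assumes "x \<in> carrier G" "x [^] (3 ^ E :: int) = \<one>" "\<not> 3 dvd r"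
    and "y \<in> carrier G" "x [^] (k * r) = y [^] j"
  obtains l :: int where "x [^] k = y [^] (j * l)"
proof -
  obtain s where s: "[r * s = 1] (mod 3 ^ E)" using inverse_mod_three_power[OF assms(3)] .
  have "[k * (r * s) = k * 1] (mod 3 ^ E)" by (intro cong_mult s cong_refl)
  then have "x [^] k = x [^] (k * r * s)"
    using int_pow_cong[OF assms(1,2)] by (simp add: mult.assoc)
  also have "\<dots> = (x [^] (k * r)) [^] s" using assms(1) by (simp add: int_pow_pow)
  also have "\<dots> = y [^] (j * s)" using assms(4,5) by (simp add: int_pow_pow)
  finally show ?thesis using that by blast
qed

lemma int_pow_unit_trivial:
  fixes r k :: int
  assumes "x \<in> carrier G" "x [^] (3 ^ E :: int) = \<one>" "\<not> 3 dvd r" "x [^] (k * r) = \<one>"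
  shows "x [^] k = \<one>"
  using int_pow_unit_root[OF assms(1-3) one_closed, of k 0] assms(4) by auto

lemma int_pow_dvd_trivial:
  fixes m k :: int
  assumes "x \<in> carrier G" "x [^] m = \<one>" "m dvd k"
  shows "x [^] k = \<one>"
  using assms by (auto simp: int_pow_pow[symmetric] elim!: dvdE)

end

text \<open>Because 3 divides \<open>w\<close> exactly once, \<open>A1\<close> and \<open>B1\<close>
  express \<open>A^9\<close> and \<open>B^(3^(n+1))\<close>, up to units in the exponent, by much
  higher powers. Eliminating \<open>C\<close> makes \<open>A^27\<close> a power of
  \<open>B^(3^(2n+1))\<close> and that a power of \<open>A^81\<close>; fed into each other, these
  force both to be trivial. The mixed terms then disappear from \<open>A1\<close> and
  \<open>B1\<close>, and the sharp bounds follow for \<open>B\<close>, then \<open>C\<close>, then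
  \<open>A\<close>.\<close>

lemma (in macdonald) order_bounds_from_relation:
  fixes y z w n E :: nat
  assumes tor: "A [^] (3 ^ E :: int) = \<one>" "B [^] (3 ^ E :: int) = \<one>" "C [^] (3 ^ E :: int) = \<one>"
    and rel: "B [^] int y = A [^] int z \<otimes> C [^] int w"
    and y: "3 ^ (2 * n) dvd y" and z: "27 dvd z" and w: "w mod 9 = 6"
    and \<alpha>: "\<alpha> = int t" "t mod 9 = 7"
    and \<beta>: "\<beta> - 1 = 3 ^ n * v" "\<not> 3 dvd v" and n: "n \<ge> 2"
  shows "A [^] (9::int) = \<one>" "B [^] (3 ^ (n + 1) :: int) = \<one>" "C [^] (3::int) = \<one>"
proof -
  have b3: "3 ^ n dvd \<beta> - 1" using \<beta> by simp
  have a3: "3 ^ 1 dvd \<alpha> - 1" using \<alpha> by simp presburger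
  have "(3::int) dvd \<beta> - 1" using b3 n by (metis dvd_power dvd_trans less_le_trans pos2)
  then have "\<not> 3 dvd \<beta>" by presburger
  \<comment> \<open>An inverse of \<beta> on the powers of \<open>B\<close>, so that they can pass
    \<open>C\<close> in the other direction.\<close>
  then obtain s where s: "[\<beta> * s = 1] (mod 3 ^ E)" using inverse_mod_three_power by blast
  obtain ra where ra: "(\<alpha> ^ w - 1) = 9 * ra" "\<not> 3 dvd ra"
  proof -
    have "[\<alpha> ^ w = 10] (mod 27)" using mod_27_power[OF \<alpha>(2) w] \<alpha>(1) by simp
    then have "27 dvd (\<alpha> ^ w - 10)" by (simp add: cong_iff_dvd_diff)
    then obtain l where "\<alpha> ^ w - 10 = 27 * l" by blast
    then have "\<alpha> ^ w - 1 = 9 * (1 + 3 * l)" by simp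
    moreover have "\<not> 3 dvd 1 + 3 * l" by presburger
    ultimately show ?thesis using that by blast
  qed
  \<comment> \<open>\<open>geom \<beta> w\<close> is congruent to \<open>w\<close>, hence to 6,
    modulo 9: it adds exactly one factor 3 to the \<open>3 ^ n\<close> of
    \<open>\<beta> - 1\<close>.\<close>
  obtain rb where rb: "(\<beta> ^ w - 1) = 3 ^ (n + 1) * rb" "\<not> 3 dvd rb"
  proof -
    have "3 ^ 2 dvd \<beta> - 1" using b3 n by (meson dvd_trans le_imp_power_dvd)
    then have "9 dvd geom \<beta> w - int w" using dvd_geom_one_minus[of \<beta> w] dvd_trans by fastforce
    then have "geom \<beta> w mod 9 = 6" using w by presburger
    then have "geom \<beta> w = 3 * (geom \<beta> w div 3)" "\<not> 3 dvd geom \<beta> w div 3" by presburger+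
    then obtain l where l: "geom \<beta> w = 3 * l" "\<not> 3 dvd l" by blast
    have "\<beta> ^ w - 1 = 3 ^ (n + 1) * (v * l)"
      using geom_times[of \<beta> w] by (simp add: \<beta>(1) l algebra_simps)
    moreover have "\<not> 3 dvd v * l" using \<beta>(2) l(2) by (simp add: prime_dvd_mult_iff)
    ultimately show ?thesis using that by blast
  qed
  define Y where "Y = int y * \<beta> ^ y - \<beta> * geom \<beta> y"
  have Y: "3 ^ (3 * n) dvd Y"
    using three_power_dvd_geom_shift[OF b3 _ y, of 0] n by (simp add: Y_def)
  have "(3::int) ^ (2 * n + 1) dvd 3 ^ (3 * n)" using n by (intro le_imp_power_dvd) simp
  then have Y': "3 ^ (2 * n + 1) dvd Y" using Y by (rule dvd_trans)
  define K where "K = int z * \<alpha> ^ z - \<alpha> * geom \<alpha> z"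
  have K: "81 dvd K"
    using three_power_dvd_geom_shift[OF a3 _, of 3 z 0] z by (simp add: K_def)

  \<comment> \<open>Commute \<open>A\<close> with both sides of \<open>rel\<close>: past
    \<open>A^z C^w\<close> by the first relation, past \<open>B^y\<close> by
    \<open>B_pow_A\<close>.\<close>
  have "A \<otimes> B [^] int y = B [^] int y \<otimes> A [^] (\<alpha> ^ w)"
  proof -
    have "A \<otimes> (A [^] int z \<otimes> C [^] int w) = A [^] int z \<otimes> (A [^] (1::int) \<otimes> C [^] int w)"
      using int_pow_commute[of A 1 "int z"] by (simp add: m_assoc[symmetric])
    then show ?thesis unfolding rel using A_pow_C_pow[of 1 w] by (simp add: m_assoc)
  qed
  also have "\<dots> = B [^] int y \<otimes> A \<otimes> A [^] (\<alpha> ^ w - 1)"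
    using int_pow_mult[of A 1 "\<alpha> ^ w - 1"] by (simp add: m_assoc)
  finally have "B [^] int y = C [^] (- int y) \<otimes> (B [^] (\<beta> * geom \<beta> y) \<otimes> A [^] (\<alpha> ^ w - 1))"
    unfolding B_pow_A by (simp add: m_assoc)
  then have "C [^] int y \<otimes> B [^] int y = B [^] (\<beta> * geom \<beta> y) \<otimes> A [^] (\<alpha> ^ w - 1)"
    by (simp add: int_pow_neg)
  then have "B [^] (- (\<beta> * geom \<beta> y)) \<otimes> (B [^] (int y * \<beta> ^ y) \<otimes> C [^] int y)
      = B [^] (- (\<beta> * geom \<beta> y)) \<otimes> (B [^] (\<beta> * geom \<beta> y) \<otimes> A [^] (\<alpha> ^ w - 1))"
    by (simp add: C_pow_B_pow)
  then have A1: "A [^] (9 * ra) = B [^] Y \<otimes> C [^] int y"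
    by (simp add: int_pow_add_left Y_def ra(1))
  \<comment> \<open>Comparing \<open>A1\<close> with its conjugate by \<open>C\<close> cancels
    \<open>C^y\<close>.\<close>
  have A1': "A [^] (9 * ra * (1 - \<alpha>)) = B [^] (Y * ((\<beta> - 1) * s))"
  proof -
    have "C \<otimes> A [^] (9 * ra) = B [^] (Y * \<beta>) \<otimes> (C \<otimes> C [^] int y)"
      unfolding A1 by (simp add: m_assoc[symmetric] C_mult_B_pow)
    also have "C \<otimes> C [^] int y = C [^] int y \<otimes> C"
      using int_pow_commute[of C 1 "int y"] by simp
    also have "B [^] (Y * \<beta>) \<otimes> (C [^] int y \<otimes> C) = B [^] (Y * (\<beta> - 1)) \<otimes> (A [^] (9 * ra) \<otimes> C)"
      unfolding A1 by (simp add: m_assoc int_pow_add_left algebra_simps)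
    also have "\<dots> = B [^] (Y * (\<beta> - 1)) \<otimes> (C \<otimes> A [^] (9 * ra * \<alpha>))"
      by (simp add: A_pow_mult_C)
    also have "B [^] (Y * (\<beta> - 1)) = B [^] (Y * ((\<beta> - 1) * s) * \<beta>)"
    proof (rule int_pow_cong[OF _ tor(2)])
      have "[Y * (\<beta> - 1) * 1 = Y * (\<beta> - 1) * (\<beta> * s)] (mod 3 ^ E)"
        by (intro cong_mult cong_refl cong_sym[OF s])
      then show "[Y * (\<beta> - 1) = Y * ((\<beta> - 1) * s) * \<beta>] (mod 3 ^ E)" by (simp add: mult_ac)
    qed simp
    also have "B [^] (Y * ((\<beta> - 1) * s) * \<beta>) \<otimes> (C \<otimes> A [^] (9 * ra * \<alpha>))
        = C \<otimes> (B [^] (Y * ((\<beta> - 1) * s)) \<otimes> A [^] (9 * ra * \<alpha>))"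
      by (simp add: m_assoc[symmetric] C_mult_B_pow)
    finally have "A [^] (9 * ra) = B [^] (Y * ((\<beta> - 1) * s)) \<otimes> A [^] (9 * ra * \<alpha>)" by simp
    then have "A [^] (9 * ra) \<otimes> A [^] (- (9 * ra * \<alpha>))
        = B [^] (Y * ((\<beta> - 1) * s)) \<otimes> A [^] (9 * ra * \<alpha>) \<otimes> A [^] (- (9 * ra * \<alpha>))" by simp
    then show ?thesis
      by (simp add: m_assoc int_pow_mult[symmetric] algebra_simps)
  qed
  \<comment> \<open>\<open>1 - \<alpha>\<close> is 3 times a unit modulo powers of 3, which turns
    \<open>9 * ra\<close> into 27 times a unit.\<close>
  obtain l1 where l1: "A [^] (27::int) = B [^] (3 ^ (2 * n + 1) * l1 :: int)"
  proof -
    obtain q where q: "t = 7 + 9 * q" using \<alpha>(2) by (metis mod_mult_div_eq add.commute)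
    have "9 * ra * (1 - \<alpha>) = 27 * (ra * (- 2 - 3 * int q))" by (simp add: \<alpha>(1) q algebra_simps)
    moreover have "\<not> 3 dvd - 2 - 3 * int q" by presburger
    then have "\<not> 3 dvd ra * (- 2 - 3 * int q)" using ra(2) by (simp add: prime_dvd_mult_iff)
    ultimately obtain l where l: "A [^] (27::int) = B [^] (Y * ((\<beta> - 1) * s) * l)"
      using int_pow_unit_root[OF A_closed tor(1) _ B_closed, of "ra * (- 2 - 3 * int q)" 27] A1' by metis
    obtain l' where "Y = 3 ^ (2 * n + 1) * l'" using Y' by blast
    then show ?thesis using that[of "l' * ((\<beta> - 1) * s) * l"] l by (simp add: mult_ac)
  qed

  \<comment> \<open>The same with \<open>B\<close>: it commutes with \<open>B^y\<close>, hence with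
    \<open>A^z C^w\<close>, and \<open>A_pow_B\<close> moves it past \<open>A^z\<close>.\<close>
  have "B \<otimes> A [^] int z = A [^] int z \<otimes> B [^] (\<beta> ^ w)"
  proof -
    have "B \<otimes> (A [^] int z \<otimes> C [^] int w) = A [^] int z \<otimes> (C [^] int w \<otimes> B [^] (1::int))"
      unfolding rel[symmetric] using int_pow_commute[of B 1 "int y"] rel by (simp add: m_assoc[symmetric])
    also have "\<dots> = A [^] int z \<otimes> B [^] (\<beta> ^ w) \<otimes> C [^] int w"
      unfolding C_pow_B_pow by (simp add: m_assoc)
    finally show ?thesis by (simp add: m_assoc[symmetric])
  qed
  also have "\<dots> = A [^] int z \<otimes> B \<otimes> B [^] (\<beta> ^ w - 1)"
    using int_pow_mult[of B 1 "\<beta> ^ w - 1"] by (simp add: m_assoc)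
  finally have "A [^] int z = C [^] int z \<otimes> (A [^] (\<alpha> * geom \<alpha> z) \<otimes> B [^] (\<beta> ^ w - 1))"
    unfolding A_pow_B by (simp add: m_assoc)
  then have "C [^] (- int z) \<otimes> A [^] int z = A [^] (\<alpha> * geom \<alpha> z) \<otimes> B [^] (\<beta> ^ w - 1)"
    by (simp add: int_pow_neg)
  moreover have "C [^] (- int z) \<otimes> A [^] (int z) = A [^] (int z * \<alpha> ^ z) \<otimes> C [^] (- int z)"
  proof -
    have "C [^] int z \<otimes> (A [^] (int z * \<alpha> ^ z) \<otimes> C [^] (- int z)) = A [^] int z"
      using A_pow_C_pow[of "int z" z, symmetric] by (simp add: m_assoc[symmetric] int_pow_neg) (simp add: m_assoc)
    then have "C [^] (- int z) \<otimes> A [^] int z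
        = C [^] (- int z) \<otimes> (C [^] int z \<otimes> (A [^] (int z * \<alpha> ^ z) \<otimes> C [^] (- int z)))" by simp
    then show ?thesis by (simp add: int_pow_add_left)
  qed
  ultimately have "A [^] (- (\<alpha> * geom \<alpha> z)) \<otimes> (A [^] (int z * \<alpha> ^ z) \<otimes> C [^] (- int z))
      = A [^] (- (\<alpha> * geom \<alpha> z)) \<otimes> (A [^] (\<alpha> * geom \<alpha> z) \<otimes> B [^] (\<beta> ^ w - 1))" by simp
  then have B1: "B [^] (\<beta> ^ w - 1) = A [^] K \<otimes> C [^] (- int z)"
    by (simp add: int_pow_add_left K_def)
  have B1': "B [^] ((\<beta> ^ w - 1) * (s - 1)) = A [^] (K * (\<alpha> - 1))"
  proof -
    let ?V = "\<beta> ^ w - 1"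
    have "C \<otimes> B [^] (?V * s) = B [^] (?V * s * \<beta>) \<otimes> C" by (rule C_mult_B_pow)
    also have "B [^] (?V * s * \<beta>) = B [^] ?V"
    proof (rule int_pow_cong[OF _ tor(2)])
      have "[?V * (\<beta> * s) = ?V * 1] (mod 3 ^ E)" by (intro cong_mult cong_refl s)
      then show "[?V * s * \<beta> = ?V] (mod 3 ^ E)" by (simp add: mult_ac)
    qed simp
    also have "B [^] ?V \<otimes> C = A [^] K \<otimes> (C \<otimes> C [^] (- int z))"
      unfolding B1 using int_pow_commute[of C 1 "- int z"] by (simp add: m_assoc)
    also have "\<dots> = C \<otimes> (A [^] (K * \<alpha>) \<otimes> C [^] (- int z))"
      by (simp add: m_assoc[symmetric] A_pow_mult_C)
    also have "A [^] (K * \<alpha>) \<otimes> C [^] (- int z) = A [^] (K * (\<alpha> - 1)) \<otimes> B [^] ?V"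
      unfolding B1 by (simp add: int_pow_add_left algebra_simps)
    finally have "B [^] (?V * s) = A [^] (K * (\<alpha> - 1)) \<otimes> B [^] ?V" by simp
    then have "B [^] (?V * s) \<otimes> B [^] (- ?V) = A [^] (K * (\<alpha> - 1)) \<otimes> B [^] ?V \<otimes> B [^] (- ?V)" by simp
    then show ?thesis
      by (simp add: m_assoc int_pow_mult[symmetric] algebra_simps)
  qed
  \<comment> \<open>Multiplying the exponent by \<beta> replaces \<open>s - 1\<close> by
    \<open>1 - \<beta>\<close>, and \<open>(\<beta> ^ w - 1) * (1 - \<beta>)\<close> is
    \<open>3 ^ (2 * n + 1)\<close> times a unit.\<close>
  obtain l2 where l2: "B [^] (3 ^ (2 * n + 1) :: int) = A [^] (81 * l2 :: int)"
  proof -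
    have "B [^] (3 ^ (2 * n + 1) * (- rb * v)) = B [^] ((\<beta> ^ w - 1) * (s - 1) * \<beta>)"
    proof (rule int_pow_cong[OF _ tor(2)])
      have "[(\<beta> ^ w - 1) * (\<beta> * s - \<beta>) = (\<beta> ^ w - 1) * (1 - \<beta>)] (mod 3 ^ E)"
        by (intro cong_mult cong_diff cong_refl s)
      moreover have "(\<beta> ^ w - 1) * (1 - \<beta>) = 3 ^ (2 * n + 1) * (- rb * v)"
      proof -
        have "1 - \<beta> = - (3 ^ n * v)" using \<beta>(1) by simp
        then show ?thesis unfolding rb(1) by (simp add: mult_2 power_add)
      qed
      moreover have "(\<beta> ^ w - 1) * (\<beta> * s - \<beta>) = (\<beta> ^ w - 1) * (s - 1) * \<beta>"
        by (simp add: algebra_simps)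
      ultimately show "[3 ^ (2 * n + 1) * (- rb * v) = (\<beta> ^ w - 1) * (s - 1) * \<beta>] (mod 3 ^ E)"
        by (metis cong_sym)
    qed simp
    also have "\<dots> = A [^] (K * (\<alpha> - 1) * \<beta>)"
      using B1' by (metis A_closed B_closed int_pow_pow)
    finally have "B [^] (3 ^ (2 * n + 1) * (- rb * v)) = A [^] (K * (\<alpha> - 1) * \<beta>)" .
    moreover have "\<not> 3 dvd - rb * v" using rb(2) \<beta>(2) by (simp add: prime_dvd_mult_iff)
    ultimately obtain l where "B [^] (3 ^ (2 * n + 1) :: int) = A [^] (K * (\<alpha> - 1) * \<beta> * l)"
      using int_pow_unit_root[OF B_closed tor(2) _ A_closed] by metis
    moreover obtain K' where "K = 81 * K'" using K by blast
    ultimately show ?thesis using that[of "K' * (\<alpha> - 1) * \<beta> * l"] by (simp add: mult_ac)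
  qed

  have A27: "A [^] (27::int) = \<one>"
  proof -
    have "A [^] (27::int) = (B [^] (3 ^ (2 * n + 1) :: int)) [^] l1" by (simp add: l1 int_pow_pow)
    also have "\<dots> = A [^] (81 * l2 * l1)" unfolding l2 by (simp add: int_pow_pow)
    finally have "A [^] (27::int) = A [^] (81 * l2 * l1)" .
    then have "A [^] (27 * (1 - 3 * (l2 * l1))) = \<one>"
      using int_pow_diff[of A 27 "81 * l2 * l1"] by (simp add: algebra_simps)
    moreover have "\<not> 3 dvd 1 - 3 * (l2 * l1)" by presburger
    ultimately show ?thesis using int_pow_unit_trivial[OF A_closed tor(1)] by blast
  qed
  have B2n: "B [^] (3 ^ (2 * n + 1) :: int) = \<one>"
    unfolding l2 by (rule int_pow_dvd_trivial[OF A_closed A27]) simp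
  have "B [^] Y = \<one>" using Y' int_pow_dvd_trivial[OF B_closed B2n] by blast
  then have A2: "A [^] (9 * ra) = C [^] int y" using A1 by simp
  have "A [^] K = \<one>" using K by (intro int_pow_dvd_trivial[OF A_closed A27]) (auto elim: dvd_trans[rotated])
  then have B2: "B [^] (\<beta> ^ w - 1) = C [^] (- int z)" using B1 by simp
  have "A [^] int z = \<one>" using z by (intro int_pow_dvd_trivial[OF A_closed A27]) presburger
  then have C2: "C [^] int w = B [^] int y" using rel by simp
  obtain l3 where l3: "C [^] (3::int) = B [^] (int y * l3)"
  proof -
    have "int w = 3 * int (w div 3)" "\<not> 3 dvd int (w div 3)" using w by presburger+
    then show ?thesis
      using int_pow_unit_root[OF gcomm_closed[OF A_closed B_closed] tor(3) _ B_closed, of "int (w div 3)" 3 "int y"] C2 that by metis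
  qed
  \<comment> \<open>By \<open>l3\<close>, \<open>C^(-z)\<close> is a power of \<open>B\<close> whose
    exponent is divisible by \<open>3 ^ (n + 2)\<close>, while the left side of \<open>B2\<close>
    has an exponent divisible by \<open>3 ^ (n + 1)\<close> only.\<close>
  show Bn: "B [^] (3 ^ (n + 1) :: int) = \<one>"
  proof -
    obtain z' where z': "int z = 27 * z'" using z by (metis dvdE int_dvd_int_iff of_nat_numeral)
    obtain y' where y': "int y = 3 ^ (2 * n) * y'" using y by (metis dvdE int_dvd_int_iff of_nat_numeral of_nat_power)
    have "C [^] (- int z) = (C [^] (3::int)) [^] (- 9 * z')" by (simp add: int_pow_pow z')
    also have "\<dots> = B [^] (int y * l3 * (- 9 * z'))" unfolding l3 by (simp add: int_pow_pow)
    also have "int y * l3 * (- 9 * z') = 3 ^ (n + 1) * (- 3 * (3 ^ n * (y' * l3 * z')))"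
      by (simp add: y' mult_2 power_add)
    finally have "B [^] (3 ^ (n + 1) * rb) = B [^] (3 ^ (n + 1) * (- 3 * (3 ^ n * (y' * l3 * z'))))"
      using B2 rb(1) by simp
    then have "B [^] (3 ^ (n + 1) * (rb - (- 3 * (3 ^ n * (y' * l3 * z'))))) = \<one>"
      by (simp only: right_diff_distrib[of "3 ^ (n + 1)"] int_pow_diff B_closed r_inv int_pow_closed)
    moreover have "\<not> 3 dvd rb - (- 3 * (3 ^ n * (y' * l3 * z')))" using rb(2) by presburger
    ultimately show ?thesis using int_pow_unit_trivial[OF B_closed tor(2)] by blast
  qed
  have "(3::nat) ^ (n + 1) dvd 3 ^ (2 * n)" using n by (intro le_imp_power_dvd) simp
  then have "3 ^ (n + 1) dvd int y" using y by (metis dvd_trans int_dvd_int_iff of_nat_numeral of_nat_power)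
  then show C3: "C [^] (3::int) = \<one>"
    unfolding l3 by (intro int_pow_dvd_trivial[OF B_closed Bn]) simp
  have "3 dvd int y" using \<open>3 ^ (n + 1) dvd int y\<close> by (metis dvd_mult_left power_Suc Suc_eq_plus1)
  then have "C [^] int y = \<one>" by (intro int_pow_dvd_trivial[OF _ C3]) simp_all
  then have "A [^] (9 * ra) = \<one>" using A2 by simp
  then show "A [^] (9::int) = \<one>" using int_pow_unit_trivial[OF A_closed tor(1) ra(2)] by simp
qed

text \<open>In the 3-part \<open>C^(t+1)\<close> equals \<open>C^(-j)\<close> for some natural
  \<open>j\<close>, and in this form it can be moved to the right of \<open>A\<close>. The final
  exponent of \<open>C\<close> is \<open>(t + 1) - (u + 2) = \<alpha> - \<beta>\<close>, which is 6
  modulo 9 under the congruences of the theorem.\<close>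

lemma (in macdonald) B_pow_eq_A_pow_C_pow:
  fixes t u E :: nat
  assumes tor: "C [^] (3 ^ E :: int) = \<one>" and \<alpha>: "\<alpha> = int t" and \<beta>: "\<beta> - 1 = int u"
  obtains j where "B [^] (int u * \<beta> ^ (u + 1) - \<beta> * geom \<beta> u)
    = A [^] (- (\<alpha> ^ (t + 1) - \<alpha> * geom \<alpha> t) * \<alpha> ^ j) \<otimes> C [^] (\<alpha> - \<beta>)"
proof -
  define y where "y = int u * \<beta> ^ (u + 1) - \<beta> * geom \<beta> u"
  define z where "z = \<alpha> ^ (t + 1) - \<alpha> * geom \<alpha> t"
  define j where "j = nat ((- int (Suc t)) mod 3 ^ E)"
  have j: "C [^] (- int j) = C [^] int (Suc t)"
  proof (rule int_pow_cong[OF _ tor])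
    have "int j = (- int (Suc t)) mod 3 ^ E" by (simp add: j_def del: of_nat_Suc)
    then have "[int j = - int (Suc t)] (mod 3 ^ E)" by (simp add: cong_def del: of_nat_Suc)
    then show "[- int j = int (Suc t)] (mod 3 ^ E)" using cong_minus_minus_iff by fastforce
  qed simp
  have "A \<otimes> (B [^] y \<otimes> C [^] (int u + 2)) = C \<otimes> (C [^] int t \<otimes> A [^] (\<alpha> * geom \<alpha> t))"
    unfolding y_def conj_relation_pos[OF \<beta>] using AC_pow[of t] \<alpha> by simp
  also have "\<dots> = C [^] int (Suc t) \<otimes> A [^] (\<alpha> * geom \<alpha> t)"
    unfolding int_pow_Suc(2)[OF gcomm_closed[OF A_closed B_closed]] by (simp add: m_assoc)
  finally have "inv A \<otimes> (A \<otimes> (B [^] y \<otimes> C [^] (int u + 2)))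
      = A [^] (- 1 :: int) \<otimes> C [^] int (Suc t) \<otimes> A [^] (\<alpha> * geom \<alpha> t)"
    by (simp add: int_pow_neg m_assoc del: of_nat_Suc)
  also have "\<dots> = C [^] int (Suc t) \<otimes> A [^] (- z)"
    unfolding A_pow_C_pow by (simp add: z_def m_assoc int_pow_mult[symmetric] del: of_nat_Suc)
  also have "\<dots> = A [^] (- z * \<alpha> ^ j) \<otimes> C [^] int (Suc t)"
  proof -
    have "C [^] (- int j) \<otimes> (A [^] (- z) \<otimes> C [^] int j) \<otimes> C [^] (- int j)
        = A [^] (- z * \<alpha> ^ j) \<otimes> C [^] (- int j)"
      unfolding A_pow_C_pow by (simp add: int_pow_add_left)
    then show ?thesis unfolding j[symmetric] by (simp add: m_assoc int_pow_mult[symmetric])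
  qed
  finally have "B [^] y \<otimes> C [^] (int u + 2) \<otimes> C [^] (- (int u + 2))
      = A [^] (- z * \<alpha> ^ j) \<otimes> C [^] int (Suc t) \<otimes> C [^] (- (int u + 2))"
    by (simp del: of_nat_Suc)
  moreover have "int (Suc t) + (- int u - 2) = \<alpha> - \<beta>" using \<alpha> \<beta> by simp
  ultimately have "B [^] y = A [^] (- z * \<alpha> ^ j) \<otimes> C [^] (\<alpha> - \<beta>)"
    by (simp add: m_assoc int_pow_mult[symmetric] del: of_nat_Suc)
  then show ?thesis using that unfolding y_def z_def by blast
qed

text \<open>The exponents are replaced by natural residues modulo \<open>3 ^ E\<close>; the lower
  bounds on \<open>E\<close> let the divisibility by \<open>3 ^ (2 * n)\<close>, by 27 and the
  residue modulo 9 survive.\<close>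

lemma (in macdonald) order_bounds_positive:
  fixes t u n E :: nat
  assumes tor: "A [^] (3 ^ E :: int) = \<one>" "B [^] (3 ^ E :: int) = \<one>" "C [^] (3 ^ E :: int) = \<one>"
    and \<alpha>: "\<alpha> = int t" "t mod 9 = 7"
    and \<beta>: "\<beta> - 1 = int u" "\<beta> - 1 = 3 ^ n * v" "\<not> 3 dvd v" and n: "n \<ge> 2" and E: "E \<ge> 2 * n" "E \<ge> 3"
  shows "A [^] (9::int) = \<one>" "B [^] (3 ^ (n + 1) :: int) = \<one>" "C [^] (3::int) = \<one>"
proof -
  let ?T = "3 ^ E :: int"
  let ?y = "int u * \<beta> ^ (u + 1) - \<beta> * geom \<beta> u"
  obtain j where j: "B [^] ?y = A [^] (- (\<alpha> ^ (t + 1) - \<alpha> * geom \<alpha> t) * \<alpha> ^ j) \<otimes> C [^] (\<alpha> - \<beta>)"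
    using B_pow_eq_A_pow_C_pow[OF tor(3) \<alpha>(1) \<beta>(1)] .
  let ?z = "- (\<alpha> ^ (t + 1) - \<alpha> * geom \<alpha> t) * \<alpha> ^ j"
  define y z w where "y = nat (?y mod ?T)" and "z = nat (?z mod ?T)" and "w = nat ((\<alpha> - \<beta>) mod ?T)"
  have ints: "int y = ?y mod ?T" "int z = ?z mod ?T" "int w = (\<alpha> - \<beta>) mod ?T"
    by (simp_all add: y_def z_def w_def)
  have dvdT: "3 ^ i dvd ?T" if "i \<le> E" for i using that by (rule le_imp_power_dvd)
  have rel: "B [^] int y = A [^] int z \<otimes> C [^] int w"
  proof -
    have "B [^] int y = B [^] ?y" "A [^] int z = A [^] ?z" "C [^] int w = C [^] (\<alpha> - \<beta>)"
      by (rule int_pow_cong[OF _ tor(2)] int_pow_cong[OF _ tor(1)] int_pow_cong[OF _ tor(3)],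
          simp, simp add: ints cong_def)+
    then show ?thesis using j by simp
  qed
  have "(3::int) ^ n dvd int u" using \<beta> by (metis dvd_triv_left)
  then have "3 ^ n dvd u" by (metis int_dvd_int_iff of_nat_numeral of_nat_power)
  then have "3 ^ (n + n) dvd ?y"
    using \<beta> n by (intro three_power_dvd_geom_shift) auto
  then have "3 ^ (2 * n) dvd int y" unfolding ints using dvdT[OF E(1)] by (simp add: dvd_mod mult_2)
  then have y: "3 ^ (2 * n) dvd y" by (metis int_dvd_int_iff of_nat_numeral of_nat_power)
  have "27 dvd \<alpha> ^ (t + 1) - \<alpha> * geom \<alpha> t" unfolding \<alpha>(1) by (rule dvd_27_relator_exponent[OF \<alpha>(2)])
  then have "27 dvd ?z" by (intro dvd_mult2) (simp only: dvd_minus_iff)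
  then have "27 dvd int z" unfolding ints using dvdT[OF E(2)] by (intro dvd_mod) simp_all
  then have z: "27 dvd z" by presburger
  have w: "w mod 9 = 6"
  proof -
    have "(9::int) dvd 3 ^ n" using le_imp_power_dvd[OF n, of "3::int"] by simp
    then have "9 dvd \<beta> - 1" unfolding \<beta>(2) by simp
    then have "(\<alpha> - \<beta>) mod 9 = 6" using \<alpha> by presburger
    moreover have "9 dvd ?T" using dvdT[of 2] E(2) by simp
    ultimately have "int w mod 9 = 6" unfolding ints by (simp add: mod_mod_cancel)
    then show ?thesis by presburger
  qed
  show "A [^] (9::int) = \<one>" "B [^] (3 ^ (n + 1) :: int) = \<one>" "C [^] (3::int) = \<one>"
    using order_bounds_from_relation[OF tor rel y z w \<alpha> \<beta>(2,3) n] .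
qed

theorem (in macdonald) order_bounds:
  fixes n e :: nat
  assumes tor: "A [^] (3 ^ e :: int) = \<one>" "B [^] (3 ^ e :: int) = \<one>"
    and \<alpha>: "\<alpha> mod 9 = 7"
    and \<beta>: "\<beta> - 1 = 3 ^ n * v" "\<not> 3 dvd v" and n: "n \<ge> 2"
  shows "A [^] (9::int) = \<one>" "B [^] (3 ^ (n + 1) :: int) = \<one>" "C [^] (3::int) = \<one>"
proof -
  \<comment> \<open>\<open>2 * e\<close> covers the order of \<open>C\<close>, which is bounded only
    by the square of that of \<open>B\<close>. The rest satisfies the lower bounds on
    \<open>E\<close> and exceeds \<open>n\<close>, so reducing \<open>\<beta> - 1\<close> modulo
    \<open>3 ^ E\<close> preserves its valuation.\<close>
  define E where "E = 2 * e + 2 * n + 3"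
  let ?T = "3 ^ E :: int"
  have dvdT: "3 ^ i dvd ?T" if "i \<le> E" for i using that by (rule le_imp_power_dvd)
  have "3 ^ e dvd ?T" by (rule dvdT) (simp add: E_def)
  then have T1: "A [^] ?T = \<one>" "B [^] ?T = \<one>"
    using tor by (auto intro: int_pow_dvd_trivial)
  have "C [^] int (3 ^ e * 3 ^ e) = \<one>" using tor(2) by (intro C_pow_trivial) simp
  then have T2: "C [^] ?T = \<one>"
  proof (rule int_pow_dvd_trivial[rotated])
    have "int (3 ^ e * 3 ^ e) = 3 ^ (2 * e)" by (simp add: mult_2 power_add)
    then show "int (3 ^ e * 3 ^ e) dvd ?T" using dvdT[of "2 * e"] by (simp add: E_def)
  qed simp
  define t where "t = nat (\<alpha> mod ?T)"
  define u where "u = nat ((\<beta> - 1) mod ?T)"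
  have t: "int t = \<alpha> mod ?T" and u: "int u = (\<beta> - 1) mod ?T" by (simp_all add: t_def u_def)
  have "A [^] int t = A [^] \<alpha>" by (rule int_pow_cong[OF _ T1(1)]) (simp_all add: t cong_def)
  moreover have "B [^] (int u + 1) = B [^] \<beta>"
    by (rule int_pow_cong[OF _ T1(2)]) (simp_all add: u cong_def mod_simps)
  ultimately interpret m: macdonald G A B "int t" "int u + 1"
    by unfold_locales (simp_all add: rel_A rel_B)
  have "9 dvd ?T" using dvdT[of 2] by (simp add: E_def)
  then have "int t mod 9 = 7" unfolding t using \<alpha> by (simp add: mod_mod_cancel)
  then have t9: "t mod 9 = 7" by presburger
  have "int u = 3 ^ n * (v - 3 * (3 ^ (E - n - 1) * ((\<beta> - 1) div ?T)))"
  proof -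
    have "?T = 3 ^ n * (3 * 3 ^ (E - n - 1))"
    proof -
      have "E = n + Suc (E - n - 1)" by (simp add: E_def)
      then show ?thesis by (metis power_Suc power_add)
    qed
    moreover have "int u = (\<beta> - 1) - ?T * ((\<beta> - 1) div ?T)"
      unfolding u by (simp add: minus_mult_div_eq_mod)
    ultimately show ?thesis using \<beta>(1) by (simp add: algebra_simps)
  qed
  moreover have "\<not> 3 dvd v - 3 * (3 ^ (E - n - 1) * ((\<beta> - 1) div ?T))" using \<beta>(2) by presburger
  ultimately show "A [^] (9::int) = \<one>" "B [^] (3 ^ (n + 1) :: int) = \<one>" "C [^] (3::int) = \<one>"
    using m.order_bounds_positive[OF T1 T2 HOL.refl t9, of u n] n by (auto simp: E_def)
qed

section \<open>Splitting off the 3-part\<close>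

lemma power_of_three_if_only_prime:
  assumes "M > 0" "\<And>p. Factorial_Ring.prime p \<Longrightarrow> p dvd M \<Longrightarrow> p dvd (3::nat) ^ e"
  obtains f where "M = 3 ^ f"
proof -
  have three: "Factorial_Ring.prime (3::nat)" by simp
  obtain r where r: "M = 3 ^ multiplicity 3 M * r" "\<not> 3 dvd r"
    using multiplicity_decompose'[of M 3] assms(1) by auto
  have "r = 1"
  proof (rule ccontr)
    assume "r \<noteq> 1"
    then obtain p where p: "Factorial_Ring.prime p" "p dvd r" using prime_factor_nat by blast
    then have "p dvd 3 ^ e" using assms(2) r(1) by (metis dvd_mult)
    then have "p = 3" using p(1) three by (metis prime_dvd_power primes_dvd_imp_eq)
    then show False using p r by blast
  qed
  then show ?thesis using that r(1) by simp
qed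

context group
begin

lemma int_pow_coprime_trivial:
  assumes "x \<in> carrier G" "x [^] (k::int) = \<one>" "x [^] (m::int) = \<one>" "coprime k m"
  shows "x = \<one>"
proof -
  have "int (ord x) dvd k" "int (ord x) dvd m" using assms by (simp_all add: int_pow_eq_id)
  then have "int (ord x) dvd 1" using assms(4) by (metis coprime_common_divisor)
  then show ?thesis using assms(1) int_pow_eq_id[of x 1] by simp
qed

lemma gcomm_mult_commuting:
  assumes [simp]: "x \<in> carrier G" "x' \<in> carrier G" "y \<in> carrier G" "y' \<in> carrier G"
    and c: "x \<otimes> x' = x' \<otimes> x" "x \<otimes> y' = y' \<otimes> x" "y \<otimes> x' = x' \<otimes> y" "y \<otimes> y' = y' \<otimes> y"
  shows "gcomm G (x \<otimes> x') (y \<otimes> y') = gcomm G x y \<otimes> gcomm G x' y'"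
proof -
  let ?c = "gcomm G x y" and ?c' = "gcomm G x' y'"
  have cx: "?c \<otimes> x' = x' \<otimes> ?c" and cy: "?c \<otimes> y' = y' \<otimes> ?c"
    by (rule commute_gcomm[THEN HOL.sym]; simp add: c)+
  have l: "g \<otimes> (h \<otimes> z) = h \<otimes> (g \<otimes> z)"
    if "g \<otimes> h = h \<otimes> g" "g \<in> carrier G" "h \<in> carrier G" "z \<in> carrier G" for g h z
    using that by (simp add: m_assoc[symmetric])
  have "(y \<otimes> y') \<otimes> ((x \<otimes> x') \<otimes> (?c \<otimes> ?c')) = y \<otimes> (x \<otimes> (y' \<otimes> (x' \<otimes> (?c \<otimes> ?c'))))"
    by (simp add: m_assoc l[OF c(2)])
  also have "\<dots> = y \<otimes> (x \<otimes> (?c \<otimes> (y' \<otimes> (x' \<otimes> ?c'))))"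
    by (simp add: l[OF cx[symmetric]] l[OF cy[symmetric]])
  also have "\<dots> = (y \<otimes> (x \<otimes> ?c)) \<otimes> (x' \<otimes> y')"
    using mult_gcomm[of x' y'] by (simp add: m_assoc)
  also have "\<dots> = (x \<otimes> x') \<otimes> (y \<otimes> y')"
    unfolding mult_gcomm[OF assms(1,3)] by (simp add: m_assoc l[OF c(3)])
  also have "\<dots> = (y \<otimes> y') \<otimes> ((x \<otimes> x') \<otimes> gcomm G (x \<otimes> x') (y \<otimes> y'))"
    by (simp add: mult_gcomm)
  finally show ?thesis by simp
qed

end

text \<open>\<open>i\<close> is the idempotent modulo \<open>L\<close> belonging to the factor
  \<open>3 ^ e\<close>: it is 1 modulo \<open>3 ^ e\<close> and 0 modulo \<open>L'\<close>, so
  \<open>A = A^i A^(1-i)\<close> separates the 3-part of \<open>A\<close> from the rest. The normal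
  subgroups commute elementwise because their exponents are coprime.\<close>

theorem (in torsion_macdonald) three_part_split:
  assumes L: "L = 3 ^ e * L'" "\<not> 3 dvd L'"
  obtains i :: int and P P' f M where "[i = 1] (mod 3 ^ e)"
    "(A [^] i) [^] (3 ^ e :: int) = \<one>" "(B [^] i) [^] (3 ^ e :: int) = \<one>"
    "P \<lhd> G" "P' \<lhd> G" "\<forall>x\<in>P. \<forall>y\<in>P'. x \<otimes> y = y \<otimes> x"
    "A [^] i \<in> P" "B [^] i \<in> P" "A [^] (1 - i) \<in> P'" "B [^] (1 - i) \<in> P'"
    "\<forall>g\<in>P. g [^] (3 ^ f :: int) = \<one>" "\<forall>g\<in>P'. g [^] int M = \<one>" "\<not> 3 dvd M" "M > 0"
proof -
  have three: "Factorial_Ring.prime (3::nat)" by simp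
  obtain P M1 where P: "P \<lhd> G" "A [^] int L' \<in> P" "B [^] int L' \<in> P" "M1 > 0"
    "\<And>g. g \<in> P \<Longrightarrow> g [^] int M1 = \<one>" "\<And>p. Factorial_Ring.prime p \<Longrightarrow> p dvd M1 \<Longrightarrow> p dvd 3 ^ e"
    using normal_power_subgroup[of L' "3 ^ e"] L(1) by (metis mult.commute)
  obtain f where f: "M1 = 3 ^ f" using power_of_three_if_only_prime[OF P(4,6)] by blast
  obtain P' M where P': "P' \<lhd> G" "A [^] int (3 ^ e) \<in> P'" "B [^] int (3 ^ e) \<in> P'" "M > 0"
    "\<And>g. g \<in> P' \<Longrightarrow> g [^] int M = \<one>" "\<And>p. Factorial_Ring.prime p \<Longrightarrow> p dvd M \<Longrightarrow> p dvd L'"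
    using normal_power_subgroup[of "3 ^ e" L'] L(1) by metis
  have M: "\<not> 3 dvd M" using P'(6)[OF three] L(2) by blast
  have subP: "subgroup P G" and subP': "subgroup P' G" using P P' normal_imp_subgroup by blast+
  have "coprime 3 M" using three M by (rule prime_imp_coprime)
  then have copM: "coprime (int (3 ^ f)) (int M)" by (metis coprime_int_iff coprime_power_left_iff)
  have "P \<inter> P' = {\<one>}"
  proof -
    have "g = \<one>" if "g \<in> P" "g \<in> P'" for g
      using int_pow_coprime_trivial[OF _ _ _ copM] P(5)[OF that(1)] P'(5)[OF that(2)] f
        subgroup.mem_carrier[OF subP that(1)] by blast
    then show ?thesis using subgroup.one_closed[OF subP] subgroup.one_closed[OF subP'] by blast
  qed
  then have comm: "x \<otimes> y = y \<otimes> x" if "x \<in> P" "y \<in> P'" for x y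
    using commute_if_normal_disjoint[OF P(1) P'(1)] that by blast
  have "coprime 3 L'" using three L(2) by (rule prime_imp_coprime)
  then have "coprime (3 ^ e :: int) (int L')" by (metis coprime_int_iff coprime_power_left_iff of_nat_numeral)
  then obtain i where i: "[i = 1] (mod 3 ^ e)" "[i = 0] (mod int L')"
    using binary_chinese_remainder_int by blast
  obtain j where j: "i = int L' * j" using i(2) by (auto simp: cong_0_iff)
  obtain j' where j': "1 - i = int (3 ^ e) * j'" using cong_sym[OF i(1)] by (auto simp: cong_iff_dvd_diff)
  have ie: "i * 3 ^ e = int L * j" using L(1) j by simp
  have i1: "1 - int L' * j = int (3 ^ e) * j'" using j j' by simp
  show ?thesis
  proof (rule that[OF i(1) _ _ P(1) P'(1)])
    show "\<forall>x\<in>P. \<forall>y\<in>P'. x \<otimes> y = y \<otimes> x" using comm by blast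
    show "(A [^] i) [^] (3 ^ e :: int) = \<one>" "(B [^] i) [^] (3 ^ e :: int) = \<one>"
      by (simp_all add: int_pow_pow ie) (simp_all add: int_pow_pow[symmetric] A_L B_L)
    show "A [^] i \<in> P" "B [^] i \<in> P"
      using P(2,3) subgroup_int_pow_closed[OF subP, of _ j] by (auto simp: j int_pow_pow[symmetric])
    show "A [^] (1 - i) \<in> P'" "B [^] (1 - i) \<in> P'"
      unfolding j' using P'(2,3) subgroup_int_pow_closed[OF subP', of _ j'] by (auto simp: int_pow_pow[symmetric])
    show "\<forall>g\<in>P. g [^] (3 ^ f :: int) = \<one>" using P(5) f by simp
  qed (use P' M in auto)
qed

text \<open>Commutators split along commuting factors, and the \<open>P'\<close>-component of
  \<open>C\<close> centralises \<open>P\<close>. Hence \<open>C\<close> acts on \<open>P\<close> as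
  the commutator of the \<open>P\<close>-components does, and the relations carry over with the same
  \<alpha> and \<beta>.\<close>

lemma (in macdonald) macdonald_component:
  fixes i :: int
  assumes P: "subgroup P G" "A [^] i \<in> P" "B [^] i \<in> P"
    and P': "subgroup P' G" "A [^] (1 - i) \<in> P'" "B [^] (1 - i) \<in> P'"
    and comm: "\<And>x y. x \<in> P \<Longrightarrow> y \<in> P' \<Longrightarrow> x \<otimes> y = y \<otimes> x"
  shows "macdonald G (A [^] i) (B [^] i) \<alpha> \<beta>"
    and "C = gcomm G (A [^] i) (B [^] i) \<otimes> gcomm G (A [^] (1 - i)) (B [^] (1 - i))"
proof -
  let ?a = "A [^] i" and ?b = "B [^] i" and ?a' = "A [^] (1 - i)" and ?b' = "B [^] (1 - i)"
  let ?c = "gcomm G ?a ?b" and ?c' = "gcomm G ?a' ?b'"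
  interpret P: subgroup P G by fact
  interpret P': subgroup P' G by fact
  have AB: "?a \<otimes> ?a' = A" "?b \<otimes> ?b' = B"
    using int_pow_mult[of A i "1 - i"] int_pow_mult[of B i "1 - i"] by simp_all
  have "gcomm G (?a \<otimes> ?a') (?b \<otimes> ?b') = ?c \<otimes> ?c'"
    by (rule gcomm_mult_commuting) (use P P' comm in simp_all)
  then show C: "C = ?c \<otimes> ?c'" by (simp only: AB)
  have cP: "?c \<in> P" using P by (simp add: gcomm_def)
  have cP': "?c' \<in> P'" using P' by (simp add: gcomm_def)
  have inv_c': "x \<otimes> inv ?c' = inv ?c' \<otimes> x" if "x \<in> P" for x using comm[OF that] cP' by simp
  have *: "inv C \<otimes> x \<otimes> C = inv ?c \<otimes> x \<otimes> ?c" "C \<otimes> x \<otimes> inv C = ?c \<otimes> x \<otimes> inv ?c" if x: "x \<in> P" for x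
  proof -
    have [simp]: "x \<in> carrier G" using x by simp
    have "inv C \<otimes> x \<otimes> C = inv ?c' \<otimes> ((inv ?c \<otimes> x \<otimes> ?c) \<otimes> ?c')"
      unfolding C by (simp add: inv_mult_group m_assoc)
    also have "(inv ?c \<otimes> x \<otimes> ?c) \<otimes> ?c' = ?c' \<otimes> (inv ?c \<otimes> x \<otimes> ?c)"
      by (rule comm) (use x cP cP' in auto)
    finally show "inv C \<otimes> x \<otimes> C = inv ?c \<otimes> x \<otimes> ?c" by simp
    have "C \<otimes> x \<otimes> inv C = ?c \<otimes> ((?c' \<otimes> x) \<otimes> (inv ?c' \<otimes> inv ?c))"
      unfolding C by (simp add: inv_mult_group m_assoc)
    also have "?c' \<otimes> x = x \<otimes> ?c'" using comm[OF x cP'] by simp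
    finally show "C \<otimes> x \<otimes> inv C = ?c \<otimes> x \<otimes> inv ?c" by (simp add: m_assoc)
  qed
  show "macdonald G ?a ?b \<alpha> \<beta>"
  proof
    have "?a \<otimes> C = C \<otimes> ?a [^] \<alpha>" by (simp add: A_pow_mult_C int_pow_pow)
    then show "inv ?c \<otimes> ?a \<otimes> ?c = ?a [^] \<alpha>"
      using *(1)[OF P(2)] by (simp add: m_assoc)
    have "C \<otimes> ?b = ?b [^] \<beta> \<otimes> C" by (simp add: C_mult_B_pow int_pow_pow)
    then show "?c \<otimes> ?b \<otimes> inv ?c = ?b [^] \<beta>"
      using *(2)[OF P(3)] by (simp add: m_assoc)
  qed simp_all
qed

section \<open>Normal forms and nilpotency class\<close>

locale small_macdonald = macdonald +
  fixes n :: nat and v :: int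
  assumes A9: "A [^] (9::int) = \<one>" and Bn: "B [^] (3 ^ (n + 1) :: int) = \<one>" and C3: "C [^] (3::int) = \<one>"
    and \<alpha>_mod: "\<alpha> mod 9 = 7" and \<beta>_eq: "\<beta> - 1 = 3 ^ n * v" and n: "n \<ge> 1"
begin

lemma A_pow_nat: "\<exists>k'::nat. A [^] (k::int) = A [^] int k'"
  by (rule exI[of _ "nat (k mod 9)"], rule int_pow_cong[OF _ A9]) (simp_all add: cong_def)

lemma B_pow_nat: "\<exists>k'::nat. B [^] (k::int) = B [^] int k'"
  by (rule exI[of _ "nat (k mod 3 ^ (n + 1))"], rule int_pow_cong[OF _ Bn]) (simp_all add: cong_def)

lemma C_pow_nat: "\<exists>k'::nat. C [^] (k::int) = C [^] int k'"
  by (rule exI[of _ "nat (k mod 3)"], rule int_pow_cong[OF _ C3]) (simp_all add: cong_def)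

lemma three_dvd_one_minus_\<alpha>: "3 dvd 1 - \<alpha>"
  using \<alpha>_mod by presburger

text \<open>As \<open>C^3 = 1\<close>, \<open>A_pow_B\<close> leaves only the exponent
  \<open>\<alpha> * geom \<alpha> 3\<close>, which is \<open>7 * 57 = 399\<close>, that is 3, modulo
  9.\<close>

lemma A3_commute:
  fixes m :: int
  assumes "3 dvd m"
  shows "A [^] m \<otimes> A = A \<otimes> A [^] m" "A [^] m \<otimes> B = B \<otimes> A [^] m" "A [^] m \<otimes> C = C \<otimes> A [^] m"
proof -
  obtain l where m: "m = 3 * l" using assms by blast
  have "A [^] (3::int) \<otimes> B = B \<otimes> A [^] (3::int)"
  proof -
    have "geom \<alpha> 3 = 1 + \<alpha> + \<alpha> * \<alpha>" by (simp add: geom_def numeral_3_eq_3)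
    moreover have "[\<alpha> * (1 + \<alpha> + \<alpha> * \<alpha>) = 7 * (1 + 7 + 7 * 7)] (mod 9)"
      using \<alpha>_mod by (intro cong_mult cong_add cong_refl) (simp_all add: cong_def)
    ultimately have "[\<alpha> * geom \<alpha> 3 = 3] (mod 9)" by (simp add: cong_def)
    then have "A [^] (\<alpha> * geom \<alpha> 3) = A [^] (3::int)" by (intro int_pow_cong[OF _ A9]) simp_all
    then show ?thesis using A_pow_B[of 3] C3 by simp
  qed
  then have "(A [^] (3::int)) [^] l \<otimes> B = B \<otimes> (A [^] (3::int)) [^] l"
    by (rule conj_int_pow[rotated 3]) simp_all
  then show B: "A [^] m \<otimes> B = B \<otimes> A [^] m" by (simp add: int_pow_pow m)
  show A: "A [^] m \<otimes> A = A \<otimes> A [^] m" using int_pow_commute[of A m 1] by simp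
  show "A [^] m \<otimes> C = C \<otimes> A [^] m" by (rule commute_gcomm) (simp_all add: A B)
qed

text \<open>\<open>C^(3^n) = 1\<close> as \<open>n \<ge> 1\<close>, and
  \<open>\<beta> * geom \<beta> (3 ^ n)\<close> is congruent to \<open>3 ^ n\<close> modulo
  \<open>3 ^ (n + 1)\<close>.\<close>

lemma B3n_commute:
  fixes m :: int
  assumes "3 ^ n dvd m"
  shows "B [^] m \<otimes> A = A \<otimes> B [^] m" "B [^] m \<otimes> B = B \<otimes> B [^] m" "B [^] m \<otimes> C = C \<otimes> B [^] m"
proof -
  obtain l where m: "m = 3 ^ n * l" using assms by blast
  let ?z = "B [^] (3 ^ n :: int)"
  have "?z \<otimes> A = A \<otimes> ?z"
  proof -
    have 1: "C [^] (- int (3 ^ n)) = \<one>"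
      by (rule int_pow_dvd_trivial[OF _ C3]) (use n in auto)
    have "3 ^ (n + n) dvd geom \<beta> (3 ^ n) - int (3 ^ n)"
      by (rule three_power_dvd_geom_diff) (use \<beta>_eq n in auto)
    moreover have "(3::int) ^ (n + 1) dvd 3 ^ (n + n)" using n by (intro le_imp_power_dvd) simp
    ultimately have "3 ^ (n + 1) dvd geom \<beta> (3 ^ n) - 3 ^ n" using dvd_trans by fastforce
    then have "[geom \<beta> (3 ^ n) = 3 ^ n] (mod 3 ^ (n + 1))" by (simp add: cong_iff_dvd_diff)
    then have "[\<beta> * geom \<beta> (3 ^ n) = \<beta> * 3 ^ n] (mod 3 ^ (n + 1))" by (intro cong_mult cong_refl)
    moreover have "[\<beta> * 3 ^ n = 3 ^ n] (mod 3 ^ (n + 1))"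
    proof -
      have "\<beta> * 3 ^ n - 3 ^ n = 3 ^ n * (3 ^ n * v)" 
      proof -
        have "\<beta> = 1 + 3 ^ n * v" using \<beta>_eq by simp
        then show ?thesis by (simp add: algebra_simps)
      qed
      moreover have "(3::int) ^ (n + 1) dvd 3 ^ n * (3 ^ n * v)"
        using n by (cases n) auto
      ultimately show ?thesis by (simp add: cong_iff_dvd_diff)
    qed
    ultimately have "[\<beta> * geom \<beta> (3 ^ n) = 3 ^ n] (mod 3 ^ (n + 1))" by (rule cong_trans)
    then have "B [^] (\<beta> * geom \<beta> (3 ^ n)) = ?z" by (intro int_pow_cong[OF _ Bn]) simp_all
    then show ?thesis using B_pow_A[of "3 ^ n"] 1 by simp
  qed
  then have "?z [^] l \<otimes> A = A \<otimes> ?z [^] l"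
    by (rule conj_int_pow[rotated 3]) simp_all
  then show A: "B [^] m \<otimes> A = A \<otimes> B [^] m" by (simp add: int_pow_pow m)
  show B: "B [^] m \<otimes> B = B \<otimes> B [^] m" using int_pow_commute[of B m 1] by simp
  show "B [^] m \<otimes> C = C \<otimes> B [^] m" by (rule commute_gcomm) (simp_all add: A B)
qed

definition nf :: "int \<Rightarrow> int \<Rightarrow> int \<Rightarrow> 'a" where
  "nf i j k = A [^] i \<otimes> (B [^] j \<otimes> C [^] k)"

definition Q :: "'a set" where
  "Q = {nf i j k | i j k. True}"

lemma nf_in_Q [simp]: "nf i j k \<in> Q"
  by (auto simp: Q_def)

lemma nf_closed [simp]: "nf i j k \<in> carrier G"
  by (simp add: nf_def)

lemma generators_in_Q: "A [^] (i::int) \<in> Q" "B [^] (i::int) \<in> Q" "C [^] (i::int) \<in> Q"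
  using nf_in_Q[of i 0 0] nf_in_Q[of 0 i 0] nf_in_Q[of 0 0 i] by (simp_all add: nf_def del: nf_in_Q)

lemma C_mult_A: "C \<otimes> A = A \<otimes> (C \<otimes> A [^] (1 - \<alpha>))"
proof -
  have "A \<otimes> (C \<otimes> A [^] (1 - \<alpha>)) = C \<otimes> (A [^] \<alpha> \<otimes> A [^] (1 - \<alpha>))"
    using A_pow_mult_C[of 1] by (simp add: m_assoc[symmetric])
  then show ?thesis by (simp add: int_pow_mult[symmetric])
qed

lemma C_pow_mult_A: "C [^] (k::int) \<otimes> A = A \<otimes> (C [^] k \<otimes> A [^] ((1 - \<alpha>) * k))"
proof -
  have "C [^] k \<otimes> A = A \<otimes> (C \<otimes> A [^] (1 - \<alpha>)) [^] k"
    by (rule conj_int_pow) (simp_all add: C_mult_A)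
  also have "(C \<otimes> A [^] (1 - \<alpha>)) [^] k = C [^] k \<otimes> (A [^] (1 - \<alpha>)) [^] k"
    by (rule int_pow_mult_distrib) (simp_all add: A3_commute(3)[OF three_dvd_one_minus_\<alpha>])
  finally show ?thesis by (simp add: int_pow_pow)
qed

lemma Q_mult_C: "nf i j k \<otimes> C [^] l \<in> Q" for l :: int
proof -
  have "nf i j k \<otimes> C [^] l = nf i j (k + l)" by (simp add: nf_def m_assoc int_pow_mult)
  then show ?thesis by simp
qed

lemma C_pow_mult_B_pow: "\<exists>l::int. C [^] (k::int) \<otimes> B [^] j = B [^] l \<otimes> C [^] k" for j :: int
proof -
  obtain k' where "C [^] k = C [^] int k'" using C_pow_nat by blast
  then show ?thesis using C_pow_B_pow by auto
qed

lemma Q_mult_B: "nf i j k \<otimes> B [^] l \<in> Q" for l :: int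
proof -
  obtain l' :: int where "C [^] k \<otimes> B [^] l = B [^] l' \<otimes> C [^] k" using C_pow_mult_B_pow by blast
  then have "nf i j k \<otimes> B [^] l = nf i (j + l') k"
    by (simp add: nf_def m_assoc int_pow_mult)
  then show ?thesis by simp
qed

text \<open>This is the collection step: \<open>A\<close> passes \<open>C^k\<close>, leaving behind
  \<open>A^?m\<close>, and passes \<open>B^j\<close>, leaving behind \<open>C^(-j)\<close> and a
  changed power of \<open>B\<close>. As 3 divides \<open>?m\<close>, the factor \<open>A^?m\<close>
  commutes with everything and joins the front.\<close>

lemma Q_mult_A: "nf i j k \<otimes> A \<in> Q"
proof -
  let ?m = "(1 - \<alpha>) * k"
  have m: "3 dvd ?m" using three_dvd_one_minus_\<alpha> by simp
  obtain j' where j: "B [^] j = B [^] int j'" using B_pow_nat by blast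
  obtain l :: int where l: "C [^] (- int j') \<otimes> B [^] (\<beta> * geom \<beta> j') = B [^] l \<otimes> C [^] (- int j')"
    using C_pow_mult_B_pow by blast
  have Ck: "C [^] k \<otimes> A [^] ?m = A [^] ?m \<otimes> C [^] k"
    using conj_int_pow[of C "A [^] ?m" C k] A3_commute(3)[OF m] by simp
  have BA: "B [^] int j' \<otimes> A = A \<otimes> (B [^] l \<otimes> C [^] (- int j'))"
    unfolding B_pow_A l ..
  have Cj: "C [^] (- int j') \<otimes> A [^] ?m = A [^] ?m \<otimes> C [^] (- int j')"
    using conj_int_pow[of C "A [^] ?m" C "- int j'"] A3_commute(3)[OF m] by simp
  have Bl: "B [^] l \<otimes> A [^] ?m = A [^] ?m \<otimes> B [^] l"
    using conj_int_pow[of B "A [^] ?m" B l] A3_commute(2)[OF m] by simp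
  have "nf i j k \<otimes> A = A [^] i \<otimes> (B [^] int j' \<otimes> (C [^] k \<otimes> A))"
    by (simp add: nf_def j m_assoc)
  also have "\<dots> = A [^] i \<otimes> ((B [^] int j' \<otimes> A) \<otimes> (C [^] k \<otimes> A [^] ?m))"
    by (simp add: C_pow_mult_A m_assoc)
  also have "\<dots> = A [^] i \<otimes> (A \<otimes> (B [^] l \<otimes> ((C [^] (- int j') \<otimes> A [^] ?m) \<otimes> C [^] k)))"
    unfolding BA Ck by (simp add: m_assoc)
  also have "\<dots> = A [^] i \<otimes> (A \<otimes> ((B [^] l \<otimes> A [^] ?m) \<otimes> (C [^] (- int j') \<otimes> C [^] k)))"
    unfolding Cj by (simp add: m_assoc)
  also have "\<dots> = A [^] i \<otimes> (A [^] (1::int) \<otimes> (A [^] ?m \<otimes> (B [^] l \<otimes> C [^] (- int j' + k))))"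
    unfolding Bl int_pow_mult[OF gcomm_closed[OF A_closed B_closed]] by (simp add: m_assoc)
  also have "\<dots> = nf (i + (1 + ?m)) l (- int j' + k)"
    unfolding nf_def by (simp only: int_pow_add_left A_closed int_pow_closed m_closed B_closed gcomm_closed)
  finally show ?thesis by simp
qed

lemma Q_mult:
  assumes "x \<in> Q" "y \<in> Q"
  shows "x \<otimes> y \<in> Q"
proof -
  obtain i j k where y: "y = nf i j k" using assms(2) by (auto simp: Q_def)
  have [simp]: "x \<in> carrier G" using assms(1) by (auto simp: Q_def)
  obtain i' where i: "A [^] i = A [^] int i'" using A_pow_nat by blast
  have "x \<otimes> A [^] int i' \<in> Q"
  proof (induction i')
    case (Suc i')
    have "x \<otimes> A [^] int (Suc i') = x \<otimes> A [^] int i' \<otimes> A"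
      unfolding int_pow_Suc(1)[OF A_closed] by (simp add: m_assoc)
    moreover obtain p q r where "x \<otimes> A [^] int i' = nf p q r" using Suc by (auto simp: Q_def)
    ultimately show ?case using Q_mult_A by simp
  qed (use assms in simp)
  then have "x \<otimes> A [^] i \<in> Q" unfolding i .
  then have "x \<otimes> A [^] i \<otimes> B [^] j \<in> Q" using Q_mult_B by (auto simp: Q_def)
  then have "x \<otimes> A [^] i \<otimes> B [^] j \<otimes> C [^] k \<in> Q" using Q_mult_C by (auto simp: Q_def)
  then show ?thesis by (simp add: y nf_def m_assoc)
qed

lemma subgroup_Q: "subgroup Q G"
proof (rule subgroupI)
  show "Q \<subseteq> carrier G" by (auto simp: Q_def)
  show "Q \<noteq> {}" using nf_in_Q by blast
  show "inv x \<in> Q" if x: "x \<in> Q" for x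
  proof -
    obtain i j k where "x = nf i j k" using x by (auto simp: Q_def)
    then have "inv x = C [^] (- k) \<otimes> B [^] (- j) \<otimes> A [^] (- i)"
      by (simp add: nf_def inv_mult_group int_pow_neg m_assoc)
    then show ?thesis using Q_mult generators_in_Q by simp
  qed
qed (rule Q_mult)

definition Qbox :: "(nat \<times> nat \<times> nat) set" where
  "Qbox = {..<9} \<times> {..<3 ^ (n + 1)} \<times> {..<3}"

lemma card_Qbox: "card Qbox = 3 ^ (n + 4)" "finite Qbox"
  by (simp_all add: Qbox_def card_cartesian_product power_add)

lemma Q_eq_image: "Q = (\<lambda>(i, j, k). nf (int i) (int j) (int k)) ` Qbox"
proof
  show "Q \<subseteq> (\<lambda>(i, j, k). nf (int i) (int j) (int k)) ` Qbox"
  proof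
    fix x assume "x \<in> Q"
    then obtain i j k where x: "x = nf i j k" by (auto simp: Q_def)
    let ?i = "nat (i mod 9)" and ?j = "nat (j mod 3 ^ (n + 1))" and ?k = "nat (k mod 3)"
    have "A [^] i = A [^] int ?i" by (rule int_pow_cong[OF _ A9]) (simp_all add: cong_def)
    moreover have "B [^] j = B [^] int ?j" by (rule int_pow_cong[OF _ Bn]) (simp_all add: cong_def)
    moreover have "C [^] k = C [^] int ?k" by (rule int_pow_cong[OF _ C3]) (simp_all add: cong_def)
    ultimately have "x = nf (int ?i) (int ?j) (int ?k)" by (simp add: x nf_def)
    moreover have "(?i, ?j, ?k) \<in> Qbox" by (simp add: Qbox_def nat_less_iff)
    ultimately show "x \<in> (\<lambda>(i, j, k). nf (int i) (int j) (int k)) ` Qbox" by force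
  qed
qed auto

end

section \<open>Commutator calculus and the lower central series\<close>

lemma (in group) commsub_subset:
  assumes "subgroup N G" "\<And>x y. x \<in> U \<Longrightarrow> y \<in> V \<Longrightarrow> gcomm G x y \<in> N"
  shows "commsub G U V \<subseteq> N"
  unfolding commsub_def
  by (rule generate_subgroup_incl[OF _ assms(1)]) (use assms(2) in \<open>auto simp: gcomm_def\<close>)

lemma (in group) gcomm_mem_commsub: "x \<in> U \<Longrightarrow> y \<in> V \<Longrightarrow> gcomm G x y \<in> commsub G U V"
  unfolding commsub_def gcomm_def by (rule generate.incl) auto

lemma (in group) gcomm_unique:
  assumes "x \<in> carrier G" "y \<in> carrier G" "z \<in> carrier G" "x \<otimes> y = y \<otimes> (x \<otimes> z)"
  shows "gcomm G x y = z"
  using assms mult_gcomm[of x y] by simp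

definition (in group) center :: "'a set" where
  "center = {z \<in> carrier G. \<forall>y\<in>carrier G. z \<otimes> y = y \<otimes> z}"

lemma (in group) centerD: "z \<in> center \<Longrightarrow> y \<in> carrier G \<Longrightarrow> z \<otimes> y = y \<otimes> z"
  unfolding center_def by blast

lemma (in group) center_normal: "center \<lhd> G"
proof -
  have "subgroup center G"
  proof (rule subgroupI)
    show "inv x \<in> center" if x: "x \<in> center" for x
    proof -
      have [simp]: "x \<in> carrier G" using x by (simp add: center_def)
      note c = centerD[OF x]
      have "inv x \<otimes> y = y \<otimes> inv x" if "y \<in> carrier G" for y
        using conj_int_pow[of x y x "-1"] c[OF that] that by (simp add: int_pow_neg)
      then show ?thesis by (simp add: center_def)
    qed
    show "x \<otimes> y \<in> center" if that': "x \<in> center" "y \<in> center" for x y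
    proof -
      have [simp]: "x \<in> carrier G" "y \<in> carrier G" using that' by (auto simp: center_def)
      have "x \<otimes> y \<otimes> z = z \<otimes> (x \<otimes> y)" if z: "z \<in> carrier G" for z
      proof -
        have "y \<otimes> z = z \<otimes> y" "x \<otimes> z = z \<otimes> x" using centerD that' z by blast+
        then show ?thesis using z by (metis \<open>x \<in> carrier G\<close> \<open>y \<in> carrier G\<close> m_assoc)
      qed
      then show ?thesis by (simp add: center_def)
    qed
  qed (auto simp: center_def)
  moreover have "x \<otimes> h \<otimes> inv x \<in> center" if "x \<in> carrier G" "h \<in> center" for x h
  proof -
    have "h \<in> carrier G" using that by (simp add: center_def)
    then have "x \<otimes> h \<otimes> inv x = h" using that by (simp add: centerD[symmetric] m_assoc)
    then show ?thesis using that by simp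
  qed
  ultimately show ?thesis unfolding normal_inv_iff by blast
qed

lemma (in group) gcomm_mult_left_mem:
  assumes K: "K \<lhd> G" and [simp]: "x \<in> carrier G" "x' \<in> carrier G" "y \<in> carrier G"
    and "gcomm G x y \<in> K" "gcomm G x' y \<in> K"
  shows "gcomm G (x \<otimes> x') y \<in> K"
proof -
  interpret K: normal K G by fact
  have "gcomm G (x \<otimes> x') y = (inv x' \<otimes> gcomm G x y \<otimes> x') \<otimes> gcomm G x' y"
    by (simp add: gcomm_def inv_mult_group m_assoc)
  then show ?thesis using assms K.inv_op_closed1[of x' "gcomm G x y"] by simp
qed

lemma (in group) gcomm_mult_right_mem:
  assumes K: "K \<lhd> G" and [simp]: "x \<in> carrier G" "y' \<in> carrier G" "y \<in> carrier G"
    and "gcomm G x y \<in> K" "gcomm G x y' \<in> K"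
  shows "gcomm G x (y \<otimes> y') \<in> K"
proof -
  interpret K: normal K G by fact
  have "gcomm G y x \<in> K" "gcomm G y' x \<in> K"
    using assms by (simp_all add: inv_gcomm[symmetric, of x] del: inv_gcomm)
  then have "gcomm G (y \<otimes> y') x \<in> K" by (intro gcomm_mult_left_mem[OF K]) simp_all
  then have "inv gcomm G (y \<otimes> y') x \<in> K" by simp
  then show ?thesis by (simp add: inv_gcomm)
qed

lemma (in group) gcomm_pow_mem:
  assumes K: "K \<lhd> G" and [simp]: "x \<in> carrier G" "y \<in> carrier G" and c: "gcomm G x y \<in> K"
  shows "gcomm G (x [^] int k) y \<in> K" "gcomm G x (y [^] int k) \<in> K"
proof -
  interpret K: normal K G by fact
  have triv: "gcomm G \<one> y = \<one>" "gcomm G x \<one> = \<one>" by (simp_all add: gcomm_def)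
  show "gcomm G (x [^] int k) y \<in> K"
  proof (induction k)
    case (Suc k)
    show ?case unfolding int_pow_Suc(1)[OF assms(2)]
      by (rule gcomm_mult_left_mem[OF K]) (use Suc c in simp_all)
  qed (simp add: triv)
  show "gcomm G x (y [^] int k) \<in> K"
  proof (induction k)
    case (Suc k)
    show ?case unfolding int_pow_Suc(1)[OF assms(3)]
      by (rule gcomm_mult_right_mem[OF K]) (use Suc c in simp_all)
  qed (simp add: triv)
qed

locale full_small_macdonald = small_macdonald +
  assumes carrier_Q: "carrier G = Q"
begin

lemma carrier_nat_cases:
  assumes "x \<in> carrier G"
  obtains i j k :: nat where "x = A [^] int i \<otimes> (B [^] int j \<otimes> C [^] int k)"
proof -
  have "x \<in> (\<lambda>(i, j, k). nf (int i) (int j) (int k)) ` Qbox"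
    using assms carrier_Q Q_eq_image by simp
  then show ?thesis using that by (auto simp: nf_def)
qed

text \<open>The elements commuting with \<open>x\<close> modulo \<open>K\<close> are closed under
  products, and every element is a product of non-negative powers of \<open>A\<close>,
  \<open>B\<close> and \<open>C\<close>.\<close>

lemma gcomm_gens_mem:
  assumes K: "K \<lhd> G" and x: "x \<in> carrier G" and y: "y \<in> carrier G"
    and "gcomm G x A \<in> K" "gcomm G x B \<in> K" "gcomm G x C \<in> K"
  shows "gcomm G x y \<in> K"
  using y
proof (rule carrier_nat_cases)
  fix i j k :: nat assume y: "y = A [^] int i \<otimes> (B [^] int j \<otimes> C [^] int k)"
  show ?thesis unfolding y
    by (intro gcomm_mult_right_mem[OF K] gcomm_pow_mem[OF K]) (use assms in simp_all)
qed

lemma centralI: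
  assumes [simp]: "z \<in> carrier G" and "z \<otimes> A = A \<otimes> z" "z \<otimes> B = B \<otimes> z" "z \<otimes> C = C \<otimes> z"
  shows "z \<in> center"
proof -
  have 1: "gcomm G z x = \<one>" if "x \<in> {A, B, C}" for x
    by (rule gcomm_unique) (use that assms in auto)
  have "gcomm G z y = \<one>" if y: "y \<in> carrier G" for y
    using gcomm_gens_mem[OF one_is_normal _ y] 1 by simp
  then have "z \<otimes> y = y \<otimes> z" if "y \<in> carrier G" for y
    using mult_gcomm[of z y] that by simp
  then show ?thesis by (simp add: center_def)
qed

lemma A3_central: "3 dvd m \<Longrightarrow> A [^] (m::int) \<in> center"
  by (rule centralI) (simp_all add: A3_commute)

lemma B3n_central: "3 ^ n dvd m \<Longrightarrow> B [^] (m::int) \<in> center"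
  by (rule centralI) (simp_all add: B3n_commute)

lemma gcomm_C_A: "gcomm G C A = A [^] (1 - \<alpha>)"
  by (rule gcomm_unique) (simp_all add: C_mult_A)

lemma gcomm_C_central:
  assumes "y \<in> carrier G"
  shows "gcomm G C y \<in> center"
proof (rule gcomm_gens_mem[OF center_normal _ assms])
  show "gcomm G C A \<in> center"
    unfolding gcomm_C_A using three_dvd_one_minus_\<alpha> by (rule A3_central)
  have z: "B [^] (\<beta> - 1) \<in> center" using \<beta>_eq by (intro B3n_central) simp
  have "C \<otimes> B = B \<otimes> (B [^] (\<beta> - 1) \<otimes> C)"
    using C_mult_B_pow[of 1] int_pow_mult[of B 1 "\<beta> - 1"] by (simp add: m_assoc)
  also have "B [^] (\<beta> - 1) \<otimes> C = C \<otimes> B [^] (\<beta> - 1)" using z by (rule centerD) simp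
  finally have "gcomm G C B = B [^] (\<beta> - 1)" by (intro gcomm_unique) simp_all
  then show "gcomm G C B \<in> center" using z by simp
  have "gcomm G C C = \<one>" by (rule gcomm_unique) simp_all
  then show "gcomm G C C \<in> center" by (simp add: center_def)
qed simp

text \<open>A subgroup between the derived subgroup and the second centre.\<close>

definition K1 :: "'a set" where "K1 = adjoin center C"

lemma gcomm_K1_central:
  assumes "x \<in> K1" and y [simp]: "y \<in> carrier G"
  shows "gcomm G x y \<in> center"
proof -
  interpret Z: normal center G by (rule center_normal)
  obtain z k where x: "x = z \<otimes> C [^] (k::int)" "z \<in> center" using assms by (auto simp: K1_def adjoin_def)
  have [simp]: "z \<in> carrier G" using x(2) by simp
  have "gcomm G z y = \<one>" by (rule gcomm_unique) (use centerD[OF x(2)] in simp_all)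
  then have 1: "gcomm G z y \<in> center" by simp
  obtain k' where "C [^] k = C [^] int k'" using C_pow_nat by blast
  then have "gcomm G (C [^] k) y \<in> center"
    using gcomm_pow_mem(1)[OF center_normal _ y gcomm_C_central[OF y]] by simp
  then show ?thesis unfolding x(1) by (intro gcomm_mult_left_mem[OF center_normal] 1) simp_all
qed

lemma K1_normal: "K1 \<lhd> G"
proof -
  have sub: "subgroup K1 G" unfolding K1_def by (rule subgroup_adjoin[OF center_normal]) simp
  have Zsub: "center \<subseteq> K1" unfolding K1_def
    by (rule adjoin_incl) (auto simp: center_def)
  have "x \<otimes> h \<otimes> inv x \<in> K1" if x: "x \<in> carrier G" and h: "h \<in> K1" for x h
  proof -
    have [simp]: "h \<in> carrier G" using sub h by (rule subgroup.mem_carrier)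
    have "x \<otimes> h \<otimes> inv x = h \<otimes> gcomm G h (inv x)"
      using x by (simp add: gcomm_def m_assoc)
    then show ?thesis
      using gcomm_K1_central[OF h, of "inv x"] x h Zsub subgroup.m_closed[OF sub] by auto
  qed
  then show ?thesis unfolding normal_inv_iff using sub by blast
qed

lemma gcomm_mem_K1:
  assumes x: "x \<in> carrier G" and y: "y \<in> carrier G"
  shows "gcomm G x y \<in> K1"
proof -
  interpret K: normal K1 G by (rule K1_normal)
  have Zsub: "center \<subseteq> K1" unfolding K1_def
    by (rule adjoin_incl) (auto simp: center_def)
  have C: "C \<in> K1" unfolding K1_def by (rule mem_adjoin) (simp_all add: center_def)
  have inv: "gcomm G s t \<in> K1" if "gcomm G t s \<in> K1" "s \<in> carrier G" "t \<in> carrier G" for s t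
    using K.m_inv_closed[OF that(1)] that by (simp add: inv_gcomm)
  have Cs: "gcomm G C y \<in> K1" if "y \<in> carrier G" for y using gcomm_C_central[OF that] Zsub by blast
  have self: "gcomm G s s \<in> K1" if "s \<in> carrier G" for s
  proof -
    have "gcomm G s s = \<one>" by (rule gcomm_unique) (use that in simp_all)
    then show ?thesis by simp
  qed
  have A: "gcomm G A y \<in> K1" if "y \<in> carrier G" for y
    by (rule gcomm_gens_mem[OF K1_normal _ that]) (use C self inv[OF Cs] in auto)
  have B: "gcomm G B y \<in> K1" if "y \<in> carrier G" for y
    by (rule gcomm_gens_mem[OF K1_normal _ that]) (use self inv[OF Cs] inv[OF A] in auto)
  show ?thesis
    by (rule inv, rule gcomm_gens_mem[OF K1_normal y x]) (use x y inv[OF A] inv[OF B] inv[OF Cs] in auto)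
qed

text \<open>The central series through \<open>K1\<close> and \<open>center\<close> bounds the class
  by 3. The bound is attained because \<open>A^(1 - \<alpha>)\<close> is the commutator of
  \<open>C\<close> and \<open>A\<close>, a double commutator in \<open>lcs G 2\<close>.\<close>

theorem nilpotency_class_three:
  assumes "A [^] (1 - \<alpha>) \<noteq> \<one>"
  shows "nilpotency_class_is G 3"
proof -
  interpret Z: normal center G by (rule center_normal)
  interpret K: normal K1 G by (rule K1_normal)
  have 1: "lcs G 1 \<subseteq> K1"
    using commsub_subset[OF K.subgroup_axioms gcomm_mem_K1] by simp
  have "commsub G (lcs G 1) (carrier G) \<subseteq> center"
    by (rule commsub_subset[OF Z.subgroup_axioms]) (use 1 gcomm_K1_central in blast)
  then have 2: "lcs G 2 \<subseteq> center" by (simp add: numeral_2_eq_2)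
  have "commsub G (lcs G 2) (carrier G) \<subseteq> {\<one>}"
  proof (rule commsub_subset)
    show "subgroup {\<one>} G" by (rule triv_subgroup)
    fix x y assume x: "x \<in> lcs G 2" and y: "y \<in> carrier G"
    have "x \<in> center" using x 2 by blast
    then show "gcomm G x y \<in> {\<one>}"
      using gcomm_unique[of x y \<one>] centerD[of x y] y by simp
  qed
  moreover have "\<one> \<in> commsub G (lcs G 2) (carrier G)" unfolding commsub_def by (rule generate.one)
  ultimately have 3: "lcs G 3 = {\<one>}" by (auto simp: numeral_3_eq_3 numeral_2_eq_2)
  have C1: "C \<in> lcs G 1" using gcomm_mem_commsub[of A "carrier G" B "carrier G"] by simp
  have A2: "A [^] (1 - \<alpha>) \<in> lcs G 2"
    using gcomm_mem_commsub[OF C1, of A "carrier G"] by (simp add: gcomm_C_A numeral_2_eq_2)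
  have "C \<noteq> \<one>"
  proof
    assume "C = \<one>"
    then have "gcomm G C A = \<one>" by (simp add: gcomm_def)
    then show False using assms gcomm_C_A by simp
  qed
  then have "lcs G 1 \<noteq> {\<one>}" using C1 by blast
  moreover have "lcs G 2 \<noteq> {\<one>}" using A2 assms by blast
  moreover have "lcs G 0 \<noteq> {\<one>}"
  proof -
    have "A [^] (1 - \<alpha>) \<in> lcs G 0" by simp
    then show ?thesis using assms by blast
  qed
  moreover have "i = 0 \<or> i = 1 \<or> i = 2" if "i < 3" for i :: nat using that by linarith
  ultimately have "lcs G i \<noteq> {\<one>}" if "i < 3" for i using that by blast
  then show ?thesis using 3 by (simp add: nilpotency_class_is_def)
qed

end

section \<open>The presented group and its action on triples\<close>

lemma linv_linv [simp]: "linv (linv x) = x"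
  by (simp add: linv_def)

lemma winv_Nil [simp]: "winv [] = []"
  by (simp add: winv_def)

lemma winv_append [simp]: "winv (u @ v) = winv v @ winv u"
  by (simp add: winv_def)

lemma winv_winv [simp]: "winv (winv u) = u"
  by (induction u) (simp_all add: winv_def rev_map)

lemma weq_append:
  assumes "weq \<alpha> \<beta> u u'" "weq \<alpha> \<beta> v v'"
  shows "weq \<alpha> \<beta> (u @ v) (u' @ v')"
proof (rule weq.trans)
  show "weq \<alpha> \<beta> (u @ v) (u' @ v)" using weq.ctxt[OF assms(1), of "[]" v] by simp
  show "weq \<alpha> \<beta> (u' @ v) (u' @ v')" using weq.ctxt[OF assms(2), of u' "[]"] by simp
qed

lemma weq_append_winv: "weq \<alpha> \<beta> (u @ winv u) []"
proof (induction u)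
  case (Cons x u)
  have "weq \<alpha> \<beta> ([x] @ (u @ winv u) @ [linv x]) ([x] @ [] @ [linv x])"
    using Cons by (rule weq.ctxt)
  then have "weq \<alpha> \<beta> ((x # u) @ winv (x # u)) [x, linv x]" by (simp add: winv_def)
  then show ?case using weq.cancel by (rule weq.trans)
qed (simp add: weq.refl)

lemma wclass_eq_iff: "wclass \<alpha> \<beta> u = wclass \<alpha> \<beta> v \<longleftrightarrow> weq \<alpha> \<beta> u v"
  unfolding wclass_def using weq.refl weq.sym weq.trans by blast

lemma wmult_wclass: "wmult \<alpha> \<beta> (wclass \<alpha> \<beta> u) (wclass \<alpha> \<beta> v) = wclass \<alpha> \<beta> (u @ v)"
proof
  show "wmult \<alpha> \<beta> (wclass \<alpha> \<beta> u) (wclass \<alpha> \<beta> v) \<subseteq> wclass \<alpha> \<beta> (u @ v)"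
    unfolding wmult_def wclass_def using weq_append weq.trans by blast
  show "wclass \<alpha> \<beta> (u @ v) \<subseteq> wmult \<alpha> \<beta> (wclass \<alpha> \<beta> u) (wclass \<alpha> \<beta> v)"
    unfolding wmult_def wclass_def using weq.refl by blast
qed

lemma carrier_presG: "carrier (presG \<alpha> \<beta>) = range (wclass \<alpha> \<beta>)"
  by (simp add: presG_def)

lemma wclass_closed [simp]: "wclass \<alpha> \<beta> u \<in> carrier (presG \<alpha> \<beta>)"
  unfolding carrier_presG by (rule rangeI)

lemma presG_simps:
  "wclass \<alpha> \<beta> u \<otimes>\<^bsub>presG \<alpha> \<beta>\<^esub> wclass \<alpha> \<beta> v = wclass \<alpha> \<beta> (u @ v)"
  "\<one>\<^bsub>presG \<alpha> \<beta>\<^esub> = wclass \<alpha> \<beta> []"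
  by (simp_all add: presG_def wmult_wclass)

lemma group_presG: "group (presG \<alpha> \<beta>)"
proof (rule groupI)
  fix x assume "x \<in> carrier (presG \<alpha> \<beta>)"
  then obtain u where u: "x = wclass \<alpha> \<beta> u" by (auto simp: carrier_presG)
  have "wclass \<alpha> \<beta> (winv u @ u) = wclass \<alpha> \<beta> []"
    using weq_append_winv[of \<alpha> \<beta> "winv u"] by (simp add: wclass_eq_iff)
  then show "\<exists>y\<in>carrier (presG \<alpha> \<beta>). y \<otimes>\<^bsub>presG \<alpha> \<beta>\<^esub> x = \<one>\<^bsub>presG \<alpha> \<beta>\<^esub>"
    unfolding u by (intro bexI[of _ "wclass \<alpha> \<beta> (winv u)"]) (simp_all add: presG_simps)
qed (auto simp: carrier_presG presG_simps)

lemma inv_wclass: "inv\<^bsub>presG \<alpha> \<beta>\<^esub> wclass \<alpha> \<beta> u = wclass \<alpha> \<beta> (winv u)"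
proof -
  interpret group "presG \<alpha> \<beta>" by (rule group_presG)
  show ?thesis
    using weq_append_winv[of \<alpha> \<beta> "winv u"]
    by (intro inv_equality) (simp_all add: presG_simps wclass_eq_iff)
qed

lemma wclass_nat_pow: "wclass \<alpha> \<beta> u [^]\<^bsub>presG \<alpha> \<beta>\<^esub> (k::nat) = wclass \<alpha> \<beta> (concat (replicate k u))"
proof (induction k)
  case (Suc k)
  have "concat (replicate (Suc k) u) = concat (replicate k u) @ u"
    by (simp add: replicate_append_same[symmetric] del: replicate_append_same)
  then show ?case using Suc by (simp add: presG_simps)
qed (simp add: presG_simps)

lemma wclass_int_pow: "wclass \<alpha> \<beta> u [^]\<^bsub>presG \<alpha> \<beta>\<^esub> (k::int) = wclass \<alpha> \<beta> (wpow u k)"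
proof -
  interpret group "presG \<alpha> \<beta>" by (rule group_presG)
  show ?thesis
  proof (cases "k \<ge> 0")
    case True
    then have "wclass \<alpha> \<beta> u [^]\<^bsub>presG \<alpha> \<beta>\<^esub> k = wclass \<alpha> \<beta> u [^]\<^bsub>presG \<alpha> \<beta>\<^esub> nat k"
      by (metis int_pow_int nat_0_le)
    then show ?thesis using True by (simp add: wclass_nat_pow wpow_def)
  next
    case False
    then have k: "wclass \<alpha> \<beta> u [^]\<^bsub>presG \<alpha> \<beta>\<^esub> k = (inv\<^bsub>presG \<alpha> \<beta>\<^esub> wclass \<alpha> \<beta> u) [^]\<^bsub>presG \<alpha> \<beta>\<^esub> int (nat (- k))"
      using int_pow_inv_eq[OF wclass_closed, where k = "- k"] by simp
    show ?thesis unfolding k int_pow_int inv_wclass wclass_nat_pow using False by (simp add: wpow_def)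
  qed
qed

lemma gcomm_wclass: "gcomm (presG \<alpha> \<beta>) (wclass \<alpha> \<beta> u) (wclass \<alpha> \<beta> v) = wclass \<alpha> \<beta> (winv u @ winv v @ u @ v)"
  by (simp add: gcomm_def inv_wclass presG_simps)

lemma macdonald_presG: "macdonald (presG \<alpha> \<beta>) (wclass \<alpha> \<beta> wA) (wclass \<alpha> \<beta> wB) \<alpha> \<beta>"
proof -
  interpret group "presG \<alpha> \<beta>" by (rule group_presG)
  have C: "gcomm (presG \<alpha> \<beta>) (wclass \<alpha> \<beta> wA) (wclass \<alpha> \<beta> wB) = wclass \<alpha> \<beta> wC"
    by (simp add: gcomm_wclass wC_def)
  show ?thesis
    by unfold_locales
       (simp_all add: C inv_wclass wclass_int_pow presG_simps wclass_eq_iff weq.rel1[simplified] weq.rel2[simplified])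
qed

lemma presG_generated: "carrier (presG \<alpha> \<beta>) = generate (presG \<alpha> \<beta>) {wclass \<alpha> \<beta> wA, wclass \<alpha> \<beta> wB}"
proof
  interpret group "presG \<alpha> \<beta>" by (rule group_presG)
  let ?S = "{wclass \<alpha> \<beta> wA, wclass \<alpha> \<beta> wB}"
  show "generate (presG \<alpha> \<beta>) ?S \<subseteq> carrier (presG \<alpha> \<beta>)"
    by (rule generate_incl) simp
  have letter: "wclass \<alpha> \<beta> [x] \<in> generate (presG \<alpha> \<beta>) ?S" for x
  proof -
    obtain g e where x: "x = (g, e)" by force
    have w: "wclass \<alpha> \<beta> [(g, False)] \<in> ?S" by (cases g) (simp_all add: wA_def wB_def)
    show ?thesis
    proof (cases e)
      case True
      have "wclass \<alpha> \<beta> [x] = inv\<^bsub>presG \<alpha> \<beta>\<^esub> wclass \<alpha> \<beta> [(g, False)]"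
        using True x by (simp add: inv_wclass winv_def linv_def)
      then show ?thesis using generate.inv[OF w] by simp
    next
      case False
      then show ?thesis using generate.incl[OF w] x by simp
    qed
  qed
  have "wclass \<alpha> \<beta> w \<in> generate (presG \<alpha> \<beta>) ?S" for w
  proof (induction w)
    case Nil
    show ?case using generate.one[of "presG \<alpha> \<beta>" ?S] by (simp add: presG_simps)
  next
    case (Cons x w)
    show ?case using generate.eng[OF letter[of x] Cons] by (simp add: presG_simps)
  qed
  then show "carrier (presG \<alpha> \<beta>) \<subseteq> generate (presG \<alpha> \<beta>) ?S" by (auto simp: carrier_presG)
qed

section \<open>The model on triples of exponents\<close>

type_synonym triple = "int \<times> int \<times> int"

text \<open>Right multiplication by the letters on the normal forms \<open>A\<^sup>iB\<^sup>jC\<^sup>k\<close> of the group of order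
  \<open>3\<^bsup>n+4\<^esup>\<close>, with exponents read modulo \<open>9\<close>, \<open>3\<^bsup>n+1\<^esup>\<close> and \<open>3\<close>. Here \<open>\<xi> = \<beta> - 1\<close>, and
  \<open>j - j\<^sup>2\<close> stands for the binomial coefficient \<open>j(j-1)/2\<close>, to which it is congruent modulo \<open>3\<close>.\<close>
fun step :: "int \<Rightarrow> letter \<Rightarrow> triple \<Rightarrow> triple" where
  "step \<xi> (False, False) (i, j, k) = (i + 1 + 3 * k, j - \<xi> * (j - j * j), k - j)"
| "step \<xi> (False, True) (i, j, k) = (i - 1 - 3 * (k + j), j + \<xi> * (j - j * j), k + j)"
| "step \<xi> (True, False) (i, j, k) = (i, j + 1 + \<xi> * k, k)"
| "step \<xi> (True, True) (i, j, k) = (i, j - 1 - \<xi> * k, k)"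

fun act :: "int \<Rightarrow> letter list \<Rightarrow> triple \<Rightarrow> triple" where
  "act \<xi> [] p = p"
| "act \<xi> (x # w) p = act \<xi> w (step \<xi> x p)"

lemma act_append: "act \<xi> (u @ v) p = act \<xi> v (act \<xi> u p)"
  by (induction u arbitrary: p) simp_all

locale model =
  fixes n :: nat and v \<xi> :: int
  assumes n: "n \<ge> 1" and \<xi>: "\<xi> = 3 ^ n * v"
begin

definition m :: int where "m = 3 ^ (n + 1)"

text \<open>Integer triples with a congruence, in place of residue classes, turn each verification
  into a polynomial identity with an explicit multiple of the modulus.\<close>

definition teq :: "triple \<Rightarrow> triple \<Rightarrow> bool" where
  "teq p q \<longleftrightarrow> [fst p = fst q] (mod 9) \<and> [fst (snd p) = fst (snd q)] (mod m) \<and> [snd (snd p) = snd (snd q)] (mod 3)"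

lemma teq_iff: "teq (i, j, k) (i', j', k') \<longleftrightarrow> [i = i'] (mod 9) \<and> [j = j'] (mod m) \<and> [k = k'] (mod 3)"
  by (simp add: teq_def)

lemma teq_refl [simp]: "teq p p"
  by (simp add: teq_def)

lemma teq_sym: "teq p q \<Longrightarrow> teq q p"
  by (auto simp: teq_def cong_sym_eq)

lemma teq_trans: "teq p q \<Longrightarrow> teq q r \<Longrightarrow> teq p r"
  unfolding teq_def using cong_trans by blast

lemma m_dvd_3\<xi>: "m dvd 3 * \<xi> * a"
proof -
  have "3 * \<xi> * a = m * (v * a)" by (simp add: \<xi> m_def)
  then show ?thesis by (metis dvd_triv_left)
qed

lemma m_dvd_\<xi>\<xi>: "m dvd \<xi> * \<xi> * a"
proof -
  have "(3::int) ^ (n + 1) dvd 3 ^ (n + n)" using n by (intro le_imp_power_dvd) simp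
  then have "m dvd 3 ^ n * 3 ^ n" by (simp add: power_add m_def)
  moreover have "\<xi> * \<xi> * a = 3 ^ n * 3 ^ n * (v * v * a)" by (simp add: \<xi>)
  ultimately show ?thesis by (metis dvd_mult2)
qed

text \<open>Modulo \<open>m\<close> both \<open>3 * \<xi>\<close> and \<open>\<xi> * \<xi>\<close>
  vanish, so calculations in the second coordinate are of first order in \<xi>, with coefficients of
  \<xi> modulo 3. The parameters \<open>a\<close> and \<open>b\<close> are the witnesses.\<close>

lemma cong_mI: "x - y = 3 * \<xi> * a + \<xi> * \<xi> * b \<Longrightarrow> [x = y] (mod m)"
  unfolding cong_iff_dvd_diff using m_dvd_3\<xi> m_dvd_\<xi>\<xi> by (metis dvd_add)

lemma three_dvd_\<xi>: "3 dvd \<xi>"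
  using n by (simp add: \<xi>)

lemma cong_3_of_m: "[j = j'] (mod m) \<Longrightarrow> [j = j'] (mod 3)"
  using cong_dvd_modulus[of j j' m 3] by (simp add: m_def)

lemma cong_\<xi>: "[a = b] (mod 3) \<Longrightarrow> [\<xi> * a = \<xi> * b] (mod m)"
proof -
  assume "[a = b] (mod 3)"
  then obtain c where "a - b = 3 * c" by (auto simp: cong_iff_dvd_diff)
  then have "\<xi> * a - \<xi> * b = 3 * \<xi> * c + \<xi> * \<xi> * 0" by (simp add: algebra_simps flip: right_diff_distrib)
  then show ?thesis by (rule cong_mI)
qed

lemma cong_9: "[a = b] (mod 3) \<Longrightarrow> [3 * a = 3 * b] (mod (9::int))"
  by (auto simp: cong_iff_dvd_diff elim!: dvdE) (simp flip: right_diff_distrib)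

lemma step_teq: "teq p q \<Longrightarrow> teq (step \<xi> x p) (step \<xi> x q)"
proof -
  obtain i j k i' j' k' where pq: "p = (i, j, k)" "q = (i', j', k')" by (metis surj_pair)
  assume "teq p q"
  then have c: "[i = i'] (mod 9)" "[j = j'] (mod m)" "[k = k'] (mod 3)" by (simp_all add: pq teq_iff)
  note c3 = cong_3_of_m[OF c(2)]
  have cj: "[\<xi> * (j - j * j) = \<xi> * (j' - j' * j')] (mod m)" by (intro cong_\<xi> cong_diff cong_mult c3)
  have ck: "[\<xi> * k = \<xi> * k'] (mod m)" by (intro cong_\<xi> c)
  have ci: "[3 * k = 3 * k'] (mod 9)" "[3 * (k + j) = 3 * (k' + j')] (mod 9)"
    by (intro cong_9 cong_add c c3)+
  obtain g e where x: "x = (g, e)" by force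
  show ?thesis unfolding pq x
    by (cases g; cases e; simp only: step.simps teq_iff; intro conjI cong_add cong_diff c c3 cj ck ci cong_refl)
qed

lemma act_teq: "teq p q \<Longrightarrow> teq (act \<xi> w p) (act \<xi> w q)"
  by (induction w arbitrary: p q) (simp_all add: step_teq)

text \<open>A perturbation of \<open>j\<close> by a multiple of \<xi> changes
  \<open>\<xi> * (j - j * j)\<close> only by a multiple of \<open>\<xi> * \<xi>\<close>; the
  correction in the inverse letter therefore cancels the one in the letter.\<close>

lemma step_linv: "teq (step \<xi> (linv x) (step \<xi> x p)) p"
proof -
  obtain i j k where p: "p = (i, j, k)" by (metis surj_pair)
  obtain g e where x: "x = (g, e)" by force
  obtain c where c: "\<xi> = 3 * c" using three_dvd_\<xi> by blast
  show ?thesis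
  proof (cases g)
    case True
    then show ?thesis by (cases e) (simp_all add: p x linv_def teq_iff)
  next
    case False
    let ?y = "j - j * j"
    have J: "[j - \<xi> * ?y + \<xi> * ((j - \<xi> * ?y) - (j - \<xi> * ?y) * (j - \<xi> * ?y)) = j] (mod m)"
      by (rule cong_mI[of _ _ 0 "- ?y + 2 * j * ?y - \<xi> * ?y * ?y"]) (simp add: algebra_simps)
    have J': "[j + \<xi> * ?y - \<xi> * ((j + \<xi> * ?y) - (j + \<xi> * ?y) * (j + \<xi> * ?y)) = j] (mod m)"
      by (rule cong_mI[of _ _ 0 "- ?y + 2 * j * ?y + \<xi> * ?y * ?y"]) (simp add: algebra_simps)
    show ?thesis
    proof (cases e)
      case True
      have "[i - 1 - 3 * (k + j) + 1 + 3 * (k + j) = i] (mod 9)" by simp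
      moreover have "[k + j - (j + \<xi> * ?y) = k] (mod 3)"
        using three_dvd_\<xi> by (simp add: cong_iff_dvd_diff)
      ultimately show ?thesis using True False J' by (simp add: p x linv_def teq_iff)
    next
      case e: False
      have "[k - j + (j - \<xi> * ?y) = k] (mod 3)"
        using three_dvd_\<xi> by (simp add: cong_iff_dvd_diff)
      moreover have "[i + 1 + 3 * k - 1 - 3 * (k - j + (j - \<xi> * ?y)) = i] (mod 9)"
      proof -
        have "i + 1 + 3 * k - 1 - 3 * (k - j + (j - \<xi> * ?y)) - i = 9 * (c * ?y)" by (simp add: c algebra_simps)
        then show ?thesis by (simp only: cong_iff_dvd_diff dvd_triv_left)
      qed
      ultimately show ?thesis using e False J by (simp add: p x linv_def teq_iff)
    qed
  qed
qed

definition acteq :: "letter list \<Rightarrow> letter list \<Rightarrow> bool" where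
  "acteq u w \<longleftrightarrow> (\<forall>p. teq (act \<xi> u p) (act \<xi> w p))"

lemma acteq_refl [simp]: "acteq u u"
  by (simp add: acteq_def)

lemma acteq_sym: "acteq u w \<Longrightarrow> acteq w u"
  by (simp add: acteq_def teq_sym)

lemma acteq_trans: "acteq u w \<Longrightarrow> acteq w x \<Longrightarrow> acteq u x"
  unfolding acteq_def using teq_trans by blast

lemma acteq_append: "acteq u u' \<Longrightarrow> acteq w w' \<Longrightarrow> acteq (u @ w) (u' @ w')"
  unfolding acteq_def act_append using act_teq teq_trans by blast

lemma acteq_append_winv: "acteq (u @ winv u) []"
proof (induction u)
  case (Cons x u)
  have "acteq ([x] @ (u @ winv u) @ [linv x]) ([x] @ [] @ [linv x])"
    by (intro acteq_append Cons acteq_refl)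
  moreover have "acteq [x, linv x] []" by (simp add: acteq_def step_linv)
  ultimately show ?case using acteq_trans by (fastforce simp: winv_def)
qed simp

lemma acteq_winv: "acteq u w \<Longrightarrow> acteq (winv u) (winv w)"
proof -
  assume uw: "acteq u w"
  have "acteq (winv u @ (w @ winv w)) (winv u @ [])" by (intro acteq_append acteq_append_winv acteq_refl)
  moreover have "acteq ((winv u @ u) @ winv w) ([] @ winv w)"
    using acteq_append_winv[of "winv u"] by (intro acteq_append acteq_refl) simp
  moreover have "acteq (winv u @ (w @ winv w)) ((winv u @ u) @ winv w)"
    using acteq_append[OF acteq_append[OF acteq_refl acteq_sym[OF uw]] acteq_refl] by simp
  ultimately show ?thesis using acteq_trans acteq_sym by (metis append_Nil append_Nil2)
qed

text \<open>Closed form of \<open>a\<close> successive steps by \<open>A\<close>: the third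
  coordinate drops by \<open>j\<close> each time, so the increments \<open>1 + 3 * k\<close> add up
  to \<open>a + 3 * a * k\<close> minus \<open>3 * j\<close> times the binomial coefficient of
  \<open>a\<close> over 2, written as \<open>a - a * a\<close> modulo 3.\<close>

definition powA :: "int \<Rightarrow> triple \<Rightarrow> triple" where
  "powA a p = (case p of (i, j, k) \<Rightarrow> (i + a + 3 * (a * k) - 3 * (j * (a - a * a)), j - a * (\<xi> * (j - j * j)), k - a * j))"

lemma powA_teq: "teq p q \<Longrightarrow> teq (powA a p) (powA a q)"
proof -
  obtain i j k i' j' k' where pq: "p = (i, j, k)" "q = (i', j', k')" by (metis surj_pair)
  assume "teq p q"
  then have c: "[i = i'] (mod 9)" "[j = j'] (mod m)" "[k = k'] (mod 3)" by (simp_all add: pq teq_iff)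
  note c3 = cong_3_of_m[OF c(2)]
  have "[\<xi> * (j - j * j) = \<xi> * (j' - j' * j')] (mod m)" by (intro cong_\<xi> cong_diff cong_mult c3)
  then show ?thesis unfolding pq powA_def
    by (auto simp: teq_iff intro!: cong_add cong_diff cong_mult cong_9 c c3 cong_refl)
qed

lemma powA_step: "teq (powA a (step \<xi> (False, False) p)) (powA (a + 1) p)"
proof -
  obtain i j k where p: "p = (i, j, k)" by (metis surj_pair)
  obtain c where c: "\<xi> = 3 * c" using three_dvd_\<xi> by blast
  let ?y = "j - j * j"
  have "[i + 1 + 3 * k + a + 3 * (a * (k - j)) - 3 * ((j - \<xi> * ?y) * (a - a * a))
      = i + (a + 1) + 3 * ((a + 1) * k) - 3 * (j * ((a + 1) - (a + 1) * (a + 1)))] (mod 9)"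
  proof -
    have "(i + 1 + 3 * k + a + 3 * (a * (k - j)) - 3 * ((j - \<xi> * ?y) * (a - a * a)))
      - (i + (a + 1) + 3 * ((a + 1) * k) - 3 * (j * ((a + 1) - (a + 1) * (a + 1))))
      = 9 * (c * ?y * (a - a * a) - a * j)" by (simp add: c algebra_simps)
    then show ?thesis by (simp only: cong_iff_dvd_diff dvd_triv_left)
  qed
  moreover have "[j - \<xi> * ?y - a * (\<xi> * ((j - \<xi> * ?y) - (j - \<xi> * ?y) * (j - \<xi> * ?y))) = j - (a + 1) * (\<xi> * ?y)] (mod m)"
    by (rule cong_mI[of _ _ 0 "a * ?y - 2 * a * j * ?y + a * \<xi> * ?y * ?y"]) (simp add: algebra_simps)
  moreover have "[k - j - a * (j - \<xi> * ?y) = k - (a + 1) * j] (mod 3)"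
  proof -
    have "(k - j - a * (j - \<xi> * ?y)) - (k - (a + 1) * j) = 3 * (a * c * ?y)" by (simp add: c algebra_simps)
    then show ?thesis by (simp only: cong_iff_dvd_diff dvd_triv_left)
  qed
  ultimately show ?thesis by (simp add: p powA_def teq_iff)
qed

lemma powA_step_inv: "teq (powA a (step \<xi> (False, True) p)) (powA (a - 1) p)"
proof -
  let ?q = "step \<xi> (False, True) p"
  have "teq (step \<xi> (False, False) ?q) p" using step_linv[of "(False, True)" p] by (simp add: linv_def)
  then have "teq (powA (a - 1) (step \<xi> (False, False) ?q)) (powA (a - 1) p)" by (rule powA_teq)
  moreover have "teq (powA (a - 1) (step \<xi> (False, False) ?q)) (powA a ?q)"
    using powA_step[of "a - 1" ?q] by simp
  ultimately show ?thesis using teq_sym teq_trans by blast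
qed

lemma act_wpow_A: "teq (act \<xi> (wpow wA a) p) (powA a p)"
proof -
  have 0: "powA 0 p = p" for p by (cases p) (simp add: powA_def)
  have pos: "teq (act \<xi> (concat (replicate l wA)) p) (powA (int l) p)" for l p
  proof (induction l arbitrary: p)
    case (Suc l)
    have "teq (act \<xi> (concat (replicate (Suc l) wA)) p) (powA (int l) (step \<xi> (False, False) p))"
      using Suc by (simp add: wA_def)
    then show ?case using powA_step[of "int l" p] teq_trans by (fastforce simp: add.commute)
  qed (simp add: 0)
  have neg: "teq (act \<xi> (concat (replicate l (winv wA))) p) (powA (- int l) p)" for l p
  proof (induction l arbitrary: p)
    case (Suc l)
    have "teq (act \<xi> (concat (replicate (Suc l) (winv wA))) p) (powA (- int l) (step \<xi> (False, True) p))"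
      using Suc by (simp add: wA_def winv_def linv_def)
    moreover have "- int l - 1 = - int (Suc l)" by simp
    ultimately show ?case using powA_step_inv[of "- int l" p] teq_trans by metis
  qed (simp add: 0)
  show ?thesis
    using pos[of "nat a" p] neg[of "nat (- a)" p] by (cases "a \<ge> 0") (simp_all add: wpow_def)
qed

definition powB :: "int \<Rightarrow> triple \<Rightarrow> triple" where
  "powB b p = (case p of (i, j, k) \<Rightarrow> (i, j + b + b * (\<xi> * k), k))"

lemma act_wpow_B: "act \<xi> (wpow wB b) p = powB b p"
proof -
  have pos: "act \<xi> (concat (replicate l wB)) p = powB (int l) p" for l p
    by (induction l arbitrary: p) (auto simp: wB_def powB_def algebra_simps)
  have neg: "act \<xi> (concat (replicate l (winv wB))) p = powB (- int l) p" for l p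
    by (induction l arbitrary: p) (auto simp: wB_def winv_def linv_def powB_def algebra_simps)
  show ?thesis
    using pos[of "nat b" p] neg[of "nat (- b)" p] by (cases "b \<ge> 0") (simp_all add: wpow_def)
qed

text \<open>This justifies reading the third coordinate as the exponent of \<open>C\<close>, which
  \<open>step\<close>, defined on single letters, does not mention.\<close>

lemma act_wC: "teq (act \<xi> wC (i, j, k)) (i, j, k + 1)"
proof -
  obtain c where c: "\<xi> = 3 * c" using three_dvd_\<xi> by blast
  define j2 where "j2 = j + \<xi> * (j - j * j) - 1 - \<xi> * (k + j)"
  have "act \<xi> wC (i, j, k) = (i - 1 - 3 * (k + j) + 1 + 3 * (k + j),
      j2 - \<xi> * (j2 - j2 * j2) + 1 + \<xi> * (k + j - j2), k + j - j2)"
    by (simp add: wC_def wA_def wB_def winv_def linv_def j2_def)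
  moreover have "[k + j - j2 = k + 1] (mod 3)"
  proof -
    have "k + j - j2 - (k + 1) = 3 * (c * (k + j) - c * (j - j * j))" by (simp add: j2_def c algebra_simps)
    then show ?thesis by (simp only: cong_iff_dvd_diff dvd_triv_left)
  qed
  moreover have "[j2 - \<xi> * (j2 - j2 * j2) + 1 + \<xi> * (k + j - j2) = j] (mod m)"
  proof -
    have "[j2 = j - 1] (mod 3)"
    proof -
      have "j2 - (j - 1) = 3 * (c * (j - j * j) - c * (k + j))" by (simp add: j2_def c algebra_simps)
      then show ?thesis by (simp only: cong_iff_dvd_diff dvd_triv_left)
    qed
    then have "[\<xi> * (j2 - j2 * j2) = \<xi> * ((j - 1) - (j - 1) * (j - 1))] (mod m)"
      "[\<xi> * (k + j - j2) = \<xi> * (k + j - (j - 1))] (mod m)"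
      by (intro cong_\<xi> cong_diff cong_mult cong_refl; assumption)+
    then have e1: "[j2 - \<xi> * (j2 - j2 * j2) + 1 + \<xi> * (k + j - j2)
        = j2 - \<xi> * ((j - 1) - (j - 1) * (j - 1)) + 1 + \<xi> * (k + j - (j - 1))] (mod m)"
      by (intro cong_add cong_diff cong_refl)
    have "[j2 - \<xi> * ((j - 1) - (j - 1) * (j - 1)) + 1 + \<xi> * (k + j - (j - 1)) = j] (mod m)"
      by (rule cong_mI[of _ _ "1 - j" 0]) (simp add: j2_def algebra_simps)
    with e1 show ?thesis by (rule cong_trans)
  qed
  ultimately show ?thesis by (simp add: teq_iff)
qed

lemma act_winv_wC: "teq (act \<xi> (winv wC) (i, j, k)) (i, j, k - 1)"
proof -
  have "teq (act \<xi> (winv wC) (act \<xi> wC (i, j, k - 1))) (i, j, k - 1)"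
    using acteq_append_winv[of wC] by (simp add: acteq_def act_append)
  moreover have "teq (act \<xi> (winv wC) (act \<xi> wC (i, j, k - 1))) (act \<xi> (winv wC) (i, j, k))"
    using act_wC[of i j "k - 1"] by (intro act_teq) simp
  ultimately show ?thesis using teq_sym teq_trans by blast
qed

lemma act_concat_wC: "teq (act \<xi> (concat (replicate l wC)) (i, j, k)) (i, j, k + int l)"
proof (induction l arbitrary: k)
  case (Suc l)
  have "teq (act \<xi> (concat (replicate l wC)) (act \<xi> wC (i, j, k))) (act \<xi> (concat (replicate l wC)) (i, j, k + 1))"
    by (intro act_teq act_wC)
  then show ?case using Suc[of "k + 1"] teq_trans by (fastforce simp: act_append add_ac)
qed simp

lemma weq_imp_acteq:
  assumes \<alpha>: "\<alpha> mod 9 = 7" and \<beta>: "\<beta> = 1 + \<xi>" and "weq \<alpha> \<beta> u w"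
  shows "acteq u w"
  using assms(3)
proof induction
  case rel1
  show ?case unfolding acteq_def
  proof
    fix p :: triple
    obtain i j k where p: "p = (i, j, k)" by (metis surj_pair)
    let ?q = "(i + 1 + 3 * (k - 1), j - \<xi> * (j - j * j), k - 1 - j)"
    have qA: "act \<xi> wA (i, j, k - 1) = ?q" by (simp add: wA_def)
    have "teq (act \<xi> wC (act \<xi> wA (act \<xi> (winv wC) p))) (act \<xi> wC (act \<xi> wA (i, j, k - 1)))"
      unfolding p by (intro act_teq act_winv_wC)
    then have "teq (act \<xi> wC (act \<xi> wA (act \<xi> (winv wC) p))) (i + 1 + 3 * (k - 1), j - \<xi> * (j - j * j), k - 1 - j + 1)"
      unfolding qA using act_wC by (rule teq_trans)
    then have "teq (act \<xi> (winv wC @ wA @ wC) p) (i + 1 + 3 * (k - 1), j - \<xi> * (j - j * j), k - 1 - j + 1)"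
      unfolding act_append .
    then have "teq (act \<xi> (winv wC @ wA @ wC) p) (i - 2 + 3 * k, j - \<xi> * (j - j * j), k - j)"
      by (simp add: algebra_simps)
    moreover have "teq (i - 2 + 3 * k, j - \<xi> * (j - j * j), k - j) (powA \<alpha> p)"
    proof -
      \<comment> \<open>The three congruences hold because \<alpha> is -2 modulo 9 and 1 modulo 3,
        so that \<open>\<alpha> - \<alpha> * \<alpha>\<close> is 0 modulo 3.\<close>
      obtain q where q: "\<alpha> = 7 + 9 * q" using \<alpha> by (metis mod_mult_div_eq add.commute)
      have "[i - 2 + 3 * k = i + \<alpha> + 3 * (\<alpha> * k) - 3 * (j * (\<alpha> - \<alpha> * \<alpha>))] (mod 9)"
      proof -
        have "i - 2 + 3 * k - (i + \<alpha> + 3 * (\<alpha> * k) - 3 * (j * (\<alpha> - \<alpha> * \<alpha>)))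
          = 9 * (- 1 - q - 2 * k - 3 * q * k + j * (- 14 - 39 * q - 27 * q * q))"
          by (simp add: q algebra_simps)
        then show ?thesis by (simp only: cong_iff_dvd_diff dvd_triv_left)
      qed
      moreover have "[j - \<xi> * (j - j * j) = j - \<alpha> * (\<xi> * (j - j * j))] (mod m)"
        by (rule cong_mI[of _ _ "(2 + 3 * q) * (j - j * j)" 0]) (simp add: q algebra_simps)
      moreover have "[k - j = k - \<alpha> * j] (mod 3)"
      proof -
        have "k - j - (k - \<alpha> * j) = 3 * ((2 + 3 * q) * j)" by (simp add: q algebra_simps)
        then show ?thesis by (simp only: cong_iff_dvd_diff dvd_triv_left)
      qed
      ultimately show ?thesis by (simp add: p powA_def teq_iff)
    qed
    moreover have "teq (powA \<alpha> p) (act \<xi> (wpow wA \<alpha>) p)" by (rule teq_sym[OF act_wpow_A])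
    ultimately show "teq (act \<xi> (winv wC @ wA @ wC) p) (act \<xi> (wpow wA \<alpha>) p)" using teq_trans by blast
  qed
next
  case rel2
  show ?case unfolding acteq_def
  proof
    fix p :: triple
    obtain i j k where p: "p = (i, j, k)" by (metis surj_pair)
    let ?q = "(i, j + 1 + \<xi> * (k + 1), k + 1)"
    have "teq (act \<xi> (winv wC) (act \<xi> wB (act \<xi> wC p))) (act \<xi> (winv wC) (act \<xi> wB (i, j, k + 1)))"
      unfolding p by (intro act_teq act_wC)
    moreover have "act \<xi> wB (i, j, k + 1) = ?q" by (simp add: wB_def)
    moreover have "teq (act \<xi> (winv wC) ?q) (i, j + 1 + \<xi> * (k + 1), k + 1 - 1)" by (rule act_winv_wC)
    ultimately have "teq (act \<xi> (wC @ wB @ winv wC) p) (i, j + 1 + \<xi> * (k + 1), k)"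
      using teq_trans by (simp add: act_append)
    moreover have "teq (i, j + 1 + \<xi> * (k + 1), k) (powB \<beta> p)"
    proof -
      have "[j + 1 + \<xi> * (k + 1) = j + \<beta> + \<beta> * (\<xi> * k)] (mod m)"
        by (rule cong_mI[of _ _ 0 "- k"]) (simp add: \<beta> algebra_simps)
      then show ?thesis by (simp add: p powB_def teq_iff)
    qed
    ultimately show "teq (act \<xi> (wC @ wB @ winv wC) p) (act \<xi> (wpow wB \<beta>) p)"
      using teq_trans by (simp add: act_wpow_B)
  qed
next
  case (cancel x)
  show ?case using acteq_append_winv[of "[x]"] by (simp add: winv_def)
next
  case (sym u v)
  then show ?case by (rule_tac acteq_sym)
next
  case (trans u v w)
  then show ?case using acteq_trans by blast
next
  case (ctxt u v p q)
  then show ?case by (intro acteq_append) simp_all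
qed simp

text \<open>Applied to the triple of zeros, a normal-form word returns its own exponents.\<close>

lemma acteq_normal_form:
  assumes "acteq (wpow wA i @ wpow wB j @ wpow wC k) (wpow wA i' @ wpow wB j' @ wpow wC k')" "k \<ge> 0" "k' \<ge> 0"
  shows "[i = i'] (mod 9)" "[j = j'] (mod m)" "[k = k'] (mod 3)"
proof -
  have nf: "teq (act \<xi> (wpow wA i @ wpow wB j @ wpow wC k) (0, 0, 0)) (i, j, k)" if "k \<ge> 0" for i j k
  proof -
    have "teq (act \<xi> (wpow wA i) (0, 0, 0)) (i, 0, 0)"
      using act_wpow_A[of i "(0, 0, 0)"] by (simp add: powA_def)
    then have "teq (act \<xi> (wpow wA i @ wpow wB j @ wpow wC k) (0, 0, 0)) (act \<xi> (wpow wB j @ wpow wC k) (i, 0, 0))"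
      unfolding act_append by (intro act_teq)
    moreover have "act \<xi> (wpow wB j @ wpow wC k) (i, 0, 0) = act \<xi> (wpow wC k) (i, j, 0)"
      by (simp add: act_append act_wpow_B powB_def)
    moreover have "teq (act \<xi> (wpow wC k) (i, j, 0)) (i, j, k)"
      using act_concat_wC[of "nat k" i j 0] that by (simp add: wpow_def)
    ultimately show ?thesis using teq_trans by simp
  qed
  have "teq (i, j, k) (i', j', k')"
    using assms(1) nf[OF assms(2), of i j] nf[OF assms(3), of i' j'] teq_trans teq_sym unfolding acteq_def by blast
  then show "[i = i'] (mod 9)" "[j = j'] (mod m)" "[k = k'] (mod 3)" by (simp_all add: teq_iff)
qed

lemma acteq_wpow: "acteq u w \<Longrightarrow> acteq (wpow u k) (wpow w k)"
proof -
  have "acteq (concat (replicate l u)) (concat (replicate l w))" if "acteq u w" for u w l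
    using that by (induction l) (simp_all add: acteq_append)
  moreover assume "acteq u w"
  ultimately show ?thesis using acteq_winv by (simp add: wpow_def)
qed

lemma acteq_wpow_gens:
  assumes "[e = 1] (mod 9)" "[e = 1] (mod m)"
  shows "acteq (wpow wA e) wA" "acteq (wpow wB e) wB"
proof -
  have e3: "[e = 1] (mod 3)" using assms(2) by (rule cong_3_of_m)
  have "teq (powA e p) (step \<xi> (False, False) p)" for p
  proof -
    obtain i j k where p: "p = (i, j, k)" by (metis surj_pair)
    have "[i + e + 3 * (e * k) - 3 * (j * (e - e * e)) = i + 1 + 3 * (1 * k) - 3 * (j * (1 - 1 * 1))] (mod 9)"
      by (intro cong_add cong_diff cong_mult cong_refl assms)
    moreover have "[j - e * (\<xi> * (j - j * j)) = j - 1 * (\<xi> * (j - j * j))] (mod m)"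
      by (intro cong_diff cong_mult cong_refl assms)
    moreover have "[k - e * j = k - 1 * j] (mod 3)" by (intro cong_diff cong_mult cong_refl e3)
    ultimately show ?thesis by (simp add: p powA_def teq_iff)
  qed
  then have "teq (act \<xi> (wpow wA e) p) (step \<xi> (False, False) p)" for p
    by (rule teq_trans[OF act_wpow_A])
  then show "acteq (wpow wA e) wA" unfolding acteq_def by (simp add: wA_def)
  have "teq (powB e p) (step \<xi> (True, False) p)" for p
  proof -
    obtain i j k where p: "p = (i, j, k)" by (metis surj_pair)
    have "[j + e + e * (\<xi> * k) = j + 1 + 1 * (\<xi> * k)] (mod m)"
      by (intro cong_add cong_mult cong_refl assms)
    then show ?thesis by (simp add: p powB_def teq_iff)
  qed
  then have "teq (act \<xi> (wpow wB e) p) (step \<xi> (True, False) p)" for p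
    unfolding act_wpow_B .
  then show "acteq (wpow wB e) wB" unfolding acteq_def by (simp add: wB_def)
qed

text \<open>\<open>a\<close> and \<open>b\<close> act on the model as \<open>A\<close> and \<open>B\<close> do.\<close>
theorem normal_forms_distinct:
  fixes \<alpha> \<beta> e :: int
  assumes \<alpha>: "\<alpha> mod 9 = 7" and \<beta>: "\<beta> = 1 + \<xi>" and e: "[e = 1] (mod 9)" "[e = 1] (mod m)"
  defines "G \<equiv> presG \<alpha> \<beta>"
  defines "a \<equiv> wclass \<alpha> \<beta> wA [^]\<^bsub>G\<^esub> e" and "b \<equiv> wclass \<alpha> \<beta> wB [^]\<^bsub>G\<^esub> e"
  assumes eq: "a [^]\<^bsub>G\<^esub> (i::int) \<otimes>\<^bsub>G\<^esub> (b [^]\<^bsub>G\<^esub> (j::int) \<otimes>\<^bsub>G\<^esub> gcomm G a b [^]\<^bsub>G\<^esub> (k::int))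
    = a [^]\<^bsub>G\<^esub> (i'::int) \<otimes>\<^bsub>G\<^esub> (b [^]\<^bsub>G\<^esub> (j'::int) \<otimes>\<^bsub>G\<^esub> gcomm G a b [^]\<^bsub>G\<^esub> (k'::int))"
    and k: "k \<ge> 0" "k' \<ge> 0"
  shows "[i = i'] (mod 9)" "[j = j'] (mod m)" "[k = k'] (mod 3)"
proof -
  let ?a = "wpow wA e" and ?b = "wpow wB e"
  let ?c = "winv ?a @ winv ?b @ ?a @ ?b"
  have c: "acteq ?c wC" unfolding wC_def
    by (intro acteq_append acteq_winv acteq_wpow_gens e)
  have nf: "acteq (wpow ?a i @ wpow ?b j @ wpow ?c k) (wpow wA i @ wpow wB j @ wpow wC k)" for i j k
    by (intro acteq_append acteq_wpow acteq_wpow_gens e c)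
  have "weq \<alpha> \<beta> (wpow ?a i @ wpow ?b j @ wpow ?c k) (wpow ?a i' @ wpow ?b j' @ wpow ?c k')"
    using eq unfolding a_def b_def G_def wclass_int_pow gcomm_wclass presG_simps wclass_eq_iff .
  then have "acteq (wpow ?a i @ wpow ?b j @ wpow ?c k) (wpow ?a i' @ wpow ?b j' @ wpow ?c k')"
    by (rule weq_imp_acteq[OF \<alpha> \<beta>])
  then have "acteq (wpow wA i @ wpow wB j @ wpow wC k) (wpow wA i' @ wpow wB j' @ wpow wC k')"
    using nf acteq_sym acteq_trans by meson
  then show "[i = i'] (mod 9)" "[j = j'] (mod m)" "[k = k'] (mod 3)"
    using acteq_normal_form k by blast+
qed

end

section \<open>The Sylow 3-subgroup\<close>

lemma (in group) macdonald_subgroup: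
  assumes H: "subgroup H G" and "macdonald G A B \<alpha> \<beta>" "A \<in> H" "B \<in> H"
  shows "macdonald (G\<lparr>carrier := H\<rparr>) A B \<alpha> \<beta>" "gcomm (G\<lparr>carrier := H\<rparr>) A B = gcomm G A B"
proof -
  interpret m: macdonald G A B \<alpha> \<beta> by fact
  interpret H: subgroup H G by fact
  interpret HG: group "G\<lparr>carrier := H\<rparr>" using H.subgroup_is_group[OF is_group] .
  show C: "gcomm (G\<lparr>carrier := H\<rparr>) A B = gcomm G A B"
    using assms by (simp add: gcomm_def m_inv_consistent)
  have "gcomm G A B \<in> H" using assms by (simp add: gcomm_def)
  then show "macdonald (G\<lparr>carrier := H\<rparr>) A B \<alpha> \<beta>"
    using assms m.rel_A m.rel_B
    by unfold_locales (simp_all add: C m_inv_consistent int_pow_consistent[symmetric])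
qed

text \<open>The \<open>p\<close>-part is recovered from the product as a power: by the Chinese
  remainder theorem there is \<open>r\<close> that is 1 modulo a power of \<open>p\<close> and 0
  modulo the orders of the other factors. One \<open>r\<close> serves two competing factorisations
  at once, so they have the same \<open>p\<close>-part.\<close>

lemma (in group) ppart_unique:
  assumes p: "Factorial_Ring.prime p"
    and x [simp]: "x \<in> carrier G" and y [simp]: "y \<in> carrier G" and xy: "x \<otimes> y = y \<otimes> x"
    and "x [^] int (p ^ k) = \<one>" and M: "y [^] int M = \<one>" "\<not> p dvd M"
  shows "ppart p G (x \<otimes> y) = x"
proof -
  have copM: "coprime p M" using p M(2) by (rule prime_imp_coprime)
  have "ord x dvd p ^ k"
    using assms(5) int_pow_eq_id[OF x, of "int (p ^ k)"] by (simp only: int_dvd_int_iff)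
  then obtain l where ox: "ord x = p ^ l" using p by (meson divides_primepow_nat)
  have "ord y dvd M" using M(1) by (simp add: int_pow_eq_id)
  then have oy: "coprime (ord y) p" using copM by (metis coprime_commute coprime_divisors dvd_refl)
  have recover: "\<exists>r0. [r0 = 1] (mod int (p ^ l1)) \<and> [r0 = 0] (mod int m1)" if "coprime m1 p" for l1 m1 :: nat
  proof -
    have "coprime (int (p ^ l1)) (int m1)" using that by (metis coprime_commute coprime_int_iff coprime_power_left_iff)
    then show ?thesis using binary_chinese_remainder_int by blast
  qed
  have pw: "(s \<otimes> t) [^] r = s"
    if "s \<in> carrier G" "t \<in> carrier G" "s \<otimes> t = t \<otimes> s"
      "[r = 1] (mod int (ord s))" "[r = 0] (mod int (ord t))" for s t and r :: int
  proof -
    have "s [^] r = s [^] (1::int)" using that by (intro int_pow_cong[of s "int (ord s)"]) (simp_all add: int_pow_eq_id)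
    moreover have "t [^] r = t [^] (0::int)" using that by (intro int_pow_cong[of t "int (ord t)"]) (simp_all add: int_pow_eq_id)
    ultimately show ?thesis using that by (simp add: int_pow_mult_distrib)
  qed
  show ?thesis unfolding ppart_def
  proof (rule the_equality)
    show "x \<in> carrier G \<and> (\<exists>k. ord x = p ^ k) \<and>
      (\<exists>y'\<in>carrier G. coprime (ord y') p \<and> x \<otimes> y' = x \<otimes> y \<and> x \<otimes> y' = y' \<otimes> x)"
      using ox oy xy by (intro conjI x exI[of _ l] bexI[of _ y]) simp_all
    fix x' assume "x' \<in> carrier G \<and> (\<exists>k. ord x' = p ^ k) \<and>
      (\<exists>y'\<in>carrier G. coprime (ord y') p \<and> x' \<otimes> y' = x \<otimes> y \<and> x' \<otimes> y' = y' \<otimes> x')"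
    then obtain l' y' where x': "x' \<in> carrier G" "ord x' = p ^ l'"
      and y': "y' \<in> carrier G" "coprime (ord y') p" "x' \<otimes> y' = x \<otimes> y" "x' \<otimes> y' = y' \<otimes> x'" by blast
    have "coprime (ord y * ord y') p" using oy y'(2) by simp
    then obtain r where r: "[r = 1] (mod int (p ^ (l + l')))" "[r = 0] (mod int (ord y * ord y'))"
      using recover by blast
    have d: "int (p ^ l) dvd int (p ^ (l + l'))" "int (p ^ l') dvd int (p ^ (l + l'))"
      "int (ord y) dvd int (ord y * ord y')" "int (ord y') dvd int (ord y * ord y')"
      by (simp_all add: power_add)
    have "(x \<otimes> y) [^] r = x"
      by (rule pw) (use xy ox cong_dvd_modulus[OF r(1) d(1)] cong_dvd_modulus[OF r(2) d(3)] in simp_all)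
    moreover have "(x' \<otimes> y') [^] r = x'"
      by (rule pw) (use x' y' cong_dvd_modulus[OF r(1) d(2)] cong_dvd_modulus[OF r(2) d(4)] in simp_all)
    ultimately show "x' = x" using y'(3) by simp
  qed
qed

text \<open>The \<open>P'\<close>-factor of a \<open>p\<close>-element is killed by a power of
  \<open>p\<close> and by \<open>M\<close>, hence trivial.\<close>

lemma (in group) pelems_eq_factor:
  assumes p: "Factorial_Ring.prime p"
    and Q: "Q \<subseteq> carrier G" "\<And>x. x \<in> Q \<Longrightarrow> x [^] int (p ^ f) = \<one>"
    and P': "P' \<subseteq> carrier G" "\<one> \<in> P'" "\<And>y. y \<in> P' \<Longrightarrow> y [^] int M = \<one>" "\<not> p dvd M"
    and comm: "\<And>x y. x \<in> Q \<Longrightarrow> y \<in> P' \<Longrightarrow> x \<otimes> y = y \<otimes> x"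
    and carrier: "\<And>g. g \<in> carrier G \<Longrightarrow> \<exists>x\<in>Q. \<exists>y\<in>P'. g = x \<otimes> y"
  shows "pelems p G = Q"
proof
  show "Q \<subseteq> pelems p G"
  proof
    fix x assume x: "x \<in> Q"
    then have xG: "x \<in> carrier G" using Q(1) by blast
    have "ord x dvd p ^ f"
      using Q(2)[OF x] int_pow_eq_id[OF xG, of "int (p ^ f)"] by (simp only: int_dvd_int_iff)
    then show "x \<in> pelems p G" unfolding pelems_def using xG p by (auto simp: divides_primepow_nat)
  qed
  show "pelems p G \<subseteq> Q"
  proof
    fix g assume "g \<in> pelems p G"
    then obtain k where g: "g \<in> carrier G" "ord g = p ^ k" by (auto simp: pelems_def)
    obtain x y where xy: "x \<in> Q" "y \<in> P'" "g = x \<otimes> y" using carrier[OF g(1)] by blast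
    have xG [simp]: "x \<in> carrier G" and yG [simp]: "y \<in> carrier G" using xy Q(1) P'(1) by blast+
    let ?N = "int (p ^ f) * int (p ^ k)"
    have gN: "g [^] ?N = \<one>" using g by (simp add: int_pow_eq_id)
    have xN: "x [^] ?N = \<one>" using Q(2)[OF xy(1)] by (simp only: int_pow_pow[symmetric] xG int_pow_one)
    have "g [^] ?N = x [^] ?N \<otimes> y [^] ?N"
      unfolding xy(3) using comm[OF xy(1,2)] by (intro int_pow_mult_distrib) simp_all
    then have yN: "y [^] ?N = \<one>" using gN xN by simp
    have "coprime p M" using p P'(4) by (rule prime_imp_coprime)
    then have "coprime ?N (int M)" by (metis coprime_int_iff coprime_power_left_iff of_nat_mult power_add)
    then have "y = \<one>" using int_pow_coprime_trivial[OF yG yN P'(3)[OF xy(2)]] by blast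
    then show "g \<in> Q" using xy by simp
  qed
qed

lemma (in group) generate_product_decomposition:
  assumes Q: "subgroup Q G" and P': "subgroup P' G"
    and comm: "\<And>x y. x \<in> Q \<Longrightarrow> y \<in> P' \<Longrightarrow> x \<otimes> y = y \<otimes> x"
    and S: "\<And>s. s \<in> S \<Longrightarrow> \<exists>x\<in>Q. \<exists>y\<in>P'. s = x \<otimes> y"
    and g: "g \<in> generate G S"
  shows "\<exists>x\<in>Q. \<exists>y\<in>P'. g = x \<otimes> y"
proof -
  interpret Q: subgroup Q G by fact
  interpret P': subgroup P' G by fact
  show ?thesis using g
  proof induction
    case one
    show ?case by (intro bexI[of _ \<one>]) simp_all
  next
    case (incl s)
    then show ?case by (rule S)
  next
    case (inv s)
    then obtain x y where xy: "x \<in> Q" "y \<in> P'" "s = x \<otimes> y" using S by blast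
    have "inv s = inv x \<otimes> inv y" using xy comm[of "inv x" "inv y"] by (simp add: inv_mult_group)
    then show ?case using xy by blast
  next
    case (eng g h)
    then obtain x y x' y' where xy: "x \<in> Q" "y \<in> P'" "g = x \<otimes> y" "x' \<in> Q" "y' \<in> P'" "h = x' \<otimes> y'" by blast
    have [simp]: "x \<in> carrier G" "y \<in> carrier G" "x' \<in> carrier G" "y' \<in> carrier G" using xy by simp_all
    have "g \<otimes> h = x \<otimes> ((y \<otimes> x') \<otimes> y')" by (simp add: xy m_assoc)
    also have "y \<otimes> x' = x' \<otimes> y" using comm[OF xy(4,2)] by simp
    finally have "g \<otimes> h = (x \<otimes> x') \<otimes> (y \<otimes> y')" by (simp add: m_assoc)
    then show ?case using xy by blast
  qed
qed

text \<open>The congruences exclude the small values of \<alpha> and \<beta> for which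
  \<open>finite_orders\<close> makes no claim. The common exponent is multiplied by
  \<open>3 ^ d\<close> for the benefit of the lower bound.\<close>

lemma (in macdonald) torsion_macdonald_exists:
  assumes gen: "carrier G = generate G {A, B}"
    and "\<alpha> mod 9 = 7" "\<beta> mod 9 = 1" "\<beta> \<noteq> 1"
  obtains L where "torsion_macdonald G A B \<alpha> \<beta> L" "3 ^ d dvd L"
proof -
  have "\<beta> \<ge> 2 \<or> \<beta> \<le> -3" "\<bar>\<alpha>\<bar> \<ge> 2" using assms(2-4) by presburger+
  then obtain m where m: "m > 0" "A [^] int m = \<one>" "B [^] int m = \<one>" "C [^] int m = \<one>"
    using finite_orders by blast
  have C': "gcomm G B A [^] int m = \<one>" using m(4) by (simp add: gcomm_swap int_pow_inv)
  define L where "L = m * 3 ^ d"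
  have pw: "x [^] int L = \<one>" if "x \<in> carrier G" "x [^] int m = \<one>" for x
    using that by (simp add: L_def int_pow_pow[symmetric])
  have "torsion_macdonald G A B \<alpha> \<beta> L"
  proof
    show "int p dvd \<alpha> - 1" if "Factorial_Ring.prime p" "p dvd ord A" for p
      using prime_dvd_ord_A[OF m(1,2,4) that] .
    show "int p dvd \<beta> - 1" if "Factorial_Ring.prime p" "p dvd ord B" for p
      using macdonald.prime_dvd_ord_A[OF macdonald_swap m(1,3) C' that] .
    show "A [^] int L = \<one>" "B [^] int L = \<one>" "C [^] int L = \<one>" using m by (simp_all add: pw)
  qed (use gen m in \<open>simp_all add: L_def\<close>)
  then show ?thesis using that by (simp add: L_def)
qed

lemma (in group) ord_subgroup:
  assumes H: "subgroup H G" and x: "x \<in> H"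
  shows "group.ord (G\<lparr>carrier := H\<rparr>) x = ord x"
proof -
  interpret H: subgroup H G by fact
  interpret HG: group "G\<lparr>carrier := H\<rparr>" using H.subgroup_is_group[OF is_group] .
  have "x [^]\<^bsub>G\<lparr>carrier := H\<rparr>\<^esub> (k::nat) = x [^] k" for k using nat_pow_consistent by metis
  then have "HG.ord x dvd k \<longleftrightarrow> ord x dvd k" for k
    using HG.pow_eq_id[of x k] pow_eq_id[of x k] x by simp
  then show ?thesis by (meson dvd_antisym dvd_refl)
qed

theorem theorem10p2:
  fixes \<alpha> \<beta> :: int
  assumes "\<beta> \<noteq> 1" and "\<alpha> mod 9 = 7" and "\<beta> mod 9 = 1"
  defines "G \<equiv> presG \<alpha> \<beta>"
      and "n \<equiv> multiplicity (3::int) (\<beta> - 1)"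
  defines "A \<equiv> wclass \<alpha> \<beta> wA" and "B \<equiv> wclass \<alpha> \<beta> wB"
  defines "C \<equiv> wclass \<alpha> \<beta> wC"
  defines "G3 \<equiv> G\<lparr>carrier := pelems 3 G\<rparr>"
  defines "a \<equiv> ppart 3 G A" and "b \<equiv> ppart 3 G B" and "c \<equiv> ppart 3 G C"
  shows "card (carrier G3) = 3 ^ (n + 4)
       \<and> nilpotency_class_is G3 3
       \<and> group.ord G3 a = 9
       \<and> group.ord G3 b = 3 ^ (n + 1)
       \<and> group.ord G3 c = 3"
proof -
  have three: "Factorial_Ring.prime (3::nat)" by simp
  interpret M: macdonald G A B \<alpha> \<beta> unfolding G_def A_def B_def by (rule macdonald_presG)
  have gen: "carrier G = generate G {A, B}" unfolding G_def A_def B_def by (rule presG_generated)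
  have C_eq: "C = gcomm G A B" unfolding G_def A_def B_def C_def by (simp add: gcomm_wclass wC_def)
  have "\<beta> - 1 \<noteq> 0" using assms(1) by simp
  then obtain v where v: "\<beta> - 1 = 3 ^ n * v" "\<not> 3 dvd v"
    unfolding n_def using multiplicity_decompose'[of "\<beta> - 1" 3] by auto
  have n2: "n \<ge> 2" unfolding n_def
  proof (rule multiplicity_geI)
    show "3 ^ 2 dvd \<beta> - 1" using assms(3) by simp presburger
  qed (use assms(1) in auto)
  \<comment> \<open>The factor \<open>3 ^ (n + 2)\<close> ensures that \<open>i\<close> below is 1
    modulo 9 and modulo \<open>3 ^ (n + 1)\<close>; the orders of the 3-components are not yet known
    to be that large.\<close>
  obtain L where L: "torsion_macdonald G A B \<alpha> \<beta> L" "3 ^ (n + 2) dvd L"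
    using M.torsion_macdonald_exists[OF gen assms(2,3,1)] by blast
  interpret T: torsion_macdonald G A B \<alpha> \<beta> L by fact
  obtain L' where L': "L = 3 ^ multiplicity 3 L * L'" "\<not> 3 dvd L'"
    using multiplicity_decompose'[of L 3] T.L_pos by auto
  define e where "e = multiplicity 3 L"
  have e: "e \<ge> n + 2" unfolding e_def by (rule multiplicity_geI) (use L(2) T.L_pos in auto)
  obtain i :: int and P P' f M where i: "[i = 1] (mod 3 ^ e)"
    and tor: "(A [^]\<^bsub>G\<^esub> i) [^]\<^bsub>G\<^esub> (3 ^ e :: int) = \<one>\<^bsub>G\<^esub>" "(B [^]\<^bsub>G\<^esub> i) [^]\<^bsub>G\<^esub> (3 ^ e :: int) = \<one>\<^bsub>G\<^esub>"
    and P: "P \<lhd> G" "P' \<lhd> G" "\<forall>x\<in>P. \<forall>y\<in>P'. x \<otimes>\<^bsub>G\<^esub> y = y \<otimes>\<^bsub>G\<^esub> x"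
    and mem: "A [^]\<^bsub>G\<^esub> i \<in> P" "B [^]\<^bsub>G\<^esub> i \<in> P" "A [^]\<^bsub>G\<^esub> (1 - i) \<in> P'" "B [^]\<^bsub>G\<^esub> (1 - i) \<in> P'"
    and f: "\<forall>g\<in>P. g [^]\<^bsub>G\<^esub> (3 ^ f :: int) = \<one>\<^bsub>G\<^esub>"
    and M': "\<forall>g\<in>P'. g [^]\<^bsub>G\<^esub> int M = \<one>\<^bsub>G\<^esub>" "\<not> 3 dvd M" "M > 0"
    using T.three_part_split[OF L'[folded e_def]] .
  interpret P: normal P G by fact
  interpret P': normal P' G by fact
  define x y where "x = A [^]\<^bsub>G\<^esub> i" and "y = B [^]\<^bsub>G\<^esub> i"
  define z where "z = gcomm G x y"
  define x' y' where "x' = A [^]\<^bsub>G\<^esub> (1 - i)" and "y' = B [^]\<^bsub>G\<^esub> (1 - i)"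
  define z' where "z' = gcomm G x' y'"
  have xP: "x \<in> P" "y \<in> P" "z \<in> P" and xP': "x' \<in> P'" "y' \<in> P'" "z' \<in> P'"
    using mem by (simp_all add: x_def y_def z_def x'_def y'_def z'_def gcomm_def)
  have mac: "macdonald G x y \<alpha> \<beta>" and Czz: "gcomm G A B = z \<otimes>\<^bsub>G\<^esub> z'"
    unfolding x_def y_def z_def x'_def y'_def z'_def
    using M.macdonald_component[OF P.subgroup_axioms mem(1,2) P'.subgroup_axioms mem(3,4)] P(3) by blast+
  interpret m: macdonald G x y \<alpha> \<beta> by fact
  have bounds: "x [^]\<^bsub>G\<^esub> (9::int) = \<one>\<^bsub>G\<^esub>" "y [^]\<^bsub>G\<^esub> (3 ^ (n + 1) :: int) = \<one>\<^bsub>G\<^esub>" "z [^]\<^bsub>G\<^esub> (3::int) = \<one>\<^bsub>G\<^esub>"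
    using m.order_bounds[OF tor[folded x_def y_def] assms(2) v n2] by (simp_all add: z_def)
  interpret s: small_macdonald G x y \<alpha> \<beta> n v
    using bounds assms(2) v n2 by unfold_locales (simp_all add: z_def)
  have QP: "s.Q \<subseteq> P"
  proof
    fix g assume "g \<in> s.Q"
    then obtain p q r where "g = s.nf p q r" by (auto simp: s.Q_def)
    then show "g \<in> P"
      using xP M.subgroup_int_pow_closed[OF P.subgroup_axioms] by (simp add: s.nf_def z_def)
  qed
  interpret Q: subgroup s.Q G by (rule s.subgroup_Q)
  have gens: "x \<in> s.Q" "y \<in> s.Q" "z \<in> s.Q"
    using s.generators_in_Q[of 1] by (simp_all add: z_def)
  have comm: "g \<otimes>\<^bsub>G\<^esub> h = h \<otimes>\<^bsub>G\<^esub> g" if "g \<in> s.Q" "h \<in> P'" for g h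
    using P(3) QP that by blast
  have AB: "A = x \<otimes>\<^bsub>G\<^esub> x'" "B = y \<otimes>\<^bsub>G\<^esub> y'"
    using M.int_pow_mult[of A i "1 - i"] M.int_pow_mult[of B i "1 - i"]
    by (simp_all add: x_def y_def x'_def y'_def)
  \<comment> \<open>\<open>P\<close> might a priori be larger than the set of normal forms, but the
    generators already split over \<open>s.Q\<close> and \<open>P'\<close>, hence so does the whole
    group.\<close>
  have pel: "pelems 3 G = s.Q"
  proof (rule M.pelems_eq_factor[OF three])
    show "\<exists>p\<in>s.Q. \<exists>q\<in>P'. g = p \<otimes>\<^bsub>G\<^esub> q" if "g \<in> carrier G" for g
    proof (rule M.generate_product_decomposition[OF s.subgroup_Q P'.subgroup_axioms])
      show "g \<in> generate G {A, B}" using that gen by simp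
      show "\<exists>p\<in>s.Q. \<exists>q\<in>P'. t = p \<otimes>\<^bsub>G\<^esub> q" if "t \<in> {A, B}" for t
        using that AB gens xP' by blast
    qed (rule comm)
    show "g [^]\<^bsub>G\<^esub> int (3 ^ f) = \<one>\<^bsub>G\<^esub>" if "g \<in> s.Q" for g using f QP that by auto
  qed (use comm M' Q.subset P'.subset in auto)
  have G3: "G3 = G\<lparr>carrier := s.Q\<rparr>" by (simp add: G3_def pel)
  have abc: "a = x" "b = y" "c = z"
  proof -
    have pp: "ppart 3 G (g \<otimes>\<^bsub>G\<^esub> h) = g" if "g \<in> P" "h \<in> P'" for g h
      by (rule M.ppart_unique[OF three, where k = f and M = M]) (use that f M' P(3) in auto)
    show "a = x" unfolding a_def AB(1) using xP(1) xP'(1) by (rule pp)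
    show "b = y" unfolding b_def AB(2) using xP(2) xP'(2) by (rule pp)
    show "c = z" unfolding c_def C_eq Czz using xP(3) xP'(3) by (rule pp)
  qed
  interpret mo: model n v "\<beta> - 1" by unfold_locales (use n2 v in auto)
  have i9: "[i = 1] (mod 9)"
    using cong_dvd_modulus[OF i, of 9] le_imp_power_dvd[of 2 e "3::int"] e by simp
  have im: "[i = 1] (mod mo.m)" unfolding mo.m_def
    using cong_dvd_modulus[OF i] le_imp_power_dvd[of "n + 1" e "3::int"] e by simp
  \<comment> \<open>Since \<open>i\<close> is 1 modulo both 9 and \<open>mo.m\<close>, the
    components \<open>x\<close> and \<open>y\<close> act on the triples of the model with \<xi> =
    \<open>\<beta> - 1\<close> just as \<open>A\<close> and \<open>B\<close> do, so the model
    separates their normal forms.\<close>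
  have dist: "[p = p'] (mod 9)" "[q = q'] (mod 3 ^ (n + 1))" "[r = r'] (mod 3)"
    if "s.nf p q r = s.nf p' q' r'" "r \<ge> 0" "r' \<ge> 0" for p q r p' q' r'
    using mo.normal_forms_distinct[OF assms(2) _ i9 im
        that(1)[unfolded s.nf_def, unfolded x_def y_def A_def B_def G_def] that(2,3)]
    by (simp_all add: mo.m_def)
  have "inj_on (\<lambda>(p, q, r). s.nf (int p) (int q) (int r)) s.Qbox"
  proof (rule inj_onI)
    fix t t' assume t: "t \<in> s.Qbox" "t' \<in> s.Qbox"
      "(\<lambda>(p, q, r). s.nf (int p) (int q) (int r)) t = (\<lambda>(p, q, r). s.nf (int p) (int q) (int r)) t'"
    obtain p q r p' q' r' where tt: "t = (p, q, r)" "t' = (p', q', r')" by (metis surj_pair)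
    have "[int p = int p'] (mod 9)" "[int q = int q'] (mod 3 ^ (n + 1))" "[int r = int r'] (mod 3)"
      using dist[of "int p" "int q" "int r"] t(3) by (simp_all add: tt)
    then have "[int p = int p'] (mod int 9)" "[int q = int q'] (mod int (3 ^ (n + 1)))" "[int r = int r'] (mod int 3)"
      by simp_all
    then have "[p = p'] (mod 9)" "[q = q'] (mod 3 ^ (n + 1))" "[r = r'] (mod 3)"
      by (simp_all only: cong_int_iff)
    then show "t = t'" using t(1,2) by (auto simp: tt s.Qbox_def cong_def)
  qed
  then have card: "card s.Q = 3 ^ (n + 4)"
    unfolding s.Q_eq_image by (simp add: card_image s.card_Qbox)
  have "M.ord x = 9"
  proof (rule dvd_antisym)
    show "M.ord x dvd 9" using bounds(1) M.int_pow_eq_id[of x 9] by simp presburger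
    have "s.nf (int (M.ord x)) 0 0 = s.nf 0 0 0"
      using M.int_pow_eq_id[of x "int (M.ord x)"] by (simp add: s.nf_def)
    then have "[int (M.ord x) = 0] (mod 9)" using dist(1) by blast
    then show "9 dvd M.ord x" by (simp add: cong_0_iff) presburger
  qed
  moreover have "M.ord y = 3 ^ (n + 1)"
  proof (rule dvd_antisym)
    have "int (M.ord y) dvd int (3 ^ (n + 1))" using bounds(2) M.int_pow_eq_id[of y "3 ^ (n + 1)"] by simp
    then show "M.ord y dvd 3 ^ (n + 1)" by (simp only: int_dvd_int_iff)
    have "s.nf 0 (int (M.ord y)) 0 = s.nf 0 0 0"
      using M.int_pow_eq_id[of y "int (M.ord y)"] by (simp add: s.nf_def)
    then have "[int (M.ord y) = 0] (mod 3 ^ (n + 1))" using dist(2) by blast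
    then have "int (3 ^ (n + 1)) dvd int (M.ord y)" by (simp add: cong_0_iff)
    then show "3 ^ (n + 1) dvd M.ord y" by (simp only: int_dvd_int_iff)
  qed
  moreover have "M.ord z = 3"
  proof (rule dvd_antisym)
    show "M.ord z dvd 3" using bounds(3) M.int_pow_eq_id[of z 3] by (simp add: z_def) presburger
    have "s.nf 0 0 (int (M.ord z)) = s.nf 0 0 0"
      using M.int_pow_eq_id[of z "int (M.ord z)"] by (simp add: s.nf_def z_def)
    then have "[int (M.ord z) = 0] (mod 3)" using dist(3) by auto
    then show "3 dvd M.ord z" by (simp add: cong_0_iff) presburger
  qed
  moreover have "nilpotency_class_is G3 3"
  proof -
    \<comment> \<open>The class refers to the lower central series formed inside \<open>G3\<close>,
      so the relations and bounds are transferred to it as a group of its own.\<close>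
    have gc: "gcomm G3 x y = z" and mac3: "macdonald G3 x y \<alpha> \<beta>"
      unfolding G3 z_def using M.macdonald_subgroup[OF s.subgroup_Q mac gens(1,2)] by blast+
    interpret m3: macdonald G3 x y \<alpha> \<beta> by fact
    have pw: "g [^]\<^bsub>G3\<^esub> k = g [^]\<^bsub>G\<^esub> k" if "g \<in> s.Q" for g and k :: int
      unfolding G3 using M.int_pow_consistent[OF s.subgroup_Q that] by simp
    have ops: "\<one>\<^bsub>G3\<^esub> = \<one>\<^bsub>G\<^esub>" "g \<otimes>\<^bsub>G3\<^esub> h = g \<otimes>\<^bsub>G\<^esub> h" for g h by (simp_all add: G3)
    interpret s3: small_macdonald G3 x y \<alpha> \<beta> n v
      using bounds assms(2) v n2 gens by unfold_locales (simp_all add: gc pw ops)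
    have nf: "s3.nf p q r = s.nf p q r" for p q r
      unfolding s3.nf_def s.nf_def gc ops z_def[symmetric] using gens by (simp add: pw)
    have "carrier G3 = s.Q" by (simp add: G3)
    also have "\<dots> = s3.Q" unfolding s3.Q_def s.Q_def nf ..
    finally interpret f3: full_small_macdonald G3 x y \<alpha> \<beta> n v by unfold_locales
    \<comment> \<open>\<open>1 - \<alpha>\<close> is 3 modulo 9, while \<open>x\<close> has order
      9.\<close>
    have "x [^]\<^bsub>G\<^esub> (1 - \<alpha>) \<noteq> \<one>\<^bsub>G\<^esub>"
    proof
      assume "x [^]\<^bsub>G\<^esub> (1 - \<alpha>) = \<one>\<^bsub>G\<^esub>"
      then have "int 9 dvd 1 - \<alpha>" using M.int_pow_eq_id[of x "1 - \<alpha>"] \<open>M.ord x = 9\<close> by simp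
      then show False using assms(2) by presburger
    qed
    then show ?thesis using f3.nilpotency_class_three gens by (simp add: pw ops)
  qed
  ultimately show ?thesis
    using card gens by (simp add: abc G3 M.ord_subgroup[OF s.subgroup_Q])
qed

end
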